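(* Let $G=SU(2)$ and let $Z_G^3(s)=\int_G\zeta_G(s,g)^3\,dg$, defined by this integral for $\operatorname{Re}(s)>1$. Then in the region $\operatorname{Re}(s)>0$, $$Z_G^3(s)=\sum_{m_1,m_2,m_3\ge0}\bigl((m_1+m_2+1)(m_2+m_3+1)(m_3+m_1+1)\bigr)^{-s-1},$$ where the series on the right converges absolutely for $\operatorname{Re}(s)>0$ and gives the (analytic continuation of) $Z_G^3(s)$ there. Moreover, $Z_G^3(s)$ continues meromorphically to all $s\in\mathbb{C}$.
   Context: $dg$ is the normalized Haar measure on $SU(2)$. The irreducible unitary representations of $SU(2)$ are the symmetric powers $\mathrm{Sym}^{n-1}$ ($n\ge1$) of dimension $n$, and for $g\in SU(2)$ the Witten $L$-function is $$\zeta_{SU(2)}(s,g)=\sum_{n=1}^\infty\frac{\operatorname{tr}(\mathrm{Sym}^{n-1}(g))}{n^{s+1}},$$ absolutely convergent for $\operatorname{Re}(s)>1$. *)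

theory Defs
  imports "HOL-Complex_Analysis.Complex_Analysis" "HOL-Probability.Probability"
begin

definition conj_transpose :: "complex^'n^'m \<Rightarrow> complex^'m^'n" where
  "conj_transpose A = (\<chi> i j. cnj (A $ j $ i))"

definition SU2 :: "(complex^2^2) set" where
  "SU2 = {A. conj_transpose A ** A = mat 1 \<and> det A = 1}"

text \<open>A left-invariant Borel probability measure on the compact group SU(2); by uniqueness of
  Haar measure there is exactly one. Its underlying space is SU(2) because \<^term>\<open>sets\<close>
  determines \<^term>\<open>space\<close>.\<close>

definition normalized_haar_SU2 :: "(complex^2^2) measure \<Rightarrow> bool" where
  "normalized_haar_SU2 \<mu> \<longleftrightarrow>
     sets \<mu> = sets (restrict_space borel SU2) \<and> prob_space \<mu> \<and>
     (\<forall>g\<in>SU2. \<forall>A\<in>sets \<mu>. emeasure \<mu> ((\<lambda>h. g ** h) ` A) = emeasure \<mu> A)"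

text \<open>The \<open>k\<close>-th symmetric power of the standard representation on \<open>V = span(X, Y)\<close>, as the
  matrix with respect to the basis \<open>X^(k-j) Y^j\<close> (\<open>0 \<le> j \<le> k\<close>) of the homogeneous
  polynomials of degree \<open>k\<close>. Bivariate polynomials are elements of \<open>complex[X][Y]\<close>: in
  \<open>[:p, q:]\<close> the entry \<open>p\<close> is free of \<open>Y\<close> and \<open>q\<close> is the coefficient of \<open>Y\<close>.\<close>

definition act_X :: "complex^2^2 \<Rightarrow> complex poly poly" where
  "act_X g = [:[:0, g $ 1 $ 1:], [:g $ 2 $ 1:]:]"  \<comment> \<open>\<open>g X = g11 X + g21 Y\<close>\<close>

definition act_Y :: "complex^2^2 \<Rightarrow> complex poly poly" where
  "act_Y g = [:[:0, g $ 1 $ 2:], [:g $ 2 $ 2:]:]"  \<comment> \<open>\<open>g Y = g12 X + g22 Y\<close>\<close>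

text \<open>Entry in row \<open>i\<close>, column \<open>j\<close> (for \<open>i, j \<le> k\<close>): the coefficient of \<open>X^(k-i) Y^i\<close> in
  \<open>g (X^(k-j) Y^j) = (g X)^(k-j) (g Y)^j\<close>.\<close>

definition Sym_power :: "nat \<Rightarrow> complex^2^2 \<Rightarrow> nat \<Rightarrow> nat \<Rightarrow> complex" where
  "Sym_power k g i j = coeff (coeff (act_X g ^ (k - j) * act_Y g ^ j) i) (k - i)"

definition tr_Sym :: "nat \<Rightarrow> complex^2^2 \<Rightarrow> complex" where
  "tr_Sym k g = (\<Sum>i\<le>k. Sym_power k g i i)"

definition witten_L_SU2 :: "complex \<Rightarrow> complex^2^2 \<Rightarrow> complex" where
  "witten_L_SU2 s g = (\<Sum>\<^sub>\<infinity>n\<in>{1..}. tr_Sym (n - 1) g / of_nat n powr (s + 1))"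

end

theory Submission
  imports Defs
begin

text \<open>
  The character of the \<open>k\<close>-th symmetric power satisfies the Chebyshev recursion, hence the
  Clebsch-Gordan rule, and all nontrivial characters integrate to 0. So the integral of
  \<open>\<chi>\<^sub>x \<chi>\<^sub>y \<chi>\<^sub>z\<close> is 1 if \<open>x = a + b\<close>, \<open>y = b + c\<close>, \<open>z = c + a\<close> for some natural numbers
  \<open>a, b, c\<close>, and 0 otherwise; by dominated convergence this gives the triple series.

  For the continuation, consider more generally \<open>\<Sum> f(a+b+1) g(b+c+1) h(c+a+1)\<close> with functions
  \<open>f, g, h\<close> of \<open>(s, n)\<close> that have an asymptotic expansion \<open>\<Sum>\<^sub>j c\<^sub>j(s) n^(-s-k-j)\<close>, with remainders
  bounded locally uniformly in \<open>s\<close>. Translation by \<open>(1, 1, -1)\<close> changes only the first linear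
  form, so summing a difference along it expresses the series through two-dimensional Tornheim
  sums on the faces and through series in which \<open>f\<close> has a larger order \<open>k\<close>. The
  Tornheim sums are treated in the same way. Once all orders are large, the series converges and is
  holomorphic in a prescribed half-plane.
\<close>

section \<open>Functions with an asymptotic expansion in powers of n\<close>

text \<open>The obstacle is that the difference of a power of \<open>n\<close> and its shift is not
  a power again but has terms of all lower orders, so a class closed under taking remainders is
  needed. All linear forms carry the same \<open>s\<close>; hence the integer order \<open>k\<close>
  is raised and \<open>s\<close> is never moved. The second Taylor coefficient of a shift is affine
  in \<open>s\<close>, and dividing by such affine factors is the only source of poles. Three linear
  forms in three variables admit a translation that moves just one of them, so a triangle sum is the
  single unknown of its identity. In two variables this is impossible: shifting one index of a
  Tornheim sum moves two of its three forms and leaves two unknowns, which are separated by the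
  linear relation between the arguments. The orders met on the way can be zero or negative, so the
  sums satisfy their identities only for large real part. The continuations obtained from these
  identities are matched by the identity theorem.\<close>

definition cpow :: "int \<Rightarrow> complex \<Rightarrow> nat \<Rightarrow> complex" where
  "cpow k s n = of_nat n powr (- s - of_int k)"

text \<open>\<open>C\<close> depends only on the radius \<open>R\<close>, so the bounds are locally
  uniform in \<open>s\<close>, as the Weierstrass test needs. Nothing is asked at
  \<open>n = 0\<close>; the sums below evaluate at arguments \<open>Suc _\<close>.\<close>

definition order_bound :: "int \<Rightarrow> (complex \<Rightarrow> nat \<Rightarrow> complex) \<Rightarrow> bool" where
  "order_bound k f \<longleftrightarrow> (\<forall>R. \<exists>C. \<forall>s n. norm s \<le> R \<longrightarrow> n \<ge> 1 \<longrightarrow>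
     norm (f s n) \<le> C * real n powr (- Re s - of_int k))"

text \<open>The case \<open>J = 0\<close> bounds \<open>f\<close> itself. The expansion need not
  converge as \<open>J\<close> grows; only its truncations are used.\<close>

definition asymp_exp :: "int \<Rightarrow> (nat \<Rightarrow> complex \<Rightarrow> complex) \<Rightarrow> (complex \<Rightarrow> nat \<Rightarrow> complex) \<Rightarrow> bool" where
  "asymp_exp k c f \<longleftrightarrow>
     (\<forall>n\<ge>1. (\<lambda>s. f s n) holomorphic_on UNIV) \<and> (\<forall>j. c j holomorphic_on UNIV) \<and>
     (\<forall>J. order_bound (k + int J) (\<lambda>s n. f s n - (\<Sum>j<J. c j s * cpow (k + int j) s n)))"

definition symbol :: "int \<Rightarrow> (complex \<Rightarrow> nat \<Rightarrow> complex) \<Rightarrow> bool" where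
  "symbol k f \<longleftrightarrow> (\<exists>c. asymp_exp k c f)"

lemma cpow_holomorphic: "n \<ge> 1 \<Longrightarrow> (\<lambda>s. cpow k s n) holomorphic_on A"
  unfolding cpow_def by (intro holomorphic_intros) auto

lemma norm_cpow: "n \<ge> 1 \<Longrightarrow> norm (cpow k s n) = real n powr (- Re s - of_int k)"
  unfolding cpow_def by (subst norm_powr_real_powr) auto

lemma cpow_1 [simp]: "cpow k s (Suc 0) = 1"
  by (simp add: cpow_def)

lemma cpow_mult_nat: "n \<ge> 1 \<Longrightarrow> of_nat n * cpow k s n = cpow (k - 1) s n"
proof -
  assume "n \<ge> 1"
  then have "of_nat n * cpow k s n = of_nat n powr 1 * of_nat n powr (- s - of_int k)"
    by (simp add: cpow_def)
  also have "\<dots> = cpow (k - 1) s n"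
    by (subst powr_add [symmetric]) (simp add: cpow_def algebra_simps)
  finally show ?thesis .
qed

lemma order_boundD:
  assumes "order_bound k f"
  obtains C where "C \<ge> 0"
    "\<And>s n. norm s \<le> R \<Longrightarrow> n \<ge> 1 \<Longrightarrow> norm (f s n) \<le> C * real n powr (- Re s - of_int k)"
proof -
  obtain C where C: "\<And>s n. norm s \<le> R \<Longrightarrow> n \<ge> 1 \<Longrightarrow> norm (f s n) \<le> C * real n powr (- Re s - of_int k)"
    using assms unfolding order_bound_def by meson
  show ?thesis
  proof (rule that[of "\<bar>C\<bar>"])
    fix s :: complex and n assume "norm s \<le> R" "n \<ge> (1::nat)"
    with C[of s n] have "norm (f s n) \<le> C * real n powr (- Re s - of_int k)" by blast
    also have "\<dots> \<le> \<bar>C\<bar> * real n powr (- Re s - of_int k)" by (intro mult_right_mono) auto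
    finally show "norm (f s n) \<le> \<bar>C\<bar> * real n powr (- Re s - of_int k)" .
  qed auto
qed

lemma order_bound_cong: "(\<And>s n. n \<ge> 1 \<Longrightarrow> f s n = g s n) \<Longrightarrow> order_bound k f \<longleftrightarrow> order_bound k g"
  unfolding order_bound_def by simp

lemma order_bound_cpow: "order_bound k (cpow k)"
  unfolding order_bound_def by (intro allI exI[of _ 1]) (auto simp: norm_cpow)

lemma order_bound_zero: "order_bound k (\<lambda>_ _. 0)"
  unfolding order_bound_def by (intro allI exI[of _ 0]) auto

lemma order_bound_mult_entire:
  assumes "order_bound k f" "c holomorphic_on UNIV" shows "order_bound k (\<lambda>s n. c s * f s n)"
  unfolding order_bound_def
proof
  fix R
  obtain C where C: "C \<ge> 0" "\<And>s n. norm s \<le> R \<Longrightarrow> n \<ge> 1 \<Longrightarrow> norm (f s n) \<le> C * real n powr (- Re s - of_int k)"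
    using order_boundD[OF assms(1), of R] by metis
  have "compact (c ` cball 0 R)"
    by (intro compact_continuous_image)
      (use assms(2) in \<open>auto intro: holomorphic_on_imp_continuous_on holomorphic_on_subset\<close>)
  then obtain D where D: "\<And>s. norm s \<le> R \<Longrightarrow> norm (c s) \<le> D"
    using compact_imp_bounded bounded_iff by (metis (no_types, lifting) image_eqI mem_cball_0)
  show "\<exists>C. \<forall>s n. norm s \<le> R \<longrightarrow> n \<ge> 1 \<longrightarrow> norm (c s * f s n) \<le> C * real n powr (- Re s - of_int k)"
  proof (intro exI[of _ "D * C"] allI impI)
    fix s :: complex and n assume *: "norm s \<le> R" "n \<ge> (1::nat)"
    have "D \<ge> 0" using D[OF *(1)] norm_ge_zero order_trans by blast
    then have "norm (c s) * norm (f s n) \<le> D * (C * real n powr (- Re s - of_int k))"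
      by (intro mult_mono D C * ) auto
    then show "norm (c s * f s n) \<le> D * C * real n powr (- Re s - of_int k)"
      by (simp add: norm_mult mult_ac)
  qed
qed

lemma order_bound_mult_nat:
  assumes "order_bound k f" shows "order_bound (k - 1) (\<lambda>s n. of_nat n * f s n)"
  unfolding order_bound_def
proof
  fix R
  obtain C where C: "C \<ge> 0" "\<And>s n. norm s \<le> R \<Longrightarrow> n \<ge> 1 \<Longrightarrow> norm (f s n) \<le> C * real n powr (- Re s - of_int k)"
    using order_boundD[OF assms(1), of R] by metis
  show "\<exists>C. \<forall>s n. norm s \<le> R \<longrightarrow> n \<ge> 1 \<longrightarrow> norm (of_nat n * f s n) \<le> C * real n powr (- Re s - of_int (k - 1))"
  proof (intro exI[of _ "C"] allI impI)
    fix s :: complex and n assume *: "norm s \<le> R" "n \<ge> (1::nat)"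
    have "norm (of_nat n * f s n) \<le> real n powr 1 * (C * real n powr (- Re s - of_int k))"
      unfolding norm_mult by (intro mult_mono C * ) (use * in auto)
    also have "\<dots> = C * (real n powr 1 * real n powr (- Re s - of_int k))" by simp
    also have "\<dots> = C * real n powr (- Re s - of_int (k - 1))"
      by (subst powr_add[symmetric]) (simp add: algebra_simps)
    finally show "norm (of_nat n * f s n) \<le> C * real n powr (- Re s - of_int (k - 1))" .
  qed
qed

lemma asymp_exp_cpow: "asymp_exp k (\<lambda>j s. if j = 0 then 1 else 0) (cpow k)"
  unfolding asymp_exp_def
proof (intro conjI allI impI)
  fix J
  have "(\<lambda>s n. cpow k s n - (\<Sum>j<J. (if j = 0 then 1 else 0) * cpow (k + int j) s n)) =
        (if J = 0 then cpow k else (\<lambda>s n. 0))"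
  proof (cases "J = 0")
    case False
    then have "(\<Sum>j<J. (if j = 0 then 1 else 0) * cpow (k + int j) s n) =
      (\<Sum>j\<in>{0}. (if j = 0 then 1 else 0) * cpow (k + int j) s n)" for s n
      by (intro sum.mono_neutral_right) auto
    with False show ?thesis by simp
  qed auto
  then show "order_bound (k + int J) (\<lambda>s n. cpow k s n - (\<Sum>j<J. (if j = 0 then 1 else 0) * cpow (k + int j) s n))"
    by (simp add: order_bound_cpow order_bound_zero)
qed (auto intro: cpow_holomorphic)

lemma symbol_cpow: "symbol k (cpow k)"
  using asymp_exp_cpow symbol_def by blast

lemma symbol_order_bound: "symbol k f \<Longrightarrow> order_bound k f"
  unfolding symbol_def asymp_exp_def by (auto dest: spec[of _ "0::nat"])

lemma symbol_holomorphic: "symbol k f \<Longrightarrow> n \<ge> 1 \<Longrightarrow> (\<lambda>s. f s n) holomorphic_on A"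
  unfolding symbol_def asymp_exp_def using holomorphic_on_subset by blast

lemma asymp_exp_tail:
  assumes "asymp_exp k c f"
  shows "asymp_exp (k + 1) (\<lambda>j. c (Suc j)) (\<lambda>s n. f s n - c 0 s * cpow k s n)"
  unfolding asymp_exp_def
proof (intro conjI allI impI)
  fix n assume "n \<ge> (1::nat)"
  then show "(\<lambda>s. f s n - c 0 s * cpow k s n) holomorphic_on UNIV"
    using assms unfolding asymp_exp_def by (auto intro!: holomorphic_intros cpow_holomorphic)
next
  fix J
  have "order_bound (k + int (Suc J)) (\<lambda>s n. f s n - (\<Sum>j<Suc J. c j s * cpow (k + int j) s n))"
    using assms unfolding asymp_exp_def by blast
  then show "order_bound (k + 1 + int J)
     (\<lambda>s n. f s n - c 0 s * cpow k s n - (\<Sum>j<J. c (Suc j) s * cpow (k + 1 + int j) s n))"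
    by (subst (asm) sum.lessThan_Suc_shift) (simp add: algebra_simps)
qed (use assms in \<open>auto simp: asymp_exp_def\<close>)

text \<open>Reduces claims about all symbols to pure powers, at the price of a symbol one order
  higher, which an induction hypothesis covers.\<close>

lemma symbol_decomp:
  assumes "symbol k f"
  obtains c r where "c holomorphic_on UNIV" "symbol (k + 1) r" "\<And>s n. f s n = c s * cpow k s n + r s n"
proof -
  obtain c where c: "asymp_exp k c f" using assms by (auto simp: symbol_def)
  show ?thesis
    by (rule that[of "c 0" "\<lambda>s n. f s n - c 0 s * cpow k s n"])
      (use c asymp_exp_tail[OF c] in \<open>auto simp: symbol_def asymp_exp_def\<close>)
qed

lemma asymp_exp_mult_entire:
  assumes "asymp_exp k c f" "a holomorphic_on UNIV"
  shows "asymp_exp k (\<lambda>j s. a s * c j s) (\<lambda>s n. a s * f s n)"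
  unfolding asymp_exp_def
proof (intro conjI allI impI)
  fix J
  have "order_bound (k + int J) (\<lambda>s n. a s * (f s n - (\<Sum>j<J. c j s * cpow (k + int j) s n)))"
    using assms by (intro order_bound_mult_entire) (auto simp: asymp_exp_def)
  then show "order_bound (k + int J) (\<lambda>s n. a s * f s n - (\<Sum>j<J. a s * c j s * cpow (k + int j) s n))"
    by (simp add: algebra_simps sum_distrib_left)
qed (use assms in \<open>auto simp: asymp_exp_def intro!: holomorphic_intros\<close>)

lemma symbol_mult_entire: "symbol k f \<Longrightarrow> a holomorphic_on UNIV \<Longrightarrow> symbol k (\<lambda>s n. a s * f s n)"
  unfolding symbol_def using asymp_exp_mult_entire by blast

lemma symbol_uminus: "symbol k f \<Longrightarrow> symbol k (\<lambda>s n. - f s n)"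
  using symbol_mult_entire[of k f "\<lambda>_. -1"] by simp

lemma symbol_mult_nat:
  assumes "symbol k f" shows "symbol (k - 1) (\<lambda>s n. of_nat n * f s n)"
proof -
  obtain c where c: "asymp_exp k c f" using assms by (auto simp: symbol_def)
  have "asymp_exp (k - 1) c (\<lambda>s n. of_nat n * f s n)"
    unfolding asymp_exp_def
  proof (intro conjI allI impI)
    fix J
    have "order_bound (k + int J - 1) (\<lambda>s n. of_nat n * (f s n - (\<Sum>j<J. c j s * cpow (k + int j) s n)))"
      using c by (intro order_bound_mult_nat) (auto simp: asymp_exp_def)
    moreover have "of_nat n * (f s n - (\<Sum>j<J. c j s * cpow (k + int j) s n)) =
       of_nat n * f s n - (\<Sum>j<J. c j s * cpow (k - 1 + int j) s n)" if "n \<ge> 1" for s n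
    proof -
      have "of_nat n * (c j s * cpow (k + int j) s n) = c j s * cpow (k - 1 + int j) s n" for j
        using cpow_mult_nat[OF that, of "k + int j" s] by (simp add: algebra_simps)
      then show ?thesis by (simp only: right_diff_distrib sum_distrib_left)
    qed
    ultimately show "order_bound (k - 1 + int J) (\<lambda>s n. of_nat n * f s n - (\<Sum>j<J. c j s * cpow (k - 1 + int j) s n))"
      by (subst (asm) order_bound_cong) (auto simp: algebra_simps)
  qed (use c in \<open>auto simp: asymp_exp_def intro!: holomorphic_intros\<close>)
  then show ?thesis by (auto simp: symbol_def)
qed

section \<open>Shifts of a power and their Taylor expansions\<close>

lemma powr_shift_bound:
  fixes n a y e :: real
  assumes "1 \<le> n" "0 \<le> a" "n \<le> y" "y \<le> n + a"
  shows "y powr e \<le> n powr e * (1 + a) powr \<bar>e\<bar>"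
proof (cases "e \<ge> 0")
  case True
  have "a * 1 \<le> a * n" using assms by (intro mult_left_mono) auto
  then have "y \<le> n * (1 + a)" using assms by (simp add: algebra_simps)
  then have "y powr e \<le> (n * (1 + a)) powr e"
    using True assms by (intro powr_mono2) auto
  with True assms show ?thesis by (simp add: powr_mult)
next
  case False
  then have "y powr e \<le> n powr e * 1" using assms by (simp add: powr_mono2')
  also have "\<dots> \<le> n powr e * (1 + a) powr \<bar>e\<bar>"
    using assms by (intro mult_left_mono ge_one_powr_ge_zero) auto
  finally show ?thesis .
qed

text \<open>Taylor's formula for \<open>y powr w\<close> with \<open>w = - s - of_int k\<close>,
  from \<open>n\<close> to \<open>n + a\<close>; the product is the falling factorial of
  \<open>w\<close>. The binomial series need not converge for \<open>n < a\<close>, whereas the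
  finite formula controls the remainder for every \<open>n\<close> from 1 on.\<close>

lemma asymp_exp_shift:
  "asymp_exp k (\<lambda>j s. of_nat a ^ j / fact j * (\<Prod>l<j. - s - of_int k - of_nat l)) (\<lambda>s n. cpow k s (n + a))"
  unfolding asymp_exp_def
proof (intro conjI allI impI)
  fix J :: nat
  show "order_bound (k + int J) (\<lambda>s n. cpow k s (n + a) -
      (\<Sum>j<J. of_nat a ^ j / fact j * (\<Prod>l<j. - s - of_int k - of_nat l) * cpow (k + int j) s n))"
  proof (cases J)
    \<comment> \<open>Taylor's theorem always removes at least the term of index 0, so the bare size
      bound is proved separately.\<close>
    case 0
    have "order_bound k (\<lambda>s n. cpow k s (n + a))"
      unfolding order_bound_def
    proof (intro allI exI impI)
      fix R and s :: complex and n :: nat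
      assume *: "norm s \<le> R" "1 \<le> n"
      have "\<bar>Re s\<bar> \<le> R" using *(1) abs_Re_le_cmod order_trans by blast
      then have e: "\<bar>- Re s - of_int k\<bar> \<le> R + \<bar>of_int k\<bar>" by linarith
      have "norm (cpow k s (n + a)) = real (n + a) powr (- Re s - of_int k)"
        using * by (intro norm_cpow) auto
      also have "\<dots> \<le> real n powr (- Re s - of_int k) * (1 + real a) powr \<bar>- Re s - of_int k\<bar>"
        using * by (intro powr_shift_bound) auto
      also have "\<dots> \<le> real n powr (- Re s - of_int k) * (1 + real a) powr (R + \<bar>of_int k\<bar>)"
        using e by (intro mult_left_mono powr_mono) auto
      finally show "norm (cpow k s (n + a)) \<le> (1 + real a) powr (R + \<bar>of_int k\<bar>) * real n powr (- Re s - of_int k)"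
        by (simp add: mult_ac)
    qed
    with 0 show ?thesis by simp
  next
    case (Suc J')
    show ?thesis unfolding order_bound_def
    proof (intro allI exI impI)
      fix R and s :: complex and n :: nat
      assume *: "norm s \<le> R" "1 \<le> n"
      define w where "w = - s - of_int k"
      define f where "f = (\<lambda>i y. (\<Prod>l<i. w - of_nat l) * y powr (w - of_nat i))"
      \<comment> \<open>The segment consists of reals that are at least 1, hence avoids the branch
        cut of \<open>powr\<close>.\<close>
      define S where "S = closed_segment (of_nat n) (of_nat (n + a) :: complex)"
      have S: "\<exists>t. y = of_real t \<and> real n \<le> t \<and> t \<le> real n + real a" if y: "y \<in> S" for y
      proof -
        from y obtain u where u: "0 \<le> u" "u \<le> 1" "y = (1 - u) *\<^sub>R of_nat n + u *\<^sub>R of_nat (n + a)"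
          unfolding S_def in_segment by blast
        then have "y = of_real (real n + u * real a)" by (simp add: algebra_simps scaleR_conv_of_real)
        moreover have "u * real a \<le> 1 * real a" using u by (intro mult_right_mono) auto
        ultimately show ?thesis using u by (intro exI[of _ "real n + u * real a"]) auto
      qed
      define e where "e = - Re s - of_int (k + int J)"
      \<comment> \<open>\<open>P\<close> bounds the falling factorial: \<open>J\<close> factors,
        each of norm at most \<open>R + |k| + J\<close>. Together with the comparison of powers on
        the segment this gives the bound \<open>B\<close> for the \<open>J\<close>-th
        derivative.\<close>
      define P where "P = (R + \<bar>of_int k\<bar> + real J) ^ J"
      define B where "B = P * (real n powr e * (1 + real a) powr (R + \<bar>of_int (k + int J)\<bar>))"
      have "R \<ge> 0" using *(1) norm_ge_zero order_trans by blast
      have Re: "\<bar>Re s\<bar> \<le> R" using *(1) abs_Re_le_cmod order_trans by blast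
      then have e: "\<bar>e\<bar> \<le> R + \<bar>of_int (k + int J)\<bar>" unfolding e_def by linarith
      have prod: "norm (\<Prod>l<J. w - of_nat l) \<le> P"
      proof -
        have "norm (w - of_nat l) \<le> R + \<bar>of_int k\<bar> + real J" if "l < J" for l
        proof -
          have "norm (w - of_nat l) \<le> norm s + norm (of_int k :: complex) + norm (of_nat l :: complex)"
            unfolding w_def by (intro order.trans[OF norm_triangle_ineq4] add_mono order.refl) auto
          with * that show ?thesis by simp
        qed
        then have "norm (\<Prod>l<J. w - of_nat l) \<le> (\<Prod>l<J. R + \<bar>of_int k\<bar> + real J)"
          unfolding prod_norm[symmetric] by (intro prod_mono) auto
        then show ?thesis by (simp add: P_def)
      qed
      have "norm (f 0 (of_nat (n + a)) - (\<Sum>i\<le>J'. f i (of_nat n) * (of_nat (n + a) - of_nat n) ^ i / fact i))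
         \<le> B * norm (of_nat (n + a) - of_nat n :: complex) ^ Suc J' / fact J'"
      proof (rule complex_Taylor[of S])
        show "convex S" by (simp add: S_def)
        show "of_nat n \<in> S" "of_nat (n + a) \<in> S" by (auto simp: S_def)
      next
        fix i y assume "y \<in> S" "i \<le> J'"
        then obtain t where t: "y = of_real t" "real n \<le> t" using S by blast
        then have "y \<notin> \<real>\<^sub>\<le>\<^sub>0" "y \<noteq> 0" using * by (auto simp: complex_nonpos_Reals_iff)
        then have "((\<lambda>y. (\<Prod>l<i. w - of_nat l) * y powr (w - of_nat i)) has_field_derivative
            (\<Prod>l<i. w - of_nat l) * ((w - of_nat i) * y powr (w - of_nat i - 1))) (at y within S)"
          by (intro DERIV_cmult has_field_derivative_at_within[OF has_field_derivative_powr])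
        moreover have "w - of_nat i - 1 = w - of_nat (Suc i)" by simp
        ultimately show "(f i has_field_derivative f (Suc i) y) (at y within S)"
          unfolding f_def by (simp only: prod.lessThan_Suc mult.assoc)
      next
        fix y assume "y \<in> S"
        then obtain t where t: "y = of_real t" "real n \<le> t" "t \<le> real n + real a" using S by blast
        have "norm (y powr (w - of_nat J)) = t powr e"
          using t * by (subst norm_powr_real_powr) (auto simp: w_def e_def algebra_simps)
        also have "\<dots> \<le> real n powr e * (1 + real a) powr \<bar>e\<bar>"
          using t * by (intro powr_shift_bound) auto
        also have "\<dots> \<le> real n powr e * (1 + real a) powr (R + \<bar>of_int (k + int J)\<bar>)"
          using e by (intro mult_left_mono powr_mono) auto
        finally show "norm (f (Suc J') y) \<le> B"
          unfolding f_def B_def norm_mult Suc[symmetric]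
          using \<open>R \<ge> 0\<close> by (intro mult_mono prod) (auto simp: P_def)
      qed
      moreover have "f 0 (of_nat (n + a)) = cpow k s (n + a)"
        by (simp add: f_def cpow_def w_def)
      moreover have "(\<Sum>i\<le>J'. f i (of_nat n) * (of_nat (n + a) - of_nat n) ^ i / fact i) =
         (\<Sum>j<J. of_nat a ^ j / fact j * (\<Prod>l<j. - s - of_int k - of_nat l) * cpow (k + int j) s n)"
        unfolding Suc lessThan_Suc_atMost
        by (intro sum.cong refl) (simp add: f_def cpow_def w_def algebra_simps)
      ultimately show "norm (cpow k s (n + a) -
         (\<Sum>j<J. of_nat a ^ j / fact j * (\<Prod>l<j. - s - of_int k - of_nat l) * cpow (k + int j) s n))
       \<le> (P * (1 + real a) powr (R + \<bar>of_int (k + int J)\<bar>) * real a ^ Suc J' / fact J') * real n powr (- Re s - of_int (k + int J))"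
        by (simp add: B_def e_def mult_ac)
    qed
  qed
qed (auto intro!: holomorphic_intros cpow_holomorphic)

lemma symbol_shift: "symbol k (\<lambda>s n. cpow k s (n + a))"
  using asymp_exp_shift symbol_def by blast

text \<open>The coefficient of order \<open>k + 1\<close> is needed exactly, since its factor
  \<open>s + of_int k\<close> enters the divisor later on; all further terms go into
  \<open>r\<close>.\<close>

lemma symbol_shift_diff:
  obtains r where "symbol (k + 2) r"
    "\<And>s n. cpow k s n - cpow k s (n + a) = of_nat a * (s + of_int k) * cpow (k + 1) s n + r s n"
proof -
  have "symbol (k + 1 + 1) (\<lambda>s n. cpow k s (n + a) - cpow k s n - of_nat a * (- s - of_int k) * cpow (k + 1) s n)"
    using asymp_exp_tail[OF asymp_exp_tail[OF asymp_exp_shift[of k a]]] by (auto simp: symbol_def)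
  then have "symbol (k + 2) (\<lambda>s n. - (cpow k s (n + a) - cpow k s n - of_nat a * (- s - of_int k) * cpow (k + 1) s n))"
    by (intro symbol_uminus) (simp add: algebra_simps)
  then show ?thesis by (rule that) (simp add: algebra_simps)
qed

lemma symbol_shift_diff':
  obtains r where "symbol (k + 1) r" "\<And>s n. cpow k s (n + a) = cpow k s n + r s n"
proof -
  have "symbol (k + 1) (\<lambda>s n. cpow k s (n + a) - cpow k s n)"
    using asymp_exp_tail[OF asymp_exp_shift[of k a]] by (auto simp: symbol_def)
  then show ?thesis by (rule that) simp
qed

section \<open>Diagonal, Tornheim and triangle sums\<close>
text \<open>A crude condition under which all three kinds of sums converge absolutely. It holds for
  symbols once \<open>Re s\<close> is large, and that is where the algebraic identities are
  needed.\<close>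

definition quad_decay :: "(nat \<Rightarrow> complex) \<Rightarrow> bool" where
  "quad_decay f \<longleftrightarrow> (\<exists>C. \<forall>n\<ge>1. norm (f n) \<le> C * real n powr -2)"

definition diag_sum :: "(nat \<Rightarrow> complex) \<Rightarrow> (nat \<Rightarrow> complex) \<Rightarrow> complex" where
  "diag_sum f g = (\<Sum>\<^sub>\<infinity>n. f (Suc n) * g (Suc n))"

text \<open>The shape of a face of a triangle sum, such as \<open>a = 0\<close>. This is why the
  last argument is one less than the sum of the first two, unlike in the classical Tornheim
  series.\<close>

definition tornheim_sum :: "(nat \<Rightarrow> complex) \<Rightarrow> (nat \<Rightarrow> complex) \<Rightarrow> (nat \<Rightarrow> complex) \<Rightarrow> complex" where
  "tornheim_sum f g h = (\<Sum>\<^sub>\<infinity>(m, n). f (Suc m) * g (Suc n) * h (Suc (m + n)))"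

definition triangle_sum :: "(nat \<Rightarrow> complex) \<Rightarrow> (nat \<Rightarrow> complex) \<Rightarrow> (nat \<Rightarrow> complex) \<Rightarrow> complex" where
  "triangle_sum f g h = (\<Sum>\<^sub>\<infinity>(a, b, c). f (Suc (a + b)) * g (Suc (b + c)) * h (Suc (c + a)))"

lemma quad_decayE:
  assumes "quad_decay f"
  obtains C where "C \<ge> 0" "\<And>n. n \<ge> 1 \<Longrightarrow> norm (f n) \<le> C * real n powr -2"
proof -
  obtain C where C: "\<And>n. n \<ge> 1 \<Longrightarrow> norm (f n) \<le> C * real n powr -2"
    using assms unfolding quad_decay_def by blast
  have "0 \<le> C" using order.trans[OF norm_ge_zero C[of 1]] by simp
  with C show ?thesis using that by blast
qed

lemma quad_decay_bounded:
  assumes "quad_decay f"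
  obtains C where "C \<ge> 0" "\<And>n. n \<ge> 1 \<Longrightarrow> norm (f n) \<le> C"
proof -
  obtain C where C: "C \<ge> 0" "\<And>n. n \<ge> 1 \<Longrightarrow> norm (f n) \<le> C * real n powr -2"
    using quad_decayE[OF assms] by blast
  have "norm (f n) \<le> C" if "n \<ge> 1" for n
  proof -
    have "C * real n powr -2 \<le> C * 1 powr -2" using that C by (intro mult_left_mono powr_mono2') auto
    with C(2)[OF that] show ?thesis by simp
  qed
  with C(1) that show ?thesis by blast
qed

lemma quad_decay_add: 
  assumes "quad_decay f" "quad_decay g" shows "quad_decay (\<lambda>n. f n + g n)"
proof -
  obtain C where C: "C \<ge> 0" "\<And>n. n \<ge> 1 \<Longrightarrow> norm (f n) \<le> C * real n powr -2"
    using quad_decayE[OF assms(1)] by blast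
  obtain D where D: "D \<ge> 0" "\<And>n. n \<ge> 1 \<Longrightarrow> norm (g n) \<le> D * real n powr -2"
    using quad_decayE[OF assms(2)] by blast
  show ?thesis unfolding quad_decay_def
    using order.trans[OF norm_triangle_ineq add_mono[OF C(2) D(2)]]
    by (intro exI[of _ "C + D"]) (simp add: distrib_right)
qed

lemma quad_decay_shift:
  assumes "quad_decay f" shows "quad_decay (\<lambda>n. f (n + a))"
proof -
  obtain C where C: "C \<ge> 0" "\<And>n. n \<ge> 1 \<Longrightarrow> norm (f n) \<le> C * real n powr -2"
    using quad_decayE[OF assms] by blast
  have "norm (f (n + a)) \<le> C * real n powr -2" if "n \<ge> 1" for n
  proof -
    have "norm (f (n + a)) \<le> C * real (n + a) powr -2" using that by (intro C) auto
    also have "\<dots> \<le> C * real n powr -2" using that C by (intro mult_left_mono powr_mono2') auto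
    finally show ?thesis .
  qed
  then show ?thesis unfolding quad_decay_def by blast
qed

section \<open>Absolute convergence under quadratic decay\<close>

lemma summable_powr_Suc:
  fixes e :: real assumes "e > 1" shows "(\<lambda>n. real (Suc n) powr - e) summable_on (UNIV :: nat set)"
proof -
  have "summable (\<lambda>n. real n powr - e)"
    using assms by (simp add: summable_real_powr_iff)
  then have "summable (\<lambda>n. real (Suc n) powr - e)" by (subst summable_Suc_iff)
  then show ?thesis by (subst summable_on_UNIV_nonneg_real_iff) auto
qed

lemma summable_on_product:
  fixes f :: "'a \<Rightarrow> real" and g :: "'b \<Rightarrow> real"
  assumes "f summable_on UNIV" "g summable_on UNIV" "\<And>n. f n \<ge> 0" "\<And>n. g n \<ge> 0"
  shows "(\<lambda>(m, n). f m * g n) summable_on UNIV"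
proof -
  have "(\<lambda>(m, n). f m * g n) summable_on (SIGMA m:UNIV. UNIV)"
  proof (rule summable_on_SigmaI)
    show "((\<lambda>y. case (x, y) of (m, n) \<Rightarrow> f m * g n) has_sum f x * infsum g UNIV) UNIV" for x
      by (simp add: has_sum_cmult_right assms(2))
    show "(\<lambda>x. f x * infsum g UNIV) summable_on UNIV"
      by (intro summable_on_cmult_left assms)
  qed (use assms in auto)
  then show ?thesis by simp
qed

lemma summable_powr_Suc2:
  fixes e :: real assumes "e > 1"
  shows "(\<lambda>(m, n). real (Suc m) powr - e * real (Suc n) powr - e) summable_on (UNIV :: (nat \<times> nat) set)"
  by (intro summable_on_product summable_powr_Suc assms) auto

lemma summable_powr_Suc3:
  fixes e :: real assumes "e > 1"
  shows "(\<lambda>(m, n, p). real (Suc m) powr - e * (real (Suc n) powr - e * real (Suc p) powr - e))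
    summable_on (UNIV :: (nat \<times> nat \<times> nat) set)"
  using summable_on_product[OF summable_powr_Suc[OF assms] summable_powr_Suc2[OF assms]]
  by (simp add: case_prod_unfold)

lemma diag_sum_summable:
  assumes "quad_decay f" "quad_decay g" shows "(\<lambda>n. f (Suc n) * g (Suc n)) summable_on UNIV"
proof -
  obtain C where C: "C \<ge> 0" "\<And>n. n \<ge> 1 \<Longrightarrow> norm (f n) \<le> C * real n powr -2" using quad_decayE[OF assms(1)] by blast
  obtain D where D: "D \<ge> 0" "\<And>n. n \<ge> 1 \<Longrightarrow> norm (g n) \<le> D" using quad_decay_bounded[OF assms(2)] by blast
  show ?thesis
  proof (rule abs_summable_summable, rule summable_on_comparison_test)
    show "(\<lambda>n. C * D * real (Suc n) powr -2) summable_on UNIV"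
      by (intro summable_on_cmult_right summable_powr_Suc) auto
    show "norm (f (Suc n) * g (Suc n)) \<le> C * D * real (Suc n) powr -2" for n
      unfolding norm_mult using mult_mono[OF C(2)[of "Suc n"] D(2)[of "Suc n"]] C(1) by (simp add: mult_ac)
  qed auto
qed

lemma tornheim_sum_summable:
  assumes "quad_decay f" "quad_decay g" "quad_decay h"
  shows "(\<lambda>(m, n). f (Suc m) * g (Suc n) * h (Suc (m + n))) summable_on UNIV"
proof -
  obtain C where C: "C \<ge> 0" "\<And>n. n \<ge> 1 \<Longrightarrow> norm (f n) \<le> C * real n powr -2" using quad_decayE[OF assms(1)] by blast
  obtain D where D: "D \<ge> 0" "\<And>n. n \<ge> 1 \<Longrightarrow> norm (g n) \<le> D * real n powr -2" using quad_decayE[OF assms(2)] by blast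
  obtain E where E: "E \<ge> 0" "\<And>n. n \<ge> 1 \<Longrightarrow> norm (h n) \<le> E" using quad_decay_bounded[OF assms(3)] by blast
  show ?thesis
  proof (rule abs_summable_summable, rule summable_on_comparison_test)
    show "(\<lambda>(m, n). C * D * E * (real (Suc m) powr -2 * real (Suc n) powr -2)) summable_on UNIV"
      using summable_on_cmult_right[OF summable_powr_Suc2[of 2], of "C * D * E"] by (simp add: case_prod_unfold)
    have "norm (f (Suc m) * g (Suc n) * h (Suc (m + n)))
        \<le> (C * real (Suc m) powr -2) * (D * real (Suc n) powr -2) * E" for m n
      unfolding norm_mult by (intro mult_mono C D E) (use C D E in auto)
    then show "norm (case x of (m, n) \<Rightarrow> f (Suc m) * g (Suc n) * h (Suc (m + n)))
      \<le> (case x of (m, n) \<Rightarrow> C * D * E * (real (Suc m) powr -2 * real (Suc n) powr -2))" for x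
      by (auto simp: mult_ac split: prod.splits)
  qed auto
qed

text \<open>Since the three forms dominate \<open>a\<close>, \<open>b\<close> and \<open>c\<close>
  respectively, each factor pays for a different variable, and a product of three convergent series
  is a majorant.\<close>

lemma triangle_sum_summable:
  assumes "quad_decay f" "quad_decay g" "quad_decay h"
  shows "(\<lambda>(a, b, c). f (Suc (a + b)) * g (Suc (b + c)) * h (Suc (c + a))) summable_on UNIV"
proof -
  obtain C where C: "C \<ge> 0" "\<And>n. n \<ge> 1 \<Longrightarrow> norm (f n) \<le> C * real n powr -2" using quad_decayE[OF assms(1)] by blast
  obtain D where D: "D \<ge> 0" "\<And>n. n \<ge> 1 \<Longrightarrow> norm (g n) \<le> D * real n powr -2" using quad_decayE[OF assms(2)] by blast
  obtain E where E: "E \<ge> 0" "\<And>n. n \<ge> 1 \<Longrightarrow> norm (h n) \<le> E * real n powr -2" using quad_decayE[OF assms(3)] by blast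
  show ?thesis
  proof (rule abs_summable_summable, rule summable_on_comparison_test)
    show "(\<lambda>(a, b, c). C * D * E * (real (Suc a) powr -2 * (real (Suc b) powr -2 * real (Suc c) powr -2))) summable_on UNIV"
      using summable_on_cmult_right[OF summable_powr_Suc3[of 2], of "C * D * E"] by (simp add: case_prod_unfold)
    have le: "real (Suc (a + b)) powr -2 \<le> real (Suc a) powr -2" for a b
      by (intro powr_mono2') auto
    have "norm (f (Suc (a + b)) * g (Suc (b + c)) * h (Suc (c + a)))
        \<le> (C * real (Suc (a + b)) powr -2) * (D * real (Suc (b + c)) powr -2) * (E * real (Suc (c + a)) powr -2)" for a b c
      unfolding norm_mult by (intro mult_mono C D E) (use C D E in auto)
    also have "\<dots> a b c \<le> (C * real (Suc a) powr -2) * (D * real (Suc b) powr -2) * (E * real (Suc c) powr -2)" for a b c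
      by (intro mult_mono mult_left_mono le C D E mult_nonneg_nonneg) auto
    finally show "norm (case x of (a, b, c) \<Rightarrow> f (Suc (a + b)) * g (Suc (b + c)) * h (Suc (c + a)))
      \<le> (case x of (a, b, c) \<Rightarrow> C * D * E * (real (Suc a) powr -2 * (real (Suc b) powr -2 * real (Suc c) powr -2)))" for x
      by (auto simp: mult_ac split: prod.splits)
  qed auto
qed

lemma diag_sum_commute: "diag_sum f g = diag_sum g f"
  by (simp add: diag_sum_def mult.commute)

lemma tornheim_sum_commute: "tornheim_sum f g h = tornheim_sum g f h"
  unfolding tornheim_sum_def
  by (rule infsum_reindex_bij_witness[of _ prod.swap prod.swap]) (auto simp: mult_ac add_ac)

lemma triangle_sum_rotate: "triangle_sum f g h = triangle_sum g h f"
  unfolding triangle_sum_def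
  by (rule infsum_reindex_bij_witness[of _ "\<lambda>(b, c, a). (a, b, c)" "\<lambda>(a, b, c). (b, c, a)"]) (auto simp: mult_ac add_ac)

lemma diag_sum_linear:
  assumes "quad_decay f" "quad_decay f'" "quad_decay g"
  shows "diag_sum (\<lambda>n. c * f n + f' n) g = c * diag_sum f g + diag_sum f' g"
proof -
  have "diag_sum (\<lambda>n. c * f n + f' n) g = infsum (\<lambda>n. c * (f (Suc n) * g (Suc n)) + f' (Suc n) * g (Suc n)) UNIV"
    unfolding diag_sum_def by (intro infsum_cong) (auto simp: algebra_simps)
  also have "\<dots> = c * diag_sum f g + diag_sum f' g"
    unfolding diag_sum_def
    by (subst infsum_add) (use diag_sum_summable[of f g] diag_sum_summable[of f' g] assms in \<open>auto simp: infsum_cmult_right' intro!: summable_on_cmult_right\<close>)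
  finally show ?thesis .
qed

lemma tornheim_sum_linear:
  assumes "quad_decay f" "quad_decay f'" "quad_decay g" "quad_decay h"
  shows "tornheim_sum (\<lambda>n. c * f n + f' n) g h = c * tornheim_sum f g h + tornheim_sum f' g h"
proof -
  have "tornheim_sum (\<lambda>n. c * f n + f' n) g h = infsum (\<lambda>x. c * (case x of (m, n) \<Rightarrow> f (Suc m) * g (Suc n) * h (Suc (m + n)))
      + (case x of (m, n) \<Rightarrow> f' (Suc m) * g (Suc n) * h (Suc (m + n)))) UNIV"
    unfolding tornheim_sum_def by (intro infsum_cong) (auto simp: algebra_simps)
  also have "\<dots> = c * tornheim_sum f g h + tornheim_sum f' g h"
    unfolding tornheim_sum_def
    by (subst infsum_add) (use tornheim_sum_summable[of f g h] tornheim_sum_summable[of f' g h] assms in \<open>auto simp: infsum_cmult_right' intro!: summable_on_cmult_right\<close>)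
  finally show ?thesis .
qed

lemma tornheim_sum_linear3:
  assumes "quad_decay f" "quad_decay g" "quad_decay h" "quad_decay h'"
  shows "tornheim_sum f g (\<lambda>n. c * h n + h' n) = c * tornheim_sum f g h + tornheim_sum f g h'"
proof -
  have "tornheim_sum f g (\<lambda>n. c * h n + h' n) = infsum (\<lambda>x. c * (case x of (m, n) \<Rightarrow> f (Suc m) * g (Suc n) * h (Suc (m + n)))
      + (case x of (m, n) \<Rightarrow> f (Suc m) * g (Suc n) * h' (Suc (m + n)))) UNIV"
    unfolding tornheim_sum_def by (intro infsum_cong) (auto simp: algebra_simps)
  also have "\<dots> = c * tornheim_sum f g h + tornheim_sum f g h'"
    unfolding tornheim_sum_def
    by (subst infsum_add) (use tornheim_sum_summable[of f g h] tornheim_sum_summable[of f g h'] assms in \<open>auto simp: infsum_cmult_right' intro!: summable_on_cmult_right\<close>)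
  finally show ?thesis .
qed

lemma triangle_sum_linear:
  assumes "quad_decay f" "quad_decay f'" "quad_decay g" "quad_decay h"
  shows "triangle_sum (\<lambda>n. c * f n + f' n) g h = c * triangle_sum f g h + triangle_sum f' g h"
proof -
  have "triangle_sum (\<lambda>n. c * f n + f' n) g h = infsum (\<lambda>x. c * (case x of (a, b, d) \<Rightarrow> f (Suc (a + b)) * g (Suc (b + d)) * h (Suc (d + a)))
      + (case x of (a, b, d) \<Rightarrow> f' (Suc (a + b)) * g (Suc (b + d)) * h (Suc (d + a)))) UNIV"
    unfolding triangle_sum_def by (intro infsum_cong) (auto simp: algebra_simps)
  also have "\<dots> = c * triangle_sum f g h + triangle_sum f' g h"
    unfolding triangle_sum_def
    by (subst infsum_add) (use triangle_sum_summable[of f g h] triangle_sum_summable[of f' g h] assms in \<open>auto simp: infsum_cmult_right' intro!: summable_on_cmult_right\<close>)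
  finally show ?thesis .
qed

lemma diag_sum_linear2:
  assumes "quad_decay f" "quad_decay g" "quad_decay g'"
  shows "diag_sum f (\<lambda>n. c * g n + g' n) = c * diag_sum f g + diag_sum f g'"
  using diag_sum_linear[of g g' f c] assms by (simp add: diag_sum_commute)

lemma tornheim_sum_linear2:
  assumes "quad_decay f" "quad_decay g" "quad_decay g'" "quad_decay h"
  shows "tornheim_sum f (\<lambda>n. c * g n + g' n) h = c * tornheim_sum f g h + tornheim_sum f g' h"
  using tornheim_sum_linear[of g g' f h c] assms by (simp add: tornheim_sum_commute[of f])

section \<open>Splitting off faces, and telescoping\<close>

lemma infsum_split_nat:
  fixes F :: "nat \<times> 'a \<Rightarrow> complex"
  assumes "F summable_on UNIV"
  shows "infsum F UNIV = (\<Sum>\<^sub>\<infinity>x. F (0, x)) + (\<Sum>\<^sub>\<infinity>(m, x). F (Suc m, x))"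
proof -
  have U: "(UNIV :: (nat \<times> 'a) set) = range (\<lambda>x. (0, x)) \<union> range (\<lambda>(m, x). (Suc m, x))"
  proof (intro equalityI subsetI)
    fix y :: "nat \<times> 'a"
    show "y \<in> range (\<lambda>x. (0, x)) \<union> range (\<lambda>(m, x). (Suc m, x))"
      by (cases y; cases "fst y") (auto simp: image_iff)
  qed auto
  have i: "inj (\<lambda>x::'a. (0::nat, x))" "inj (\<lambda>(m, x::'a). (Suc m, x))" by (auto simp: inj_on_def)
  have "infsum F (range (\<lambda>x. (0, x)) \<union> range (\<lambda>(m, x). (Suc m, x)))
      = infsum F (range (\<lambda>x. (0, x))) + infsum F (range (\<lambda>(m, x). (Suc m, x)))"
    by (rule infsum_Un_disjoint) (use assms in \<open>auto intro: summable_on_subset_banach\<close>)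
  also have "\<dots> = (\<Sum>\<^sub>\<infinity>x. F (0, x)) + (\<Sum>\<^sub>\<infinity>(m, x). F (Suc m, x))"
    by (subst infsum_reindex[OF i(1)], subst infsum_reindex[OF i(2)]) (simp add: o_def case_prod_unfold)
  finally show ?thesis by (simp only: U[symmetric])
qed

lemma infsum_split_nat1:
  fixes F :: "nat \<Rightarrow> complex"
  assumes "F summable_on UNIV"
  shows "infsum F UNIV = F 0 + (\<Sum>\<^sub>\<infinity>n. F (Suc n))"
proof -
  have U: "(UNIV :: nat set) = {0} \<union> range Suc"
    using UNIV_nat_eq by simp
  have "infsum F ({0} \<union> range Suc) = infsum F {0} + infsum F (range Suc)"
    by (rule infsum_Un_disjoint) (use assms in \<open>auto intro: summable_on_subset_banach\<close>)
  then show ?thesis by (simp only: U[symmetric]) (simp add: infsum_reindex o_def)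
qed

lemma diag_sum_telescope:
  assumes "quad_decay f" "quad_decay g"
  shows "diag_sum f g - diag_sum (\<lambda>n. f (n + 1)) (\<lambda>n. g (n + 1)) = f 1 * g 1"
  using infsum_split_nat1[OF diag_sum_summable[OF assms]] by (simp add: diag_sum_def)

text \<open>Shifting the first index moves the arguments of \<open>f\<close> and \<open>h\<close>
  together. The two sums differ by the row \<open>m = 0\<close>, on which \<open>g\<close> and
  \<open>h\<close> have the same argument.\<close>

lemma tornheim_sum_telescope:
  assumes "quad_decay f" "quad_decay g" "quad_decay h"
  shows "tornheim_sum f g h - tornheim_sum (\<lambda>n. f (n + 1)) g (\<lambda>n. h (n + 1)) = f 1 * diag_sum g h"
  using infsum_split_nat[OF tornheim_sum_summable[OF assms]] 
  by (simp add: diag_sum_def tornheim_sum_def mult.assoc infsum_cmult_right')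

text \<open>The arguments satisfy \<open>m + n + 1 = (m + 1) + (n + 1) - 1\<close>.\<close>

lemma tornheim_sum_mult:
  assumes "quad_decay (\<lambda>n. of_nat n * f n)" "quad_decay (\<lambda>n. of_nat n * g n)" "quad_decay (\<lambda>n. of_nat n * h n)" "quad_decay f" "quad_decay g" "quad_decay h"
  shows "tornheim_sum f g (\<lambda>n. of_nat n * h n) + tornheim_sum f g h = tornheim_sum (\<lambda>n. of_nat n * f n) g h + tornheim_sum f (\<lambda>n. of_nat n * g n) h"
proof -
  let ?t = "\<lambda>f g h (m, n). f (Suc m) * g (Suc n) * h (Suc (m + n)) :: complex"
  have "tornheim_sum f g (\<lambda>n. of_nat n * h n) + tornheim_sum f g h = infsum (\<lambda>x. ?t f g (\<lambda>n. of_nat n * h n) x + ?t f g h x) UNIV"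
    unfolding tornheim_sum_def by (intro infsum_add[symmetric] tornheim_sum_summable assms)
  also have "\<dots> = infsum (\<lambda>x. ?t (\<lambda>n. of_nat n * f n) g h x + ?t f (\<lambda>n. of_nat n * g n) h x) UNIV"
    by (intro infsum_cong) (auto simp: algebra_simps)
  also have "\<dots> = tornheim_sum (\<lambda>n. of_nat n * f n) g h + tornheim_sum f (\<lambda>n. of_nat n * g n) h"
    unfolding tornheim_sum_def by (intro infsum_add tornheim_sum_summable assms)
  finally show ?thesis .
qed

text \<open>Translation by \<open>(1, 1, -1)\<close> shifts the argument of \<open>g\<close> by 2 and fixes the other two arguments;
  the terms on the right are the contributions of the faces.\<close>

lemma triangle_sum_telescope:
  assumes "quad_decay g" "quad_decay f" "quad_decay h"
  shows "triangle_sum g f h - triangle_sum (\<lambda>n. g (n + 2)) f h =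
    tornheim_sum g h f + tornheim_sum g f h - g 1 * diag_sum f h - tornheim_sum f h (\<lambda>n. g (n + 2))"
proof -
  \<comment> \<open>The common interior: \<open>(a + 1, b + 1, c)\<close> in the first sum and
    \<open>(a, b, c + 1)\<close> in the second give the same term.\<close>
  let ?R = "\<Sum>\<^sub>\<infinity>(a, b, c). g (a + b + 3) * f (b + c + 2) * h (c + a + 2)"
  have s3: "(\<lambda>(a, b, c). g (Suc (a + b)) * f (Suc (b + c)) * h (Suc (c + a))) summable_on UNIV"
    by (rule triangle_sum_summable[OF assms])
  have 1: "triangle_sum g f h = tornheim_sum g h f + (\<Sum>\<^sub>\<infinity>(a, b, c). g (Suc (Suc (a + b))) * f (Suc (b + c)) * h (Suc (Suc (c + a))))"
    unfolding triangle_sum_def tornheim_sum_def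
    by (subst infsum_split_nat[OF s3]) (auto intro!: arg_cong2[of _ _ _ _ "(+)"] infsum_cong simp: mult_ac)
  \<comment> \<open>\<open>b\<close> is brought to the front so that the face \<open>b = 0\<close>
    can be split off; \<open>H\<close> does the same for \<open>c\<close>.\<close>
  define G where "G = (\<lambda>(b, a, c). g (Suc (Suc (a + b))) * f (Suc (b + c)) * h (Suc (Suc (c + a))))"
  have 2: "(\<Sum>\<^sub>\<infinity>(a, b, c). g (Suc (Suc (a + b))) * f (Suc (b + c)) * h (Suc (Suc (c + a)))) = infsum G UNIV"
    unfolding G_def
    by (rule infsum_reindex_bij_witness[of _ "\<lambda>(b, a, c). (a, b, c)" "\<lambda>(a, b, c). (b, a, c)"]) auto
  have Gs: "G summable_on UNIV"
  proof -
    have "inj (\<lambda>(b, a, c). (Suc a, b, c :: nat))" by (auto simp: inj_on_def)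
    have "(\<lambda>(a, b, c). g (Suc (a + b)) * f (Suc (b + c)) * h (Suc (c + a))) summable_on range (\<lambda>(b, a, c). (Suc a, b, c))"
      by (rule summable_on_subset_banach[OF s3]) auto
    then have "((\<lambda>(a, b, c). g (Suc (a + b)) * f (Suc (b + c)) * h (Suc (c + a))) \<circ> (\<lambda>(b, a, c). (Suc a, b, c))) summable_on UNIV"
      by (subst (asm) summable_on_reindex) (auto simp: inj_on_def)
    then show ?thesis by (simp add: o_def G_def case_prod_unfold)
  qed
  have 3: "infsum G UNIV = (\<Sum>\<^sub>\<infinity>(a, c). g (Suc (Suc a)) * f (Suc c) * h (Suc (Suc (c + a)))) + ?R"
  proof -
    have "(\<Sum>\<^sub>\<infinity>(b, x). G (Suc b, x)) = ?R"
      by (rule infsum_reindex_bij_witness[of _ "\<lambda>(a, b, c). (b, a, c)" "\<lambda>(b, a, c). (a, b, c)"])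
        (auto simp: G_def eval_nat_numeral add_ac)
    then show ?thesis
      by (subst infsum_split_nat[OF Gs]) (simp add: G_def)
  qed
  \<comment> \<open>On this face the first index starts one later, because the face
    \<open>a = 0\<close> is already gone. So an edge, which is a diagonal sum, is missing from the
    full Tornheim sum.\<close>
  have 4: "(\<Sum>\<^sub>\<infinity>(a, c). g (Suc (Suc a)) * f (Suc c) * h (Suc (Suc (c + a)))) = tornheim_sum g f h - g 1 * diag_sum f h"
    using tornheim_sum_telescope[of g f h] assms by (simp add: tornheim_sum_def add_ac eq_diff_eq diff_eq_eq)
  have s3': "(\<lambda>(a, b, c). g (Suc (a + b) + 2) * f (Suc (b + c)) * h (Suc (c + a))) summable_on UNIV"
    using triangle_sum_summable[OF quad_decay_shift[OF assms(1), of 2] assms(2,3)] by simp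
  define H where "H = (\<lambda>(c, b, a). g (Suc (a + b) + 2) * f (Suc (b + c)) * h (Suc (c + a)))"
  have Hs: "H summable_on UNIV"
    using s3' unfolding H_def
    by (subst summable_on_reindex_bij_witness[of _ "\<lambda>(a, b, c). (c, b, a)" "\<lambda>(a, b, c). (c, b, a)"]) auto
  have "triangle_sum (\<lambda>n. g (n + 2)) f h = infsum H UNIV"
    unfolding triangle_sum_def H_def
    by (rule infsum_reindex_bij_witness[of _ "\<lambda>(a, b, c). (c, b, a)" "\<lambda>(a, b, c). (c, b, a)"]) auto
  also have "\<dots> = tornheim_sum f h (\<lambda>n. g (n + 2)) + ?R"
  proof -
    have "(\<Sum>\<^sub>\<infinity>(c, x). H (Suc c, x)) = ?R"
      by (rule infsum_reindex_bij_witness[of _ "\<lambda>(a, b, c). (c, b, a)" "\<lambda>(a, b, c). (c, b, a)"])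
        (auto simp: H_def eval_nat_numeral add_ac)
    moreover have "(\<Sum>\<^sub>\<infinity>x. H (0, x)) = tornheim_sum f h (\<lambda>n. g (n + 2))"
      unfolding tornheim_sum_def
      by (rule infsum_reindex_bij_witness[of _ "\<lambda>(b, a). (b, a)" "\<lambda>(b, a). (b, a)"])
        (auto simp: H_def add_ac mult_ac)
    ultimately show ?thesis
      by (subst infsum_split_nat[OF Hs]) simp
  qed
  finally show ?thesis using 1 2 3 4 by simp
qed

section \<open>Meromorphic continuation of the sums\<close>
abbreviation rhp_top :: "complex filter" where "rhp_top \<equiv> filtercomap Re at_top"

text \<open>\<open>F\<close> will be an \<open>infsum\<close>, which is 0 where it diverges, so it
  is meaningful only far to the right and agreement is asked only there. By the identity theorem
  this still determines \<open>Z\<close> up to isolated points.\<close>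

definition mero_ext :: "real \<Rightarrow> (complex \<Rightarrow> complex) \<Rightarrow> bool" where
  "mero_ext X F \<longleftrightarrow> (\<exists>Z. Z meromorphic_on {s. Re s > X} \<and> eventually (\<lambda>s. Z s = F s) rhp_top)"

lemma eventually_rhp_top: "eventually P rhp_top \<longleftrightarrow> (\<exists>A. \<forall>s. Re s > A \<longrightarrow> P s)"
  by (rule eventually_filtercomap_at_top_dense)

lemma mero_ext_cong:
  assumes "mero_ext X F" "eventually (\<lambda>s. G s = F s) rhp_top" shows "mero_ext X G"
proof -
  obtain Z where Z: "Z meromorphic_on {s. Re s > X}" "eventually (\<lambda>s. Z s = F s) rhp_top"
    using assms(1) unfolding mero_ext_def by blast
  from Z(2) assms(2) have "eventually (\<lambda>s. Z s = G s) rhp_top" by eventually_elim auto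
  with Z(1) show ?thesis unfolding mero_ext_def by blast
qed

lemma mero_ext_meromorphic: "F meromorphic_on {s. Re s > X} \<Longrightarrow> mero_ext X F"
  unfolding mero_ext_def by auto

lemma mero_ext_entire: "F holomorphic_on UNIV \<Longrightarrow> mero_ext X F"
  by (intro mero_ext_meromorphic analytic_on_imp_meromorphic_on)
    (auto simp: analytic_on_holomorphic)

lemma mero_ext_add:
  assumes "mero_ext X F" "mero_ext X G" shows "mero_ext X (\<lambda>s. F s + G s)"
proof -
  obtain Z where Z: "Z meromorphic_on {s. Re s > X}" "eventually (\<lambda>s. Z s = F s) rhp_top"
    using assms(1) unfolding mero_ext_def by blast
  obtain Y where Y: "Y meromorphic_on {s. Re s > X}" "eventually (\<lambda>s. Y s = G s) rhp_top"
    using assms(2) unfolding mero_ext_def by blast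
  from Z(2) Y(2) have "eventually (\<lambda>s. Z s + Y s = F s + G s) rhp_top" by eventually_elim auto
  then show ?thesis unfolding mero_ext_def
    by (intro exI[of _ "\<lambda>s. Z s + Y s"] conjI meromorphic_intros Z(1) Y(1))
qed

lemma mero_ext_mult:
  assumes "mero_ext X F" "mero_ext X G" shows "mero_ext X (\<lambda>s. F s * G s)"
proof -
  obtain Z where Z: "Z meromorphic_on {s. Re s > X}" "eventually (\<lambda>s. Z s = F s) rhp_top"
    using assms(1) unfolding mero_ext_def by blast
  obtain Y where Y: "Y meromorphic_on {s. Re s > X}" "eventually (\<lambda>s. Y s = G s) rhp_top"
    using assms(2) unfolding mero_ext_def by blast
  from Z(2) Y(2) have "eventually (\<lambda>s. Z s * Y s = F s * G s) rhp_top" by eventually_elim auto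
  then show ?thesis unfolding mero_ext_def
    by (intro exI[of _ "\<lambda>s. Z s * Y s"] conjI meromorphic_intros Z(1) Y(1))
qed

lemma mero_ext_diff:
  assumes "mero_ext X F" "mero_ext X G" shows "mero_ext X (\<lambda>s. F s - G s)"
  using mero_ext_add[OF assms(1) mero_ext_mult[OF mero_ext_entire[of "\<lambda>_. -1"] assms(2)]] by simp

text \<open>The place where poles arise. The slope \<open>Suc m\<close> is at least 1, so the factor
  has no zero with \<open>Re s > |a|\<close> and may be divided out far to the right.\<close>

lemma mero_ext_divide_affine:
  assumes "mero_ext X G" "eventually (\<lambda>s. (of_nat (Suc m) * s + of_int a) * F s = G s) rhp_top"
  shows "mero_ext X F"
proof (rule mero_ext_cong)
  have "(\<lambda>s. inverse (of_nat (Suc m) * s + of_int a)) meromorphic_on {s. Re s > X}"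
    by (intro meromorphic_intros)
  then show "mero_ext X (\<lambda>s. inverse (of_nat (Suc m) * s + of_int a) * G s)"
    by (intro mero_ext_mult assms(1) mero_ext_meromorphic)
  have "eventually (\<lambda>s. of_nat (Suc m) * s + of_int a \<noteq> 0) rhp_top"
    unfolding eventually_rhp_top
  proof (intro exI allI impI notI)
    fix s :: complex assume s: "Re s > \<bar>of_int a\<bar>" and "of_nat (Suc m) * s + of_int a = 0"
    from arg_cong[OF this(2), of Re] have "real (Suc m) * Re s = - of_int a" by simp
    moreover have "1 * Re s \<le> real (Suc m) * Re s" using s by (intro mult_right_mono) auto
    ultimately show False using s by linarith
  qed
  with assms(2) show "eventually (\<lambda>s. F s = inverse (of_nat (Suc m) * s + of_int a) * G s) rhp_top"
    by eventually_elim (simp add: field_simps)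
qed

text \<open>Weierstrass test along the net of finite index sets. Majorants that depend on a bound
  for \<open>norm s\<close> suffice, since holomorphy is local.\<close>

lemma infsum_holomorphic:
  fixes t :: "complex \<Rightarrow> 'i \<Rightarrow> complex"
  assumes hol: "\<And>i. (\<lambda>s. t s i) holomorphic_on {s. Re s > X}"
    and bound: "\<And>R. \<exists>M. M summable_on UNIV \<and> (\<forall>s i. norm s \<le> R \<longrightarrow> Re s > X \<longrightarrow> norm (t s i) \<le> M i)"
  shows "(\<lambda>s. \<Sum>\<^sub>\<infinity>i. t s i) holomorphic_on {s. Re s > X}"
proof -
  have op: "open {s. Re s > X}" by (rule open_halfspace_Re_gt)
  have "\<exists>d>0. (\<lambda>s. \<Sum>\<^sub>\<infinity>i. t s i) holomorphic_on ball z d" if z: "Re z > X" for z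
  proof -
    obtain d where d: "d > 0" "cball z d \<subseteq> {s. Re s > X}"
      using op z open_contains_cball by (metis mem_Collect_eq)
    obtain M where M: "M summable_on UNIV"
      "\<And>s i. norm s \<le> norm z + d \<Longrightarrow> Re s > X \<Longrightarrow> norm (t s i) \<le> M i"
      using bound by meson
    have "uniform_limit (cball z d) (\<lambda>I s. \<Sum>i\<in>I. t s i) (\<lambda>s. \<Sum>\<^sub>\<infinity>i. t s i) (finite_subsets_at_top UNIV)"
    proof (rule Weierstrass_m_test_general[OF _ M(1)])
      fix i s assume s: "s \<in> cball z d"
      have "norm s \<le> norm z + norm (s - z)" using norm_triangle_sub by blast
      also have "norm (s - z) \<le> d" using s by (simp add: dist_norm norm_minus_commute)
      finally show "norm (t s i) \<le> M i" using s d by (intro M(2)) auto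
    qed
    then have "(\<lambda>s. \<Sum>\<^sub>\<infinity>i. t s i) holomorphic_on ball z d"
    proof (rule holomorphic_uniform_limit[rotated])
      show "\<forall>\<^sub>F I in finite_subsets_at_top UNIV. continuous_on (cball z d) (\<lambda>s. \<Sum>i\<in>I. t s i) \<and>
          (\<lambda>s. \<Sum>i\<in>I. t s i) holomorphic_on ball z d"
      proof (intro always_eventually allI conjI)
        fix I
        have "(\<lambda>s. \<Sum>i\<in>I. t s i) holomorphic_on cball z d"
          using hol d(2) by (intro holomorphic_intros) (meson holomorphic_on_subset)
        then show "continuous_on (cball z d) (\<lambda>s. \<Sum>i\<in>I. t s i)" "(\<lambda>s. \<Sum>i\<in>I. t s i) holomorphic_on ball z d"
          using ball_subset_cball holomorphic_on_subset holomorphic_on_imp_continuous_on by blast+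
      qed
    qed auto
    with d show ?thesis by blast
  qed
  then show ?thesis
    by (metis (no_types, lifting) analytic_on_def analytic_imp_holomorphic mem_Collect_eq)
qed

lemma mero_ext_infsum:
  fixes t :: "complex \<Rightarrow> 'i \<Rightarrow> complex"
  assumes "\<And>i. (\<lambda>s. t s i) holomorphic_on UNIV"
    and "\<And>R. \<exists>M. M summable_on UNIV \<and> (\<forall>s i. norm s \<le> R \<longrightarrow> Re s > X \<longrightarrow> norm (t s i) \<le> M i)"
  shows "mero_ext X (\<lambda>s. \<Sum>\<^sub>\<infinity>i. t s i)"
proof -
  have "(\<lambda>s. \<Sum>\<^sub>\<infinity>i. t s i) holomorphic_on {s. Re s > X}"
    by (intro infsum_holomorphic assms(2)) (use assms(1) holomorphic_on_subset in blast)
  then show ?thesis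
    by (intro mero_ext_meromorphic analytic_on_imp_meromorphic_on)
      (simp add: analytic_on_open open_halfspace_Re_gt)
qed

lemma eventually_quad_decay:
  assumes "symbol k f" shows "eventually (\<lambda>s. quad_decay (f s)) rhp_top"
  unfolding eventually_rhp_top
proof (intro exI allI impI)
  fix s assume s: "Re s > 2 - of_int k"
  obtain C where C: "C \<ge> 0" "\<And>n. n \<ge> 1 \<Longrightarrow> norm (f s n) \<le> C * real n powr (- Re s - of_int k)"
    using order_boundD[OF symbol_order_bound[OF assms], of "norm s"] by (metis order.refl)
  have "norm (f s n) \<le> C * real n powr -2" if "n \<ge> 1" for n
    using that s C(1) by (intro order.trans[OF C(2)] mult_left_mono powr_mono) auto
  then show "quad_decay (f s)" unfolding quad_decay_def by blast
qed

lemma diag_sum_cong: "(\<And>n. n \<ge> 1 \<Longrightarrow> f n * g n = f' n * g' n) \<Longrightarrow> diag_sum f g = diag_sum f' g'"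
  unfolding diag_sum_def by (intro infsum_cong) auto

lemma tornheim_sum_cong:
  assumes "\<And>n. n \<ge> 1 \<Longrightarrow> f n = f' n" "\<And>n. n \<ge> 1 \<Longrightarrow> g n = g' n" "\<And>n. n \<ge> 1 \<Longrightarrow> h n = h' n"
  shows "tornheim_sum f g h = tornheim_sum f' g' h'"
  unfolding tornheim_sum_def by (intro infsum_cong) (auto simp: assms)

text \<open>In the following, \<open>X\<close> is the abscissa of the half-plane to which all sums of symbols of the given
  orders extend.\<close>

definition diag_ext :: "real \<Rightarrow> int \<Rightarrow> int \<Rightarrow> bool" where
  "diag_ext X k1 k2 \<longleftrightarrow> (\<forall>f g. symbol k1 f \<longrightarrow> symbol k2 g \<longrightarrow> mero_ext X (\<lambda>s. diag_sum (f s) (g s)))"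

definition tornheim_ext :: "real \<Rightarrow> int \<Rightarrow> int \<Rightarrow> int \<Rightarrow> bool" where
  "tornheim_ext X k1 k2 k3 \<longleftrightarrow> (\<forall>f g h. symbol k1 f \<longrightarrow> symbol k2 g \<longrightarrow> symbol k3 h \<longrightarrow> mero_ext X (\<lambda>s. tornheim_sum (f s) (g s) (h s)))"

definition triangle_ext :: "real \<Rightarrow> int \<Rightarrow> int \<Rightarrow> int \<Rightarrow> bool" where
  "triangle_ext X k1 k2 k3 \<longleftrightarrow> (\<forall>f g h. symbol k1 f \<longrightarrow> symbol k2 g \<longrightarrow> symbol k3 h \<longrightarrow> mero_ext X (\<lambda>s. triangle_sum (f s) (g s) (h s)))"

text \<open>The threshold makes the combined exponent \<open>- 2 * Re s - (k1 + k2)\<close> at most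
  -2 throughout \<open>Re s > - N\<close>.\<close>

lemma diag_ext_base:
  assumes "k1 + k2 \<ge> 2 + 2 * int N" shows "diag_ext (- real N) k1 k2"
  unfolding diag_ext_def diag_sum_def
proof (intro allI impI mero_ext_infsum)
  fix f g and R :: real assume f: "symbol k1 f" and g: "symbol k2 g"
  show "(\<lambda>s. f s (Suc i) * g s (Suc i)) holomorphic_on UNIV" for i
    by (intro holomorphic_intros symbol_holomorphic[OF f] symbol_holomorphic[OF g]) auto
  obtain C where C: "C \<ge> 0" "\<And>s n. norm s \<le> R \<Longrightarrow> n \<ge> 1 \<Longrightarrow> norm (f s n) \<le> C * real n powr (- Re s - of_int k1)"
    using order_boundD[OF symbol_order_bound[OF f], of R] by metis
  obtain D where D: "D \<ge> 0" "\<And>s n. norm s \<le> R \<Longrightarrow> n \<ge> 1 \<Longrightarrow> norm (g s n) \<le> D * real n powr (- Re s - of_int k2)"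
    using order_boundD[OF symbol_order_bound[OF g], of R] by metis
  show "\<exists>M. M summable_on UNIV \<and> (\<forall>s i. norm s \<le> R \<longrightarrow> Re s > - real N \<longrightarrow> norm (f s (Suc i) * g s (Suc i)) \<le> M i)"
  proof (intro exI conjI allI impI)
    show "(\<lambda>i. C * D * real (Suc i) powr -2) summable_on UNIV"
      by (intro summable_on_cmult_right summable_powr_Suc) auto
    fix s i assume s: "norm s \<le> R" "Re s > - real N"
    have "norm (f s (Suc i) * g s (Suc i)) \<le> (C * real (Suc i) powr (- Re s - of_int k1)) * (D * real (Suc i) powr (- Re s - of_int k2))"
      unfolding norm_mult by (intro mult_mono C D s) (use C D in auto)
    also have "\<dots> = C * D * real (Suc i) powr (- 2 * Re s - of_int (k1 + k2))"
      by (simp add: powr_add[symmetric] algebra_simps flip: mult.assoc) 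
    also have "\<dots> \<le> C * D * real (Suc i) powr -2"
      using C D s assms by (intro mult_left_mono powr_mono) auto
    finally show "norm (f s (Suc i) * g s (Suc i)) \<le> C * D * real (Suc i) powr -2" .
  qed
qed

lemma powr_double_bound:
  fixes x y e :: real
  assumes "1 \<le> x" "x \<le> y" "y \<le> 2 * x" shows "y powr e \<le> 2 powr \<bar>e\<bar> * x powr e"
proof (cases "e \<ge> 0")
  case True
  then have "y powr e \<le> (2 * x) powr e" using assms by (intro powr_mono2) auto
  with True assms show ?thesis by (simp add: powr_mult)
next
  case False
  then have "y powr e \<le> 1 * x powr e" using assms by (simp add: powr_mono2')
  also have "\<dots> \<le> 2 powr \<bar>e\<bar> * x powr e" by (intro mult_right_mono ge_one_powr_ge_zero) auto
  finally show ?thesis .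
qed

text \<open>As \<open>z\<close> is comparable to \<open>y\<close>, its power merges with that of
  \<open>y\<close>. If the smaller variable \<open>x\<close> has an exponent above -2, the excess is
  handed over to \<open>y\<close>, since then \<open>x powr (a + 2)\<close> is at most
  \<open>y powr (a + 2)\<close>; the condition on \<open>a + b + c\<close> leaves \<open>y\<close>
  enough decay.\<close>

lemma tornheim_bound_le:
  fixes x y z a b c :: real
  assumes "1 \<le> x" "x \<le> y" "y \<le> z" "z \<le> 2 * y" "b + c \<le> -2" "a + b + c \<le> -4"
  shows "x powr a * y powr b * z powr c \<le> 2 powr \<bar>c\<bar> * (x powr -2 * y powr -2)"
proof -
  have "x powr a * y powr b * z powr c \<le> x powr a * y powr b * (2 powr \<bar>c\<bar> * y powr c)"
    using assms by (intro mult_left_mono powr_double_bound) auto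
  also have "\<dots> = 2 powr \<bar>c\<bar> * (x powr a * y powr (b + c))" by (simp add: powr_add)
  also have "x powr a * y powr (b + c) \<le> x powr -2 * y powr -2"
  proof (cases "a \<le> -2")
    case True
    with assms show ?thesis by (intro mult_mono powr_mono) auto
  next
    case False
    have "x powr a * y powr (b + c) = x powr -2 * (x powr (a + 2) * y powr (b + c))"
      using assms by (simp add: powr_add[symmetric] flip: mult.assoc)
    also have "\<dots> \<le> x powr -2 * (y powr (a + 2) * y powr (b + c))"
      using False assms by (intro mult_left_mono mult_right_mono powr_mono2) auto
    also have "\<dots> = x powr -2 * y powr (a + b + c + 2)"
      by (simp add: powr_add[symmetric] algebra_simps)
    also have "\<dots> \<le> x powr -2 * y powr -2"
      using assms by (intro mult_left_mono powr_mono) auto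
    finally show ?thesis .
  qed
  then have "2 powr \<bar>c\<bar> * (x powr a * y powr (b + c)) \<le> 2 powr \<bar>c\<bar> * (x powr -2 * y powr -2)"
    by (intro mult_left_mono) auto
  finally show ?thesis .
qed

lemma tornheim_bound:
  fixes x y z a b c :: real
  assumes "1 \<le> x" "1 \<le> y" "max x y \<le> z" "z \<le> 2 * max x y" "a + c \<le> -2" "b + c \<le> -2" "a + b + c \<le> -4"
  shows "x powr a * y powr b * z powr c \<le> 2 powr \<bar>c\<bar> * (x powr -2 * y powr -2)"
proof (cases "x \<le> y")
  case True
  with assms show ?thesis by (intro tornheim_bound_le) (auto simp: max_def)
next
  case False
  then have "y powr b * x powr a * z powr c \<le> 2 powr \<bar>c\<bar> * (y powr -2 * x powr -2)"
    using assms by (intro tornheim_bound_le) (auto simp: max_def)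
  then show ?thesis by (simp add: mult_ac)
qed

text \<open>Each exponent \<open>- Re s - k\<close> is below \<open>N - k\<close>. A pair of factors
  therefore loses \<open>2 * N\<close> and all three lose \<open>3 * N\<close>, which gives the
  thresholds matching \<open>tornheim_bound\<close>.\<close>

lemma tornheim_ext_base:
  assumes "k1 + k3 \<ge> 2 + 2 * int N" "k2 + k3 \<ge> 2 + 2 * int N" "k1 + k2 + k3 \<ge> 4 + 3 * int N"
  shows "tornheim_ext (- real N) k1 k2 k3"
  unfolding tornheim_ext_def tornheim_sum_def
proof (intro allI impI mero_ext_infsum)
  fix f g h and R :: real assume f: "symbol k1 f" and g: "symbol k2 g" and h: "symbol k3 h"
  show "(\<lambda>s. case i of (m, n) \<Rightarrow> f s (Suc m) * g s (Suc n) * h s (Suc (m + n))) holomorphic_on UNIV" for i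
    by (cases i) (auto intro!: holomorphic_intros symbol_holomorphic[OF f] symbol_holomorphic[OF g] symbol_holomorphic[OF h])
  obtain C where C: "C \<ge> 0" "\<And>s n. norm s \<le> R \<Longrightarrow> n \<ge> 1 \<Longrightarrow> norm (f s n) \<le> C * real n powr (- Re s - of_int k1)"
    using order_boundD[OF symbol_order_bound[OF f], of R] by metis
  obtain D where D: "D \<ge> 0" "\<And>s n. norm s \<le> R \<Longrightarrow> n \<ge> 1 \<Longrightarrow> norm (g s n) \<le> D * real n powr (- Re s - of_int k2)"
    using order_boundD[OF symbol_order_bound[OF g], of R] by metis
  obtain E where E: "E \<ge> 0" "\<And>s n. norm s \<le> R \<Longrightarrow> n \<ge> 1 \<Longrightarrow> norm (h s n) \<le> E * real n powr (- Re s - of_int k3)"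
    using order_boundD[OF symbol_order_bound[OF h], of R] by metis
  show "\<exists>M. M summable_on UNIV \<and> (\<forall>s i. norm s \<le> R \<longrightarrow> Re s > - real N \<longrightarrow>
      norm (case i of (m, n) \<Rightarrow> f s (Suc m) * g s (Suc n) * h s (Suc (m + n))) \<le> M i)"
  proof (intro exI conjI allI impI)
    define K where "K = C * D * E * 2 powr (R + \<bar>of_int k3\<bar>)"
    show "(\<lambda>(m, n). K * (real (Suc m) powr -2 * real (Suc n) powr -2)) summable_on UNIV"
      using summable_on_cmult_right[OF summable_powr_Suc2[of 2], of K] by (simp add: case_prod_unfold)
    fix s and i :: "nat \<times> nat" assume s: "norm s \<le> R" "Re s > - real N"
    obtain m n where i: "i = (m, n)" by (cases i)
    have "\<bar>Re s\<bar> \<le> R" using s(1) abs_Re_le_cmod order_trans by blast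
    then have e: "\<bar>- Re s - of_int k3\<bar> \<le> R + \<bar>of_int k3\<bar>" by linarith
    have "real_of_int (k1 + k3) \<ge> 2 + 2 * real N" "real_of_int (k2 + k3) \<ge> 2 + 2 * real N"
      "real_of_int (k1 + k2 + k3) \<ge> 4 + 3 * real N" using assms by linarith+
    note k = this
    have "norm (f s (Suc m) * g s (Suc n) * h s (Suc (m + n))) \<le>
      (C * real (Suc m) powr (- Re s - of_int k1)) * (D * real (Suc n) powr (- Re s - of_int k2))
       * (E * real (Suc (m + n)) powr (- Re s - of_int k3))"
      unfolding norm_mult by (intro mult_mono C D E s) (use C D E in auto)
    also have "\<dots> = C * D * E * (real (Suc m) powr (- Re s - of_int k1) * real (Suc n) powr (- Re s - of_int k2)
       * real (Suc (m + n)) powr (- Re s - of_int k3))" by (simp add: mult_ac)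
    also have "\<dots> \<le> C * D * E * (2 powr \<bar>- Re s - of_int k3\<bar> * (real (Suc m) powr -2 * real (Suc n) powr -2))"
      using C D E s k by (intro mult_left_mono tornheim_bound) (auto simp: max_def)
    also have "\<dots> \<le> C * D * E * (2 powr (R + \<bar>of_int k3\<bar>) * (real (Suc m) powr -2 * real (Suc n) powr -2))"
      using C D E e by (intro mult_left_mono mult_right_mono powr_mono) auto
    finally show "norm (case i of (m, n) \<Rightarrow> f s (Suc m) * g s (Suc n) * h s (Suc (m + n)))
      \<le> (case i of (m, n) \<Rightarrow> K * (real (Suc m) powr -2 * real (Suc n) powr -2))"
      by (simp add: i K_def mult_ac)
  qed
qed

lemma triangle_ext_base:
  assumes "k1 \<ge> 2 + int N" "k2 \<ge> 2 + int N" "k3 \<ge> 2 + int N"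
  shows "triangle_ext (- real N) k1 k2 k3"
  unfolding triangle_ext_def triangle_sum_def
proof (intro allI impI mero_ext_infsum)
  fix f g h and R :: real assume f: "symbol k1 f" and g: "symbol k2 g" and h: "symbol k3 h"
  show "(\<lambda>s. case i of (a, b, c) \<Rightarrow> f s (Suc (a + b)) * g s (Suc (b + c)) * h s (Suc (c + a))) holomorphic_on UNIV" for i
    by (cases i) (auto intro!: holomorphic_intros symbol_holomorphic[OF f] symbol_holomorphic[OF g] symbol_holomorphic[OF h])
  have B: "\<exists>C\<ge>0. \<forall>s m n. norm s \<le> R \<longrightarrow> Re s > - real N \<longrightarrow> norm (f s (Suc (m + n))) \<le> C * real (Suc m) powr -2"
    if f: "symbol k f" and k: "k \<ge> 2 + int N" for f k
  proof -
    obtain C where C: "C \<ge> 0" "\<And>s n. norm s \<le> R \<Longrightarrow> n \<ge> 1 \<Longrightarrow> norm (f s n) \<le> C * real n powr (- Re s - of_int k)"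
      using order_boundD[OF symbol_order_bound[OF f], of R] by metis
    show ?thesis
    proof (intro exI[of _ C] conjI allI impI C(1))
      fix s m n assume s: "norm s \<le> R" "Re s > - real N"
      have "norm (f s (Suc (m + n))) \<le> C * real (Suc (m + n)) powr (- Re s - of_int k)" by (intro C s) auto
      also have "\<dots> \<le> C * real (Suc (m + n)) powr -2" using s k C(1) by (intro mult_left_mono powr_mono) auto
      also have "\<dots> \<le> C * real (Suc m) powr -2" using C(1) by (intro mult_left_mono powr_mono2') auto
      finally show "norm (f s (Suc (m + n))) \<le> C * real (Suc m) powr -2" .
    qed
  qed
  obtain C where C: "C \<ge> 0" "\<And>s m n. norm s \<le> R \<Longrightarrow> Re s > - real N \<Longrightarrow> norm (f s (Suc (m + n))) \<le> C * real (Suc m) powr -2"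
    using B[OF f assms(1)] by blast
  obtain D where D: "D \<ge> 0" "\<And>s m n. norm s \<le> R \<Longrightarrow> Re s > - real N \<Longrightarrow> norm (g s (Suc (m + n))) \<le> D * real (Suc m) powr -2"
    using B[OF g assms(2)] by blast
  obtain E where E: "E \<ge> 0" "\<And>s m n. norm s \<le> R \<Longrightarrow> Re s > - real N \<Longrightarrow> norm (h s (Suc (m + n))) \<le> E * real (Suc m) powr -2"
    using B[OF h assms(3)] by blast
  show "\<exists>M. M summable_on UNIV \<and> (\<forall>s i. norm s \<le> R \<longrightarrow> Re s > - real N \<longrightarrow>
      norm (case i of (a, b, c) \<Rightarrow> f s (Suc (a + b)) * g s (Suc (b + c)) * h s (Suc (c + a))) \<le> M i)"
  proof (intro exI conjI allI impI)
    show "(\<lambda>(a, b, c). C * D * E * (real (Suc a) powr -2 * (real (Suc b) powr -2 * real (Suc c) powr -2))) summable_on UNIV"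
      using summable_on_cmult_right[OF summable_powr_Suc3[of 2], of "C * D * E"] by (simp add: case_prod_unfold)
    fix s and i :: "nat \<times> nat \<times> nat" assume s: "norm s \<le> R" "Re s > - real N"
    obtain a b c where i: "i = (a, b, c)" by (cases i)
    have "norm (f s (Suc (a + b)) * g s (Suc (b + c)) * h s (Suc (c + a)))
       \<le> (C * real (Suc a) powr -2) * (D * real (Suc b) powr -2) * (E * real (Suc c) powr -2)"
      unfolding norm_mult by (intro mult_mono C D E s) (use C D E in auto)
    then show "norm (case i of (a, b, c) \<Rightarrow> f s (Suc (a + b)) * g s (Suc (b + c)) * h s (Suc (c + a)))
      \<le> (case i of (a, b, c) \<Rightarrow> C * D * E * (real (Suc a) powr -2 * (real (Suc b) powr -2 * real (Suc c) powr -2)))"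
      by (simp add: i mult_ac)
  qed
qed

lemma diag_extD: "diag_ext X k1 k2 \<Longrightarrow> symbol k1 f \<Longrightarrow> symbol k2 g \<Longrightarrow> mero_ext X (\<lambda>s. diag_sum (f s) (g s))"
  unfolding diag_ext_def by blast

lemma tornheim_extD: "tornheim_ext X k1 k2 k3 \<Longrightarrow> symbol k1 f \<Longrightarrow> symbol k2 g \<Longrightarrow> symbol k3 h \<Longrightarrow>
    mero_ext X (\<lambda>s. tornheim_sum (f s) (g s) (h s))"
  unfolding tornheim_ext_def by blast

lemma triangle_extD: "triangle_ext X k1 k2 k3 \<Longrightarrow> symbol k1 f \<Longrightarrow> symbol k2 g \<Longrightarrow> symbol k3 h \<Longrightarrow>
    mero_ext X (\<lambda>s. triangle_sum (f s) (g s) (h s))"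
  unfolding triangle_ext_def by blast

lemma tornheim_ext_swap:
  assumes "tornheim_ext X k1 k2 k3" shows "tornheim_ext X k2 k1 k3"
  unfolding tornheim_ext_def
proof (intro allI impI)
  fix f g h assume "symbol k2 f" "symbol k1 g" "symbol k3 h"
  then have "mero_ext X (\<lambda>s. tornheim_sum (g s) (f s) (h s))" by (intro tornheim_extD[OF assms])
  also have "(\<lambda>s. tornheim_sum (g s) (f s) (h s)) = (\<lambda>s. tornheim_sum (f s) (g s) (h s))" by (intro ext tornheim_sum_commute)
  finally show "mero_ext X \<dots>" .
qed

lemma triangle_ext_rotate:
  assumes "triangle_ext X k1 k2 k3" shows "triangle_ext X k2 k3 k1"
  unfolding triangle_ext_def
proof (intro allI impI)
  fix f g h assume "symbol k2 f" "symbol k3 g" "symbol k1 h"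
  then have "mero_ext X (\<lambda>s. triangle_sum (h s) (f s) (g s))" by (intro triangle_extD[OF assms])
  also have "(\<lambda>s. triangle_sum (h s) (f s) (g s)) = (\<lambda>s. triangle_sum (f s) (g s) (h s))" by (intro ext triangle_sum_rotate)
  finally show "mero_ext X \<dots>" .
qed

section \<open>Recursion for diagonal sums\<close>

lemma add_1_1: "k + 1 + 1 = k + (2 :: int)"
  by simp

text \<open>The shape \<open>c * f + (1 * r + f')\<close> lets the linearity lemmas apply twice,
  splitting a sum into leading part, remainder and shifted sum.\<close>

lemma symbol_shift_eq:
  assumes "k' + 1 = k" "k + 1 = k''"
  obtains r where "symbol k'' r"
    "\<And>s n. cpow k' s n = (of_nat a * (s + of_int k')) * cpow k s n + (1 * r s n + cpow k' s (n + a))"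
proof -
  obtain r where r: "symbol (k' + 2) r"
    "\<And>s n. cpow k' s n - cpow k' s (n + a) = of_nat a * (s + of_int k') * cpow (k' + 1) s n + r s n"
    using symbol_shift_diff[of k' a] by blast
  have k: "k' + 2 = k''" "k' + 1 = k" using assms by auto
  show ?thesis
  proof (rule that)
    show "symbol k'' r" using r(1) k by simp
    show "cpow k' s n = (of_nat a * (s + of_int k')) * cpow k s n + (1 * r s n + cpow k' s (n + a))" for s n
      using r(2)[of s n] unfolding k by (simp add: diff_eq_eq add_ac)
  qed
qed

text \<open>Summation by parts for a product \<open>F G\<close> in which \<open>F\<close> has order
  \<open>k1 - 1\<close>: by \<open>F G - F' G' = (F - F') G + F' (G - G')\<close> the two leading
  coefficients \<open>s + k1 - 1\<close> and \<open>s + k2\<close> add up to the divisor, and all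
  remaining sums have larger total order.\<close>

lemma diag_ext_step:
  assumes hyp: "diag_ext X (k1 + 1) k2" "diag_ext X k1 (k2 + 1)" "diag_ext X (k1 - 1) (k2 + 2)"
  shows "diag_ext X k1 k2"
proof -
  have pure: "mero_ext X (\<lambda>s. diag_sum (cpow k1 s) (cpow k2 s))"
  proof -
    define F where "F = cpow (k1 - 1)"
    define F' where "F' = (\<lambda>s n. F s (n + 1))"
    define G where "G = cpow k2"
    define G' where "G' = (\<lambda>s n. G s (n + 1))"
    obtain r where r: "symbol (k1 + 1) r" "\<And>s n. F s n = (of_nat 1 * (s + of_int (k1 - 1))) * cpow k1 s n + (1 * r s n + F' s n)"
      using symbol_shift_eq[of "k1 - 1" k1 "k1 + 1" 1, OF diff_add_cancel refl] unfolding F'_def F_def by blast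
    obtain q where q: "symbol (k2 + 2) q" "\<And>s n. G s n = (of_nat 1 * (s + of_int k2)) * cpow (k2 + 1) s n + (1 * q s n + G' s n)"
      using symbol_shift_eq[of k2 "k2 + 1" "k2 + 2" 1, OF refl add_1_1] unfolding G'_def G_def by blast
    \<comment> \<open>The leading part of \<open>F' (G - G')\<close> still contains the shifted
      \<open>F'\<close>; replacing it by \<open>F\<close> costs a symbol one order higher than
      \<open>F\<close>.\<close>
    obtain t where t: "symbol k1 t" "\<And>s n. F' s n = 1 * F s n + t s n"
      using symbol_shift_diff'[of "k1 - 1" 1] unfolding F'_def F_def by auto
    have sF: "symbol (k1 - 1) F" "symbol (k1 - 1) F'" and sG: "symbol k2 G" "symbol k2 G'"
      unfolding F_def F'_def G_def G'_def by (auto intro: symbol_cpow symbol_shift[of _ 1, simplified])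
    have "eventually (\<lambda>s. (of_nat (Suc 1) * s + of_int (k1 + k2 - 1)) * diag_sum (cpow k1 s) (cpow k2 s)
       = 1 - diag_sum (r s) (G s) - diag_sum (F' s) (q s) - (s + of_int k2) * diag_sum (t s) (cpow (k2 + 1) s)) rhp_top"
      using eventually_quad_decay[OF sF(1)] eventually_quad_decay[OF sF(2)] eventually_quad_decay[OF sG(1)] eventually_quad_decay[OF sG(2)]
        eventually_quad_decay[OF r(1)] eventually_quad_decay[OF q(1)] eventually_quad_decay[OF t(1)]
        eventually_quad_decay[OF symbol_cpow[of k1]] eventually_quad_decay[OF symbol_cpow[of "k2 + 1"]]
    proof eventually_elim
      case (elim s)
      note d = elim
      have d': "quad_decay (\<lambda>n. 1 * r s n + F' s n)" "quad_decay (\<lambda>n. 1 * q s n + G' s n)"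
        using d by (auto intro!: quad_decay_add)
      have 1: "diag_sum (F s) (G s) - diag_sum (F' s) (G' s) = 1"
        using diag_sum_telescope[OF d(1) d(3)] by (simp add: F'_def G'_def F_def G_def)
      have "diag_sum (F s) (G s) = diag_sum (\<lambda>n. (of_nat 1 * (s + of_int (k1 - 1))) * cpow k1 s n + (1 * r s n + F' s n)) (G s)"
        by (rule diag_sum_cong) (simp only: r(2))
      also have "\<dots> = (of_nat 1 * (s + of_int (k1 - 1))) * diag_sum (cpow k1 s) (G s) + (1 * diag_sum (r s) (G s) + diag_sum (F' s) (G s))"
        using d d' by (simp only: diag_sum_linear)
      finally have 2: "diag_sum (F s) (G s) = \<dots>" .
      have "diag_sum (F' s) (G s) = diag_sum (F' s) (\<lambda>n. (of_nat 1 * (s + of_int k2)) * cpow (k2 + 1) s n + (1 * q s n + G' s n))"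
        by (rule diag_sum_cong) (simp only: q(2))
      also have "\<dots> = (of_nat 1 * (s + of_int k2)) * diag_sum (F' s) (cpow (k2 + 1) s) + (1 * diag_sum (F' s) (q s) + diag_sum (F' s) (G' s))"
        using d d' by (simp only: diag_sum_linear2)
      finally have 3: "diag_sum (F' s) (G s) = \<dots>" .
      have "diag_sum (F' s) (cpow (k2 + 1) s) = diag_sum (\<lambda>n. 1 * F s n + t s n) (cpow (k2 + 1) s)"
        by (rule diag_sum_cong) (simp only: t(2))
      also have "\<dots> = 1 * diag_sum (F s) (cpow (k2 + 1) s) + diag_sum (t s) (cpow (k2 + 1) s)"
        using d by (simp only: diag_sum_linear)
      \<comment> \<open>On the diagonal both factors have the same argument, so a factor
        \<open>n\<close> can pass from one to the other and both leading parts are the same sum.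
        This is what fails for Tornheim sums.\<close>
      also have "diag_sum (F s) (cpow (k2 + 1) s) = diag_sum (cpow k1 s) (cpow k2 s)"
      proof (rule diag_sum_cong)
        fix n :: nat assume "n \<ge> 1"
        then show "F s n * cpow (k2 + 1) s n = cpow k1 s n * cpow k2 s n"
          using cpow_mult_nat[of n k1 s, symmetric] cpow_mult_nat[of n "k2 + 1" s, symmetric]
          by (simp add: F_def mult_ac)
      qed
      finally have 4: "diag_sum (F' s) (cpow (k2 + 1) s) = 1 * diag_sum (cpow k1 s) (cpow k2 s) + diag_sum (t s) (cpow (k2 + 1) s)" .
      have 5: "diag_sum (cpow k1 s) (G s) = diag_sum (cpow k1 s) (cpow k2 s)" by (simp add: G_def)
      from 1 show ?case unfolding 2 3 4 5 by (simp add: algebra_simps)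
    qed
    moreover have "mero_ext X (\<lambda>s. 1 - diag_sum (r s) (G s) - diag_sum (F' s) (q s) - (s + of_int k2) * diag_sum (t s) (cpow (k2 + 1) s))"
      by (intro mero_ext_diff mero_ext_mult mero_ext_entire holomorphic_intros diag_extD[OF hyp(1) r(1) sG(1)]
          diag_extD[OF hyp(3) sF(2) q(1)] diag_extD[OF hyp(2) t(1) symbol_cpow])
    ultimately show ?thesis by (rule mero_ext_divide_affine[rotated])
  qed
  show ?thesis unfolding diag_ext_def
  proof (intro allI impI)
    fix f g assume f: "symbol k1 f" and g: "symbol k2 g"
    obtain c u where u: "c holomorphic_on UNIV" "symbol (k1 + 1) u" "\<And>s n. f s n = c s * cpow k1 s n + u s n"
      using symbol_decomp[OF f] by blast
    obtain d v where v: "d holomorphic_on UNIV" "symbol (k2 + 1) v" "\<And>s n. g s n = d s * cpow k2 s n + v s n"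
      using symbol_decomp[OF g] by blast
    show "mero_ext X (\<lambda>s. diag_sum (f s) (g s))"
    proof (rule mero_ext_cong)
      show "mero_ext X (\<lambda>s. c s * (d s * diag_sum (cpow k1 s) (cpow k2 s) + diag_sum (cpow k1 s) (v s)) + diag_sum (u s) (g s))"
        by (intro mero_ext_add mero_ext_mult pure mero_ext_entire u(1) v(1) diag_extD[OF hyp(1) u(2) g] diag_extD[OF hyp(2) symbol_cpow v(2)])
      show "\<forall>\<^sub>F s in rhp_top. diag_sum (f s) (g s) = c s * (d s * diag_sum (cpow k1 s) (cpow k2 s) + diag_sum (cpow k1 s) (v s)) + diag_sum (u s) (g s)"
        using eventually_quad_decay[OF symbol_cpow[of k1]] eventually_quad_decay[OF symbol_cpow[of k2]] eventually_quad_decay[OF g]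
          eventually_quad_decay[OF u(2)] eventually_quad_decay[OF v(2)]
      proof eventually_elim
        case (elim s)
        have "diag_sum (f s) (g s) = diag_sum (\<lambda>n. c s * cpow k1 s n + u s n) (g s)" by (rule diag_sum_cong) (simp only: u(3))
        also have "\<dots> = c s * diag_sum (cpow k1 s) (g s) + diag_sum (u s) (g s)" using elim by (simp only: diag_sum_linear)
        also have "diag_sum (cpow k1 s) (g s) = diag_sum (cpow k1 s) (\<lambda>n. d s * cpow k2 s n + v s n)" by (rule diag_sum_cong) (simp only: v(3))
        also have "\<dots> = d s * diag_sum (cpow k1 s) (cpow k2 s) + diag_sum (cpow k1 s) (v s)" using elim by (simp only: diag_sum_linear2)
        finally show ?case .
      qed
    qed
  qed
qed

lemma diag_ext_all: "diag_ext (- real N) k1 k2"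
proof (induction "nat (2 + 2 * int N - (k1 + k2))" arbitrary: k1 k2 rule: less_induct)
  case less
  show ?case
  proof (cases "k1 + k2 \<ge> 2 + 2 * int N")
    case True
    then show ?thesis by (rule diag_ext_base)
  next
    case False
    then have "nat (2 + 2 * int N - (k1 + 1 + k2)) < nat (2 + 2 * int N - (k1 + k2))"
      "nat (2 + 2 * int N - (k1 + (k2 + 1))) < nat (2 + 2 * int N - (k1 + k2))"
      "nat (2 + 2 * int N - (k1 - 1 + (k2 + 2))) < nat (2 + 2 * int N - (k1 + k2))"
      by linarith+
    from this[THEN less] show ?thesis by (rule diag_ext_step)
  qed
qed

section \<open>Recursion for Tornheim sums\<close>

lemma tornheim_ext_shift:
  assumes diag_ext: "\<And>k1 k2. diag_ext X k1 k2"
    and hyp: "tornheim_ext X k1 (k2 + 1) k3" "tornheim_ext X k1 k2 (k3 + 1)" "tornheim_ext X k1 (k2 - 1) (k3 + 2)"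
    and f: "symbol k1 f"
  shows "mero_ext X (\<lambda>s. (s + of_int (k2 - 1)) * tornheim_sum (f s) (cpow k2 s) (cpow k3 s)
    + (s + of_int k3) * tornheim_sum (f s) (cpow (k2 - 1) s) (cpow (k3 + 1) s))"
proof -
  define G where "G = cpow (k2 - 1)"
  define G' where "G' = (\<lambda>s n. G s (n + 1))"
  define H where "H = cpow k3"
  define H' where "H' = (\<lambda>s n. H s (n + 1))"
  obtain r where r: "symbol (k2 + 1) r" "\<And>s n. G s n = (of_nat 1 * (s + of_int (k2 - 1))) * cpow k2 s n + (1 * r s n + G' s n)"
    using symbol_shift_eq[of "k2 - 1" k2 "k2 + 1" 1, OF diff_add_cancel refl] unfolding G'_def G_def by blast
  obtain q where q: "symbol (k3 + 2) q" "\<And>s n. H s n = (of_nat 1 * (s + of_int k3)) * cpow (k3 + 1) s n + (1 * q s n + H' s n)"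
    using symbol_shift_eq[of k3 "k3 + 1" "k3 + 2" 1, OF refl add_1_1] unfolding H'_def H_def by blast
  obtain t where t: "symbol k2 t" "\<And>s n. G' s n = 1 * G s n + t s n"
    using symbol_shift_diff'[of "k2 - 1" 1] unfolding G'_def G_def by auto
  have sG: "symbol (k2 - 1) G" "symbol (k2 - 1) G'" and sH: "symbol k3 H" "symbol k3 H'"
    unfolding G_def G'_def H_def H'_def by (auto intro: symbol_cpow symbol_shift[of _ 1, simplified])
  \<comment> \<open>The product rule as for diagonal sums. Here \<open>G\<close> and
    \<open>H\<close> are evaluated at different arguments, so the two leading parts remain two
    distinct unknowns; only the right-hand side is covered by the hypotheses.\<close>
  have "eventually (\<lambda>s. (s + of_int (k2 - 1)) * tornheim_sum (f s) (cpow k2 s) (cpow k3 s)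
      + (s + of_int k3) * tornheim_sum (f s) (cpow (k2 - 1) s) (cpow (k3 + 1) s) =
      diag_sum (f s) (H s) - tornheim_sum (f s) (r s) (H s) - tornheim_sum (f s) (G' s) (q s)
      - (s + of_int k3) * tornheim_sum (f s) (t s) (cpow (k3 + 1) s)) rhp_top"
    using eventually_quad_decay[OF sG(1)] eventually_quad_decay[OF sG(2)] eventually_quad_decay[OF sH(1)] eventually_quad_decay[OF sH(2)]
      eventually_quad_decay[OF r(1)] eventually_quad_decay[OF q(1)] eventually_quad_decay[OF t(1)] eventually_quad_decay[OF f]
      eventually_quad_decay[OF symbol_cpow[of k2]] eventually_quad_decay[OF symbol_cpow[of "k3 + 1"]]
  proof eventually_elim
    case (elim s)
    note d = elim
    have d': "quad_decay (\<lambda>n. 1 * r s n + G' s n)" "quad_decay (\<lambda>n. 1 * q s n + H' s n)"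
      using d by (auto intro!: quad_decay_add)
    have 1: "tornheim_sum (f s) (G s) (H s) - tornheim_sum (f s) (G' s) (H' s) = diag_sum (f s) (H s)"
      using tornheim_sum_telescope[OF d(1) d(8) d(3)] by (simp add: G'_def H'_def G_def tornheim_sum_commute[of "f s"])
    have "tornheim_sum (f s) (G s) (H s) = tornheim_sum (f s) (\<lambda>n. (of_nat 1 * (s + of_int (k2 - 1))) * cpow k2 s n + (1 * r s n + G' s n)) (H s)"
      by (rule tornheim_sum_cong) (simp_all only: r(2))
    also have "\<dots> = (of_nat 1 * (s + of_int (k2 - 1))) * tornheim_sum (f s) (cpow k2 s) (H s) + (1 * tornheim_sum (f s) (r s) (H s) + tornheim_sum (f s) (G' s) (H s))"
      using d d' by (simp only: tornheim_sum_linear2)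
    finally have 2: "tornheim_sum (f s) (G s) (H s) = \<dots>" .
    have "tornheim_sum (f s) (G' s) (H s) = tornheim_sum (f s) (G' s) (\<lambda>n. (of_nat 1 * (s + of_int k3)) * cpow (k3 + 1) s n + (1 * q s n + H' s n))"
      by (rule tornheim_sum_cong) (simp_all only: q(2))
    also have "\<dots> = (of_nat 1 * (s + of_int k3)) * tornheim_sum (f s) (G' s) (cpow (k3 + 1) s) + (1 * tornheim_sum (f s) (G' s) (q s) + tornheim_sum (f s) (G' s) (H' s))"
      using d d' by (simp only: tornheim_sum_linear3)
    finally have 3: "tornheim_sum (f s) (G' s) (H s) = \<dots>" .
    have "tornheim_sum (f s) (G' s) (cpow (k3 + 1) s) = tornheim_sum (f s) (\<lambda>n. 1 * G s n + t s n) (cpow (k3 + 1) s)"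
      by (rule tornheim_sum_cong) (simp_all only: t(2))
    also have "\<dots> = 1 * tornheim_sum (f s) (G s) (cpow (k3 + 1) s) + tornheim_sum (f s) (t s) (cpow (k3 + 1) s)"
      using d by (simp only: tornheim_sum_linear2)
    finally have 4: "tornheim_sum (f s) (G' s) (cpow (k3 + 1) s) = \<dots>" .
    from 1 show ?case unfolding 2 3 4 by (simp add: algebra_simps G_def H_def)
  qed
  moreover have "mero_ext X (\<lambda>s. diag_sum (f s) (H s) - tornheim_sum (f s) (r s) (H s) - tornheim_sum (f s) (G' s) (q s)
      - (s + of_int k3) * tornheim_sum (f s) (t s) (cpow (k3 + 1) s))"
    by (intro mero_ext_diff mero_ext_mult mero_ext_entire holomorphic_intros diag_extD[OF diag_ext f sH(1)] tornheim_extD[OF hyp(1) f r(1) sH(1)]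
          tornheim_extD[OF hyp(3) f sG(2) q(1)] tornheim_extD[OF hyp(2) f t(1) symbol_cpow])
  ultimately show ?thesis by (rule mero_ext_cong[rotated])
qed

text \<open>The second equation for the two unknowns left by \<open>tornheim_ext_shift\<close>:
  \<open>tornheim_sum_mult\<close> with a last factor of order \<open>k3 + 1\<close>, the analogue
  of \<open>1 / (m n) = (1 / m + 1 / n) / (m + n)\<close>.\<close>

lemma tornheim_sum_partial_fraction:
  assumes f: "symbol k1 f"
  shows "eventually (\<lambda>s. tornheim_sum (f s) (cpow k2 s) (cpow k3 s) + tornheim_sum (f s) (cpow k2 s) (cpow (k3 + 1) s) =
     tornheim_sum (\<lambda>n. of_nat n * f s n) (cpow k2 s) (cpow (k3 + 1) s) + tornheim_sum (f s) (cpow (k2 - 1) s) (cpow (k3 + 1) s)) rhp_top"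
  using eventually_quad_decay[OF symbol_mult_nat[OF f]] eventually_quad_decay[OF symbol_mult_nat[OF symbol_cpow[of k2]]]
    eventually_quad_decay[OF symbol_mult_nat[OF symbol_cpow[of "k3 + 1"]]]
    eventually_quad_decay[OF f] eventually_quad_decay[OF symbol_cpow[of k2]] eventually_quad_decay[OF symbol_cpow[of "k3 + 1"]]
proof eventually_elim
  case (elim s)
  have "tornheim_sum (f s) (cpow k2 s) (\<lambda>n. of_nat n * cpow (k3 + 1) s n) = tornheim_sum (f s) (cpow k2 s) (cpow k3 s)"
    by (rule tornheim_sum_cong) (simp_all add: cpow_mult_nat)
  moreover have "tornheim_sum (f s) (\<lambda>n. of_nat n * cpow k2 s n) (cpow (k3 + 1) s) = tornheim_sum (f s) (cpow (k2 - 1) s) (cpow (k3 + 1) s)"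
    by (rule tornheim_sum_cong) (simp_all add: cpow_mult_nat)
  ultimately show ?case using tornheim_sum_mult[OF elim] by simp
qed

text \<open>Partial fractions replace the second unknown by the wanted sum, up to sums of orders
  \<open>(k1 - 1, k2, k3 + 1)\<close> and \<open>(k1, k2, k3 + 1)\<close>, both with larger
  \<open>k2 + k3\<close>. The coefficients \<open>s + k2 - 1\<close> and \<open>s + k3\<close> then
  add up to the divisor. Only the last two factors are expanded, so \<open>f\<close> can be any
  symbol.\<close>

lemma tornheim_ext_step_pair_pure:
  assumes diag_ext: "\<And>k1 k2. diag_ext X k1 k2"
    and hyp: "tornheim_ext X k1 (k2 + 1) k3" "tornheim_ext X k1 k2 (k3 + 1)" "tornheim_ext X k1 (k2 - 1) (k3 + 2)" "tornheim_ext X (k1 - 1) k2 (k3 + 1)"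
    and f: "symbol k1 f"
  shows "mero_ext X (\<lambda>s. tornheim_sum (f s) (cpow k2 s) (cpow k3 s))"
proof -
  let ?E = "\<lambda>s. (s + of_int (k2 - 1)) * tornheim_sum (f s) (cpow k2 s) (cpow k3 s)
    + (s + of_int k3) * tornheim_sum (f s) (cpow (k2 - 1) s) (cpow (k3 + 1) s)"
  let ?R = "\<lambda>s. ?E s + (s + of_int k3) * (tornheim_sum (\<lambda>n. of_nat n * f s n) (cpow k2 s) (cpow (k3 + 1) s)
     - tornheim_sum (f s) (cpow k2 s) (cpow (k3 + 1) s))"
  have "mero_ext X ?R"
    by (intro mero_ext_add[OF tornheim_ext_shift[OF diag_ext hyp(1-3) f]] mero_ext_mult mero_ext_diff mero_ext_entire holomorphic_intros
        tornheim_extD[OF hyp(4) symbol_mult_nat[OF f] symbol_cpow symbol_cpow] tornheim_extD[OF hyp(2) f symbol_cpow symbol_cpow])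
  moreover have "eventually (\<lambda>s. (of_nat (Suc 1) * s + of_int (k2 + k3 - 1)) * tornheim_sum (f s) (cpow k2 s) (cpow k3 s) = ?R s) rhp_top"
    using tornheim_sum_partial_fraction[OF f, of k2 k3]
  proof eventually_elim
    case (elim s)
    then have "tornheim_sum (\<lambda>n. of_nat n * f s n) (cpow k2 s) (cpow (k3 + 1) s) - tornheim_sum (f s) (cpow k2 s) (cpow (k3 + 1) s)
        = tornheim_sum (f s) (cpow k2 s) (cpow k3 s) - tornheim_sum (f s) (cpow (k2 - 1) s) (cpow (k3 + 1) s)"
      by (simp add: diff_eq_eq eq_diff_eq algebra_simps)
    then show ?case by (simp only:) (simp add: algebra_simps)
  qed
  ultimately show ?thesis by (rule mero_ext_divide_affine)
qed

lemma tornheim_ext_reduce: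
  assumes hyp: "tornheim_ext X k1 (k2 + 1) k3" "tornheim_ext X k1 k2 (k3 + 1)"
    and pure: "mero_ext X (\<lambda>s. tornheim_sum (f s) (cpow k2 s) (cpow k3 s))"
    and f: "symbol k1 f" and g: "symbol k2 g" and h: "symbol k3 h"
  shows "mero_ext X (\<lambda>s. tornheim_sum (f s) (g s) (h s))"
proof -
  obtain c u where u: "c holomorphic_on UNIV" "symbol (k2 + 1) u" "\<And>s n. g s n = c s * cpow k2 s n + u s n"
    using symbol_decomp[OF g] by blast
  obtain d v where v: "d holomorphic_on UNIV" "symbol (k3 + 1) v" "\<And>s n. h s n = d s * cpow k3 s n + v s n"
    using symbol_decomp[OF h] by blast
  show ?thesis
  proof (rule mero_ext_cong)
    show "mero_ext X (\<lambda>s. c s * (d s * tornheim_sum (f s) (cpow k2 s) (cpow k3 s) + tornheim_sum (f s) (cpow k2 s) (v s)) + tornheim_sum (f s) (u s) (h s))"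
      by (intro mero_ext_add mero_ext_mult pure mero_ext_entire u(1) v(1) tornheim_extD[OF hyp(1) f u(2) h] tornheim_extD[OF hyp(2) f symbol_cpow v(2)])
    show "\<forall>\<^sub>F s in rhp_top. tornheim_sum (f s) (g s) (h s) =
        c s * (d s * tornheim_sum (f s) (cpow k2 s) (cpow k3 s) + tornheim_sum (f s) (cpow k2 s) (v s)) + tornheim_sum (f s) (u s) (h s)"
      using eventually_quad_decay[OF symbol_cpow[of k2]] eventually_quad_decay[OF symbol_cpow[of k3]] eventually_quad_decay[OF f] eventually_quad_decay[OF h]
        eventually_quad_decay[OF u(2)] eventually_quad_decay[OF v(2)]
    proof eventually_elim
      case (elim s)
      have "tornheim_sum (f s) (g s) (h s) = tornheim_sum (f s) (\<lambda>n. c s * cpow k2 s n + u s n) (h s)" by (rule tornheim_sum_cong) (simp_all only: u(3))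
      also have "\<dots> = c s * tornheim_sum (f s) (cpow k2 s) (h s) + tornheim_sum (f s) (u s) (h s)" using elim by (simp only: tornheim_sum_linear2)
      also have "tornheim_sum (f s) (cpow k2 s) (h s) = tornheim_sum (f s) (cpow k2 s) (\<lambda>n. d s * cpow k3 s n + v s n)"
        by (rule tornheim_sum_cong) (simp_all only: v(3))
      also have "\<dots> = d s * tornheim_sum (f s) (cpow k2 s) (cpow k3 s) + tornheim_sum (f s) (cpow k2 s) (v s)"
        using elim by (simp only: tornheim_sum_linear3)
      finally show ?case .
    qed
  qed
qed

text \<open>The orders \<open>k1 + k3\<close>, \<open>k2 + k3\<close> and \<open>k1 + k2 + k3\<close> govern convergence. The two steps below raise the
  second and the third of them, respectively, without lowering the others.\<close>

lemma tornheim_ext_step_pair: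
  assumes diag_ext: "\<And>k1 k2. diag_ext X k1 k2"
    and hyp: "tornheim_ext X k1 (k2 + 1) k3" "tornheim_ext X k1 k2 (k3 + 1)" "tornheim_ext X k1 (k2 - 1) (k3 + 2)" "tornheim_ext X (k1 - 1) k2 (k3 + 1)"
  shows "tornheim_ext X k1 k2 k3"
  unfolding tornheim_ext_def using tornheim_ext_reduce[OF hyp(1,2)] tornheim_ext_step_pair_pure[OF diag_ext hyp] by blast

lemma tornheim_ext_step_total:
  assumes diag_ext: "\<And>k1 k2. diag_ext X k1 k2"
    and hyp: "tornheim_ext X k1 (k2 + 1) k3" "tornheim_ext X k1 k2 (k3 + 1)" "tornheim_ext X k1 (k2 - 1) (k3 + 2)"
      "tornheim_ext X (k1 + 1) k2 k3" "tornheim_ext X (k1 - 1) k2 (k3 + 2)"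
  shows "tornheim_ext X k1 k2 k3"
proof -
  have pure: "mero_ext X (\<lambda>s. tornheim_sum (cpow k1 s) (cpow k2 s) (cpow k3 s))"
  proof -
    let ?E = "\<lambda>s. (s + of_int (k2 - 1)) * tornheim_sum (cpow k1 s) (cpow k2 s) (cpow k3 s)
      + (s + of_int k3) * tornheim_sum (cpow k1 s) (cpow (k2 - 1) s) (cpow (k3 + 1) s)"
    let ?E' = "\<lambda>s. (s + of_int (k1 - 1)) * tornheim_sum (cpow k2 s) (cpow k1 s) (cpow k3 s)
      + (s + of_int k3) * tornheim_sum (cpow k2 s) (cpow (k1 - 1) s) (cpow (k3 + 1) s)"
    \<comment> \<open>Each of the two indices gives one shift relation. In their sum both side
      unknowns have the coefficient \<open>s + of_int k3\<close>, and partial fractions turn their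
      total into the wanted sum plus one with last order \<open>k3 + 1\<close>. The divisor becomes
      \<open>3 s + k1 + k2 + k3 - 2\<close>.\<close>
    let ?R = "\<lambda>s. ?E s + ?E' s - (s + of_int k3) * tornheim_sum (cpow k1 s) (cpow k2 s) (cpow (k3 + 1) s)"
    have e1: "mero_ext X ?E" by (rule tornheim_ext_shift[OF diag_ext hyp(1-3) symbol_cpow])
    have e2: "mero_ext X ?E'" by (rule tornheim_ext_shift[OF diag_ext hyp(4,2,5)[THEN tornheim_ext_swap] symbol_cpow])
    have "mero_ext X ?R"
      by (rule mero_ext_diff[OF mero_ext_add[OF e1 e2] mero_ext_mult[OF mero_ext_entire tornheim_extD[OF hyp(2) symbol_cpow symbol_cpow symbol_cpow]]])
        (intro holomorphic_intros)
    moreover have "eventually (\<lambda>s. (of_nat (Suc 2) * s + of_int (k1 + k2 + k3 - 2)) * tornheim_sum (cpow k1 s) (cpow k2 s) (cpow k3 s) = ?R s) rhp_top"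
      using tornheim_sum_partial_fraction[OF symbol_cpow[of k1], of k2 k3]
    proof eventually_elim
      case (elim s)
      have "tornheim_sum (\<lambda>n. of_nat n * cpow k1 s n) (cpow k2 s) (cpow (k3 + 1) s) = tornheim_sum (cpow (k1 - 1) s) (cpow k2 s) (cpow (k3 + 1) s)"
        by (rule tornheim_sum_cong) (simp_all add: cpow_mult_nat)
      with elim have P: "tornheim_sum (cpow k1 s) (cpow k2 s) (cpow (k3 + 1) s) = tornheim_sum (cpow (k1 - 1) s) (cpow k2 s) (cpow (k3 + 1) s)
          + tornheim_sum (cpow k1 s) (cpow (k2 - 1) s) (cpow (k3 + 1) s) - tornheim_sum (cpow k1 s) (cpow k2 s) (cpow k3 s)"
        by (simp add: algebra_simps)
      have comm: "tornheim_sum (cpow k2 s) (cpow k1 s) (cpow k3 s) = tornheim_sum (cpow k1 s) (cpow k2 s) (cpow k3 s)"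
        "tornheim_sum (cpow k2 s) (cpow (k1 - 1) s) (cpow (k3 + 1) s) = tornheim_sum (cpow (k1 - 1) s) (cpow k2 s) (cpow (k3 + 1) s)"
        by (rule tornheim_sum_commute)+
      show ?case unfolding P comm by (simp add: algebra_simps)
    qed
    ultimately show ?thesis by (rule mero_ext_divide_affine)
  qed
  have pure': "mero_ext X (\<lambda>s. tornheim_sum (f s) (cpow k2 s) (cpow k3 s))" if f: "symbol k1 f" for f
  proof -
    obtain c u where u: "c holomorphic_on UNIV" "symbol (k1 + 1) u" "\<And>s n. f s n = c s * cpow k1 s n + u s n"
      using symbol_decomp[OF f] by blast
    show ?thesis
    proof (rule mero_ext_cong)
      show "mero_ext X (\<lambda>s. c s * tornheim_sum (cpow k1 s) (cpow k2 s) (cpow k3 s) + tornheim_sum (u s) (cpow k2 s) (cpow k3 s))"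
        by (intro mero_ext_add mero_ext_mult pure mero_ext_entire u(1) tornheim_extD[OF hyp(4) u(2) symbol_cpow symbol_cpow])
      show "\<forall>\<^sub>F s in rhp_top. tornheim_sum (f s) (cpow k2 s) (cpow k3 s) =
          c s * tornheim_sum (cpow k1 s) (cpow k2 s) (cpow k3 s) + tornheim_sum (u s) (cpow k2 s) (cpow k3 s)"
        using eventually_quad_decay[OF symbol_cpow[of k1]] eventually_quad_decay[OF symbol_cpow[of k2]] eventually_quad_decay[OF symbol_cpow[of k3]]
          eventually_quad_decay[OF u(2)]
      proof eventually_elim
        case (elim s)
        have "tornheim_sum (f s) (cpow k2 s) (cpow k3 s) = tornheim_sum (\<lambda>n. c s * cpow k1 s n + u s n) (cpow k2 s) (cpow k3 s)"
          by (rule tornheim_sum_cong) (simp_all only: u(3))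
        also have "\<dots> = c s * tornheim_sum (cpow k1 s) (cpow k2 s) (cpow k3 s) + tornheim_sum (u s) (cpow k2 s) (cpow k3 s)"
          using elim by (simp only: tornheim_sum_linear)
        finally show ?case .
      qed
    qed
  qed
  show ?thesis unfolding tornheim_ext_def using tornheim_ext_reduce[OF hyp(1,2)] pure' by blast
qed

lemma tornheim_ext_all: "tornheim_ext (- real N) k1 k2 k3"
proof -
  \<comment> \<open>The total shortfall from the thresholds of \<open>tornheim_ext_base\<close>. The
    hypotheses of a step may lower single orders, but none of the three shortfalls grows and the one
    treated in the current case shrinks.\<close>
  define \<delta> where "\<delta> = (\<lambda>k1 k2 k3. nat (2 + 2 * int N - (k1 + k3)) + nat (2 + 2 * int N - (k2 + k3))
    + nat (4 + 3 * int N - (k1 + k2 + k3)))"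
  show ?thesis
  proof (induction "\<delta> k1 k2 k3" arbitrary: k1 k2 k3 rule: less_induct)
    case less
    consider "k2 + k3 < 2 + 2 * int N" | "k1 + k3 < 2 + 2 * int N" | "k1 + k2 + k3 < 4 + 3 * int N"
      | "k1 + k3 \<ge> 2 + 2 * int N" "k2 + k3 \<ge> 2 + 2 * int N" "k1 + k2 + k3 \<ge> 4 + 3 * int N" by linarith
    then show ?case
    proof cases
      case 1
      then have "\<delta> k1 (k2 + 1) k3 < \<delta> k1 k2 k3" "\<delta> k1 k2 (k3 + 1) < \<delta> k1 k2 k3"
        "\<delta> k1 (k2 - 1) (k3 + 2) < \<delta> k1 k2 k3" "\<delta> (k1 - 1) k2 (k3 + 1) < \<delta> k1 k2 k3"
        unfolding \<delta>_def by linarith+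
      from this[THEN less] show ?thesis by (rule tornheim_ext_step_pair[OF diag_ext_all])
    next
      case 2
      then have "\<delta> (k1 + 1) k2 k3 < \<delta> k1 k2 k3" "\<delta> k1 k2 (k3 + 1) < \<delta> k1 k2 k3"
        "\<delta> (k1 - 1) k2 (k3 + 2) < \<delta> k1 k2 k3" "\<delta> k1 (k2 - 1) (k3 + 1) < \<delta> k1 k2 k3"
        unfolding \<delta>_def by linarith+
      from this[THEN less, THEN tornheim_ext_swap] show ?thesis by (rule tornheim_ext_swap[OF tornheim_ext_step_pair[OF diag_ext_all]])
    next
      case 3
      then have "\<delta> k1 (k2 + 1) k3 < \<delta> k1 k2 k3" "\<delta> k1 k2 (k3 + 1) < \<delta> k1 k2 k3"
        "\<delta> k1 (k2 - 1) (k3 + 2) < \<delta> k1 k2 k3" "\<delta> (k1 + 1) k2 k3 < \<delta> k1 k2 k3"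
        "\<delta> (k1 - 1) k2 (k3 + 2) < \<delta> k1 k2 k3"
        unfolding \<delta>_def by linarith+
      from this[THEN less] show ?thesis by (rule tornheim_ext_step_total[OF diag_ext_all])
    next
      case 4
      then show ?thesis by (rule tornheim_ext_base)
    qed
  qed
qed

section \<open>Recursion for triangle sums\<close>

lemma triangle_ext_step:
  assumes diag_ext: "\<And>k1 k2. diag_ext X k1 k2" and tornheim_ext: "\<And>k1 k2 k3. tornheim_ext X k1 k2 k3" and hyp: "triangle_ext X (k1 + 1) k2 k3"
  shows "triangle_ext X k1 k2 k3"
  unfolding triangle_ext_def
proof (intro allI impI)
  fix f g h assume f: "symbol k1 f" and g: "symbol k2 g" and h: "symbol k3 h"
  \<comment> \<open>Only the argument of the first factor moves. So there is one unknown,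
    \<open>g\<close> and \<open>h\<close> stay arbitrary symbols, and the remainder raises the first
    order alone; the sums on the faces are known for all orders.\<close>
  have pure: "mero_ext X (\<lambda>s. triangle_sum (cpow k1 s) (g s) (h s))"
  proof -
    define G where "G = cpow (k1 - 1)"
    define G' where "G' = (\<lambda>s n. G s (n + 2))"
    obtain r where r: "symbol (k1 + 1) r" "\<And>s n. G s n = (of_nat 2 * (s + of_int (k1 - 1))) * cpow k1 s n + (1 * r s n + G' s n)"
      using symbol_shift_eq[of "k1 - 1" k1 "k1 + 1" 2, OF diff_add_cancel refl] unfolding G'_def G_def by blast
    have sG: "symbol (k1 - 1) G" "symbol (k1 - 1) G'"
      unfolding G_def G'_def by (rule symbol_cpow symbol_shift)+
    let ?R = "\<lambda>s. tornheim_sum (G s) (h s) (g s) + tornheim_sum (G s) (g s) (h s) - diag_sum (g s) (h s) - tornheim_sum (g s) (h s) (G' s) - triangle_sum (r s) (g s) (h s)"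
    have "mero_ext X ?R"
      by (intro mero_ext_add mero_ext_diff tornheim_extD[OF tornheim_ext sG(1) h g] tornheim_extD[OF tornheim_ext sG(1) g h] diag_extD[OF diag_ext g h]
          tornheim_extD[OF tornheim_ext g h sG(2)] triangle_extD[OF hyp r(1) g h])
    moreover have "eventually (\<lambda>s. (of_nat (Suc 1) * s + of_int (2 * (k1 - 1))) * triangle_sum (cpow k1 s) (g s) (h s) = ?R s) rhp_top"
      using eventually_quad_decay[OF sG(1)] eventually_quad_decay[OF sG(2)] eventually_quad_decay[OF r(1)] eventually_quad_decay[OF g] eventually_quad_decay[OF h]
        eventually_quad_decay[OF symbol_cpow[of k1]]
    proof eventually_elim
      case (elim s)
      have d': "quad_decay (\<lambda>n. 1 * r s n + G' s n)" using elim by (auto intro!: quad_decay_add)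
      have "G s = (\<lambda>n. (of_nat 2 * (s + of_int (k1 - 1))) * cpow k1 s n + (1 * r s n + G' s n))"
        using r(2) by blast
      then have "triangle_sum (G s) (g s) (h s) = triangle_sum (\<lambda>n. (of_nat 2 * (s + of_int (k1 - 1))) * cpow k1 s n + (1 * r s n + G' s n)) (g s) (h s)"
        by metis
      also have "\<dots> = (of_nat 2 * (s + of_int (k1 - 1))) * triangle_sum (cpow k1 s) (g s) (h s) + (1 * triangle_sum (r s) (g s) (h s) + triangle_sum (G' s) (g s) (h s))"
        using elim d' by (simp only: triangle_sum_linear)
      finally have E: "triangle_sum (G s) (g s) (h s) = \<dots>" .
      have "triangle_sum (G s) (g s) (h s) - triangle_sum (G' s) (g s) (h s) =
          tornheim_sum (G s) (h s) (g s) + tornheim_sum (G s) (g s) (h s) - diag_sum (g s) (h s) - tornheim_sum (g s) (h s) (G' s)"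
        using triangle_sum_telescope[OF elim(1,4,5)] by (simp add: G'_def G_def)
      then have "(of_nat 2 * (s + of_int (k1 - 1))) * triangle_sum (cpow k1 s) (g s) (h s) + triangle_sum (r s) (g s) (h s) =
          tornheim_sum (G s) (h s) (g s) + tornheim_sum (G s) (g s) (h s) - diag_sum (g s) (h s) - tornheim_sum (g s) (h s) (G' s)"
        unfolding E by (simp only: add_diff_cancel_right' add_diff_eq[symmetric] diff_self mult_1 add.assoc[symmetric] add_0_right)
      moreover have "of_nat (Suc 1) * s + of_int (2 * (k1 - 1)) = of_nat 2 * (s + of_int (k1 - 1))"
        by (simp add: algebra_simps)
      ultimately show ?case by (simp only: eq_diff_eq)
    qed
    ultimately show ?thesis by (rule mero_ext_divide_affine)
  qed
  obtain c u where u: "c holomorphic_on UNIV" "symbol (k1 + 1) u" "\<And>s n. f s n = c s * cpow k1 s n + u s n"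
    using symbol_decomp[OF f] by blast
  show "mero_ext X (\<lambda>s. triangle_sum (f s) (g s) (h s))"
  proof (rule mero_ext_cong)
    show "mero_ext X (\<lambda>s. c s * triangle_sum (cpow k1 s) (g s) (h s) + triangle_sum (u s) (g s) (h s))"
      by (intro mero_ext_add mero_ext_mult pure mero_ext_entire u(1) triangle_extD[OF hyp u(2) g h])
    show "\<forall>\<^sub>F s in rhp_top. triangle_sum (f s) (g s) (h s) = c s * triangle_sum (cpow k1 s) (g s) (h s) + triangle_sum (u s) (g s) (h s)"
      using eventually_quad_decay[OF symbol_cpow[of k1]] eventually_quad_decay[OF g] eventually_quad_decay[OF h] eventually_quad_decay[OF u(2)]
    proof eventually_elim
      case (elim s)
      have "f s = (\<lambda>n. c s * cpow k1 s n + u s n)" using u(3) by blast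
      then show ?case using triangle_sum_linear[OF elim(1,4,2,3), of "c s"] by simp
    qed
  qed
qed

lemma triangle_ext_all: "triangle_ext (- real N) k1 k2 k3"
proof -
  define \<delta> where "\<delta> = (\<lambda>k1 k2 k3. nat (2 + int N - k1) + nat (2 + int N - k2) + nat (2 + int N - k3))"
  show ?thesis
  proof (induction "\<delta> k1 k2 k3" arbitrary: k1 k2 k3 rule: less_induct)
    case less
    note step = triangle_ext_step[OF diag_ext_all tornheim_ext_all]
    consider "k1 < 2 + int N" | "k2 < 2 + int N" | "k3 < 2 + int N"
      | "k1 \<ge> 2 + int N" "k2 \<ge> 2 + int N" "k3 \<ge> 2 + int N" by linarith
    then show ?case
    proof cases
      case 1
      then have "\<delta> (k1 + 1) k2 k3 < \<delta> k1 k2 k3" unfolding \<delta>_def by linarith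
      from step[OF this[THEN less]] show ?thesis .
    next
      case 2
      then have "\<delta> (k2 + 1) k3 k1 < \<delta> k1 k2 k3" unfolding \<delta>_def by linarith
      from step[OF this[THEN less], THEN triangle_ext_rotate, THEN triangle_ext_rotate] show ?thesis .
    next
      case 3
      then have "\<delta> (k3 + 1) k1 k2 < \<delta> k1 k2 k3" unfolding \<delta>_def by linarith
      from step[OF this[THEN less], THEN triangle_ext_rotate] show ?thesis .
    next
      case 4
      then show ?thesis by (rule triangle_ext_base)
    qed
  qed
qed

section \<open>Gluing the continuations to larger and larger half-planes\<close>

lemma meromorphic_eq_continuation:
  assumes f: "f meromorphic_on {s. Re s > X}" and g: "g meromorphic_on {s. Re s > X}"
    and eq: "eventually (\<lambda>s. f s = g s) rhp_top" and z: "Re z > X"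
  shows "eventually (\<lambda>s. f s = g s) (at z)"
proof -
  let ?H = "{s. Re s > X}"
  \<comment> \<open>With singularities removed, \<open>D\<close> is nicely meromorphic, and
    vanishing near one point far to the right forces it to vanish on the connected half-plane. The
    values of \<open>f\<close> and \<open>g\<close> at poles are arbitrary, so equality is only
    claimed on punctured neighbourhoods.\<close>
  define D where "D = remove_sings (\<lambda>s. f s - g s)"
  have diff: "(\<lambda>s. f s - g s) meromorphic_on ?H" by (intro meromorphic_intros f g)
  obtain A where A: "\<And>s. Re s > A \<Longrightarrow> f s = g s" using eq by (auto simp: eventually_rhp_top)
  define w where "w = complex_of_real (max A X + 1)"
  have w: "Re w > A" "Re w > X" by (auto simp: w_def)
  have "open {s. Re s > A}" by (rule open_halfspace_Re_gt)
  with w(1) have "eventually (\<lambda>s. s \<in> {s. Re s > A}) (at w)"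
    by (intro eventually_at_in_open') auto
  moreover have "eventually (\<lambda>s. D s = f s - g s) (at w)"
    unfolding D_def using diff w(2)
    by (intro eventually_remove_sings_eq_at meromorphic_on_isolated_singularity) (auto intro: meromorphic_on_subset)
  ultimately have "eventually (\<lambda>s. D s = 0) (at w)" by eventually_elim (auto simp: A)
  then have "frequently (\<lambda>s. D s = 0) (at w)" by (intro eventually_frequently) auto
  then have D0: "D s = 0" if "Re s > X" for s
    by (rule frequently_eq_meromorphic_imp_constant[of _ _ _ ?H])
      (use that w diff in \<open>auto simp: D_def open_halfspace_Re_gt intro!: remove_sings_nicely_meromorphic
         convex_connected convex_halfspace_Re_gt\<close>)
  have "eventually (\<lambda>s. s \<in> ?H) (at z)"
    using z by (intro eventually_at_in_open' open_halfspace_Re_gt) auto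
  moreover have "eventually (\<lambda>s. D s = f s - g s) (at z)"
    unfolding D_def using diff z
    by (intro eventually_remove_sings_eq_at meromorphic_on_isolated_singularity) (auto intro: meromorphic_on_subset)
  ultimately show ?thesis by eventually_elim (use D0 in auto)
qed

lemma mero_ext_glue:
  assumes mero_ext: "\<And>N. mero_ext (- real N) F" and hol: "F holomorphic_on {s. Re s > X}"
  obtains Z where "Z meromorphic_on UNIV" "\<And>s. Re s > X \<Longrightarrow> Z s = F s"
proof -
  have "\<exists>Y. \<forall>N. Y N meromorphic_on {s. Re s > - real N} \<and> eventually (\<lambda>s. Y N s = F s) rhp_top"
    using mero_ext unfolding mero_ext_def by (intro choice) blast
  then obtain Y where Y: "\<And>N. Y N meromorphic_on {s. Re s > - real N}"
    "\<And>N. eventually (\<lambda>s. Y N s = F s) rhp_top" by blast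
  define idx where "idx = (\<lambda>s. nat \<lceil>- Re s\<rceil> + 1)"
  \<comment> \<open>Different \<open>Y N\<close> may disagree at isolated points.
    \<open>remove_sings\<close> picks the common normalised value, which makes the choice of
    \<open>idx s\<close> immaterial.\<close>
  define Z where "Z = (\<lambda>s. remove_sings (Y (idx s)) s)"
  have idx: "Re s > - real (idx s)" for s
    unfolding idx_def by (simp add: of_nat_nat ceiling_le_iff) linarith
  have Z: "Z s = remove_sings (Y N) s" if s: "Re s > - real N" for s N
    unfolding Z_def
  proof (rule remove_sings_cong[OF meromorphic_eq_continuation refl])
    let ?X = "max (- real N) (- real (idx s))"
    show "Y (idx s) meromorphic_on {s. Re s > ?X}" "Y N meromorphic_on {s. Re s > ?X}"
      by (rule meromorphic_on_subset[OF Y(1)]; auto)+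
    show "eventually (\<lambda>z. Y (idx s) z = Y N z) rhp_top"
      using Y(2)[of "idx s"] Y(2)[of N] by eventually_elim auto
    show "Re s > ?X" using s idx by auto
  qed
  show ?thesis
  proof (rule that)
    show "Z meromorphic_on UNIV"
      unfolding meromorphic_on_meromorphic_at[of Z UNIV]
    proof
      fix s
      have "remove_sings (Y (idx s)) meromorphic_on {s}"
        by (intro remove_sings_meromorphic meromorphic_on_subset[OF Y(1)[of "idx s"]]) (use idx in auto)
      moreover have "eventually (\<lambda>z. z \<in> {z. Re z > - real (idx s)}) (at s)"
        using idx by (intro eventually_at_in_open' open_halfspace_Re_gt) auto
      then have "eventually (\<lambda>z. Z z = remove_sings (Y (idx s)) z) (at s)"
        by eventually_elim (use Z in auto)
      ultimately show "Z meromorphic_on {s}" by (subst meromorphic_on_cong) auto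
    qed
  next
    fix s assume s: "Re s > X"
    \<comment> \<open>Normalising does not change an analytic function, so agreement far to the
      right becomes equality at every point with \<open>Re s > X\<close>.\<close>
    have an: "F analytic_on {s. Re s > X}" using hol by (simp add: analytic_on_open open_halfspace_Re_gt)
    let ?X = "max (- real (idx s)) X"
    have "Z s = remove_sings (Y (idx s)) s" by (simp add: Z_def)
    also have "\<dots> = remove_sings F s"
    proof (rule remove_sings_cong[OF meromorphic_eq_continuation refl])
      show "Y (idx s) meromorphic_on {s. Re s > ?X}" by (rule meromorphic_on_subset[OF Y(1)]) auto
      show "F meromorphic_on {s. Re s > ?X}"
        by (rule meromorphic_on_subset[OF analytic_on_imp_meromorphic_on[OF an]]) auto
      show "eventually (\<lambda>z. Y (idx s) z = F z) rhp_top" by (rule Y(2))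
      show "Re s > ?X" using s idx by auto
    qed
    also have "\<dots> = F s" using an s by (intro remove_sings_at_analytic) (auto intro: analytic_on_subset)
    finally show "Z s = F s" .
  qed
qed

section \<open>The triple series for positive real part\<close>

definition witten_series :: "complex \<Rightarrow> complex" where
  "witten_series s = triangle_sum (cpow 1 s) (cpow 1 s) (cpow 1 s)"

lemma of_nat_powr_mult3:
  "of_nat (x * y * z) powr w = (of_nat x powr w * of_nat y powr w * of_nat z powr w :: complex)"
  by (simp add: powr_times_real)

lemma witten_series_term:
  "(of_nat ((a + b + 1) * (b + c + 1) * (c + a + 1)) :: complex) powr (- s - 1) =
     cpow 1 s (Suc (a + b)) * cpow 1 s (Suc (b + c)) * cpow 1 s (Suc (c + a))"
  unfolding of_nat_powr_mult3 by (simp add: cpow_def)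

lemma witten_series_term_bound:
  assumes "Re s > e"  "e > 0"
  shows "norm (cpow 1 s (Suc (a + b)) * cpow 1 s (Suc (b + c)) * cpow 1 s (Suc (c + a)))
    \<le> real (Suc a) powr - (1 + e) * (real (Suc b) powr - (1 + e) * real (Suc c) powr - (1 + e))"
proof -
  have "norm (cpow 1 s (Suc (x + y))) \<le> real (Suc x) powr - (1 + e)" for x y
  proof -
    have "norm (cpow 1 s (Suc (x + y))) \<le> real (Suc (x + y)) powr - (1 + e)"
      using assms by (subst norm_cpow) (auto intro!: powr_mono)
    also have "\<dots> \<le> real (Suc x) powr - (1 + e)" using assms by (intro powr_mono2') auto
    finally show ?thesis .
  qed
  then show ?thesis unfolding norm_mult mult.assoc by (intro mult_mono) auto
qed

lemma witten_series_summable: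
  assumes "Re s > 0"
  shows "(\<lambda>(a, b, c). norm (cpow 1 s (Suc (a + b)) * cpow 1 s (Suc (b + c)) * cpow 1 s (Suc (c + a)))) summable_on UNIV"
proof (rule summable_on_comparison_test)
  show "(\<lambda>(a, b, c). real (Suc a) powr - (1 + Re s / 2) * (real (Suc b) powr - (1 + Re s / 2) * real (Suc c) powr - (1 + Re s / 2)))
      summable_on UNIV"
    using assms by (intro summable_powr_Suc3) auto
qed (use assms witten_series_term_bound[of "Re s / 2" s] in \<open>auto simp del: of_nat_Suc\<close>)

lemma witten_series_holomorphic: "witten_series holomorphic_on {s. Re s > 0}"
proof -
  \<comment> \<open>A common majorant needs a fixed margin \<open>e\<close>; the half-planes
    \<open>Re s > e\<close> exhaust \<open>Re s > 0\<close>.\<close>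
  have e: "witten_series holomorphic_on {s. Re s > e}" if "e > 0" for e
    unfolding witten_series_def triangle_sum_def
  proof (rule infsum_holomorphic)
    show "(\<lambda>s. case i of (a, b, c) \<Rightarrow> cpow 1 s (Suc (a + b)) * cpow 1 s (Suc (b + c)) * cpow 1 s (Suc (c + a)))
        holomorphic_on {s. Re s > e}" for i
      by (cases i) (auto intro!: holomorphic_intros cpow_holomorphic)
    show "\<exists>M. M summable_on UNIV \<and> (\<forall>s i. norm s \<le> R \<longrightarrow> Re s > e \<longrightarrow> norm (case i of (a, b, c) \<Rightarrow>
        cpow 1 s (Suc (a + b)) * cpow 1 s (Suc (b + c)) * cpow 1 s (Suc (c + a))) \<le> M i)" for R
      by (intro exI[of _ "\<lambda>(a, b, c). real (Suc a) powr - (1 + e) * (real (Suc b) powr - (1 + e) * real (Suc c) powr - (1 + e))"]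
          conjI summable_powr_Suc3) (use that witten_series_term_bound[of e] in \<open>auto simp del: of_nat_Suc\<close>)
  qed
  have "witten_series analytic_on {s. Re s > 0}"
  proof (subst analytic_on_analytic_at, safe)
    fix s assume "Re s > 0"
    then have "witten_series analytic_on {z. Re z > Re s / 2}"
      by (subst analytic_on_open[OF open_halfspace_Re_gt], intro e) simp
    then show "witten_series analytic_on {s}" by (rule analytic_on_subset) (use \<open>Re s > 0\<close> in auto)
  qed
  then show ?thesis by (rule analytic_imp_holomorphic)
qed

lemma witten_series_continuation:
  obtains Z where "Z meromorphic_on UNIV" "\<And>s. Re s > 0 \<Longrightarrow> Z s = witten_series s"
proof (rule mero_ext_glue[OF _ witten_series_holomorphic])
  show "mero_ext (- real N) witten_series" for N
    unfolding witten_series_def by (rule triangle_extD[OF triangle_ext_all[of _ 1 1 1] symbol_cpow symbol_cpow symbol_cpow])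
qed (use that in blast)

section \<open>Characters of SU(2)\<close>
(* Formal_Laurent_Series leaves this notation active, and every $ is then parsed in two ways. *)
no_notation fps_nth (infixl \<open>$\<close> 75)



text \<open>The coefficient of \<open>X^p Y^q\<close> in \<open>(a X + c Y)^p (b X + d Y)^q\<close>,
  a diagonal matrix entry of the symmetric power; \<open>i\<close> counts the factors of the first
  kind that contribute \<open>Y\<close>.\<close>

definition sym_diag :: "complex \<Rightarrow> complex \<Rightarrow> complex \<Rightarrow> complex \<Rightarrow> nat \<Rightarrow> nat \<Rightarrow> complex" where
  "sym_diag a b c d p q = (\<Sum>i\<le>q. of_nat (p choose i) * of_nat (q choose i) * (b * c) ^ i * a ^ (p - i) * d ^ (q - i))"

lemma coeff_linear_power:
  fixes a c :: complex
  shows "coeff ([:[:0, a:], [:c:]:] ^ p) i = monom (of_nat (p choose i) * c ^ i * a ^ (p - i)) (p - i)"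
proof -
  have "[:[:0, a:], [:c:]:] = monom (monom c 0) 1 + monom (monom a 1) 0"
    by (simp add: monom_0 monom_Suc)
  also have "\<dots> ^ p = (\<Sum>k\<le>p. monom (monom (of_nat (p choose k) * c ^ k * a ^ (p - k)) (p - k)) k)"
    by (simp add: binomial_ring monom_power mult_monom of_nat_monom)
  also have "coeff \<dots> i = (\<Sum>k\<le>p. if k = i then monom (of_nat (p choose k) * c ^ k * a ^ (p - k)) (p - k) else 0)"
    by (simp add: coeff_sum coeff_monom)
  also have "\<dots> = monom (of_nat (p choose i) * c ^ i * a ^ (p - i)) (p - i)"
    by (auto simp: sum.delta not_le binomial_eq_0)
  finally show ?thesis .
qed

lemma coeff_act_power:
  "coeff (coeff (act_X g ^ p * act_Y g ^ q) q) p = sym_diag (g$1$1) (g$1$2) (g$2$1) (g$2$2) p q"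
proof -
  have *: "coeff (monom (of_nat (p choose i) * c ^ i * a ^ (p - i)) (p - i) *
          monom (of_nat (q choose (q - i)) * d ^ (q - i) * b ^ (q - (q - i))) (q - (q - i))) p =
        of_nat (p choose i) * of_nat (q choose i) * (b * c) ^ i * a ^ (p - i) * d ^ (q - i)"
    if "i \<le> q" for i and a b c d :: complex
  proof (cases "i \<le> p")
    case True
    with that show ?thesis by (simp add: mult_monom binomial_symmetric[symmetric] power_mult_distrib mult_ac)
  next
    case False
    then show ?thesis by (simp add: binomial_eq_0)
  qed
  show ?thesis
    unfolding act_X_def act_Y_def sym_diag_def coeff_mult[of _ _ q] coeff_linear_power coeff_sum
    by (intro sum.cong refl *) auto
qed

lemma tr_Sym_eq: "tr_Sym k g = (\<Sum>i\<le>k. sym_diag (g$1$1) (g$1$2) (g$2$1) (g$2$2) (k - i) i)"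
  unfolding tr_Sym_def Sym_power_def coeff_act_power by simp

lemma sym_diag_0_right: "sym_diag a b c d p 0 = a ^ p"
  by (simp add: sym_diag_def)

lemma sym_diag_0_left: "sym_diag a b c d 0 q = d ^ q"
proof -
  have "sym_diag a b c d 0 q = (\<Sum>i\<le>q. if i = 0 then d ^ q else 0)"
    unfolding sym_diag_def by (intro sum.cong refl) auto
  then show ?thesis by simp
qed

text \<open>Because of truncated subtraction the powers can differ for \<open>p <= i\<close>, but
  there the binomial coefficient vanishes.\<close>

lemma binomial_power_Suc:
  "of_nat (p choose Suc i) * (a * a ^ (p - Suc i)) = of_nat (p choose Suc i) * (a :: complex) ^ (p - i)"
proof (cases "i < p")
  case True
  then have "p - i = Suc (p - Suc i)" by simp
  then show ?thesis by simp
qed (simp add: binomial_eq_0)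

text \<open>Equivalently, the generating function of \<open>sym_diag a b c d p q\<close> in \<open>x, y\<close> is
  \<open>1 / ((1 - a x) (1 - d y) - b c x y)\<close>.\<close>

lemma sym_diag_rec:
  "sym_diag a b c d (Suc p) (Suc q) = a * sym_diag a b c d p (Suc q) + d * sym_diag a b c d (Suc p) q
     - (a * d - b * c) * sym_diag a b c d p q"
proof -
  define t where "t = (\<lambda>p q i. of_nat (p choose i) * of_nat (q choose i) * (b * c) ^ i * a ^ (p - i) * d ^ (q - i))"
  have sd: "sym_diag a b c d p q = sum (t p q) {..q}" for p q
    by (simp add: sym_diag_def t_def)
  \<comment> \<open>\<open>q choose Suc q\<close> is 0, so the range may be lengthened to match that
    of the other sums.\<close>
  have sd': "sym_diag a b c d p q = sum (t p q) {..Suc q}" for p q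
    by (simp add: sd t_def binomial_eq_0)
  have t0: "t p q 0 = a ^ p * d ^ q" for p q by (simp add: t_def)
  \<comment> \<open>Pascal's rule in both binomial coefficients; the term with \<open>a * d\<close>
    removes the product \<open>?P' * ?Q'\<close>, which is counted twice.\<close>
  have tS: "t (Suc p) (Suc q) (Suc i) = a * t p (Suc q) (Suc i) + d * t (Suc p) q (Suc i)
      - a * d * t p q (Suc i) + b * c * t p q i" for i
  proof -
    define z where "z = (b * c) ^ Suc i"
    let ?P = "of_nat (p choose i) :: complex" and ?P' = "of_nat (p choose Suc i) :: complex"
    let ?Q = "of_nat (q choose i) :: complex" and ?Q' = "of_nat (q choose Suc i) :: complex"
    define A where "A = a ^ (p - i)"
    define D where "D = d ^ (q - i)"
    have A: "?P' * (a * a ^ (p - Suc i)) = ?P' * A" and D: "?Q' * (d * d ^ (q - Suc i)) = ?Q' * D"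
      unfolding A_def D_def by (rule binomial_power_Suc)+
    have 1: "a * t p (Suc q) (Suc i) = (?P' * (a * a ^ (p - Suc i))) * ((?Q + ?Q') * z * D)"
      by (simp add: t_def z_def D_def algebra_simps)
    have 2: "d * t (Suc p) q (Suc i) = (?Q' * (d * d ^ (q - Suc i))) * ((?P + ?P') * z * A)"
      by (simp add: t_def z_def A_def algebra_simps)
    have 3: "a * d * t p q (Suc i) = (?P' * (a * a ^ (p - Suc i))) * (?Q' * (d * d ^ (q - Suc i))) * z"
      by (simp add: t_def z_def algebra_simps)
    have 4: "b * c * t p q i = ?P * ?Q * z * A * D"
      by (simp add: t_def z_def A_def D_def algebra_simps)
    have 5: "t (Suc p) (Suc q) (Suc i) = (?P + ?P') * (?Q + ?Q') * z * A * D"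
      by (simp add: t_def z_def A_def D_def)
    show ?thesis unfolding 1 2 3 4 5 A D by (simp add: algebra_simps)
  qed
  have "sym_diag a b c d (Suc p) (Suc q) = t (Suc p) (Suc q) 0 + (\<Sum>i\<le>q. t (Suc p) (Suc q) (Suc i))"
    unfolding sd by (rule sum.atMost_Suc_shift)
  also have "\<dots> = a * (t p (Suc q) 0 + (\<Sum>i\<le>q. t p (Suc q) (Suc i))) + d * (t (Suc p) q 0 + (\<Sum>i\<le>q. t (Suc p) q (Suc i)))
      - a * d * (t p q 0 + (\<Sum>i\<le>q. t p q (Suc i))) + b * c * (\<Sum>i\<le>q. t p q i)"
    unfolding t0 tS by (simp add: sum.distrib sum_subtractf sum_distrib_left algebra_simps)
  also have "\<dots> = a * sym_diag a b c d p (Suc q) + d * sym_diag a b c d (Suc p) q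
      - a * d * sym_diag a b c d p q + b * c * sym_diag a b c d p q"
    unfolding sum.atMost_Suc_shift[symmetric] by (simp only: sd[of p "Suc q"] sd'[of "Suc p" q] sd'[of p q] sd[of p q, symmetric])
  finally show ?thesis by (simp add: algebra_simps)
qed

lemma tr_Sym_0: "tr_Sym 0 g = 1"
  by (simp add: tr_Sym_eq sym_diag_0_right)

lemma tr_Sym_1: "tr_Sym (Suc 0) g = g$1$1 + g$2$2"
  by (simp add: tr_Sym_eq sym_diag_0_right sym_diag_0_left)

text \<open>\<open>sym_diag_rec\<close> summed along \<open>p + q = k + 2\<close>, completed by the
  two ends, which are powers of the diagonal entries. This avoids diagonalising
  \<open>g\<close>.\<close>

lemma tr_Sym_rec:
  "tr_Sym (Suc (Suc k)) g = (g$1$1 + g$2$2) * tr_Sym (Suc k) g - det g * tr_Sym k g"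
proof -
  let ?u = "sym_diag (g$1$1) (g$1$2) (g$2$1) (g$2$2)"
  have "tr_Sym (Suc (Suc k)) g = ?u (Suc (Suc k)) 0 + (\<Sum>i\<le>k. ?u (Suc (k - i)) (Suc i)) + ?u 0 (Suc (Suc k))"
    unfolding tr_Sym_eq by (subst sum.atMost_Suc_shift, subst sum.atMost_Suc) (simp add: Suc_diff_le)
  also have "(\<Sum>i\<le>k. ?u (Suc (k - i)) (Suc i)) = g$1$1 * (\<Sum>i\<le>k. ?u (k - i) (Suc i)) + g$2$2 * (\<Sum>i\<le>k. ?u (Suc (k - i)) i)
      - det g * (\<Sum>i\<le>k. ?u (k - i) i)"
    by (simp add: sym_diag_rec det_2 sum.distrib sum_subtractf sum_distrib_left)
  also have "?u (Suc (Suc k)) 0 + (g$1$1 * (\<Sum>i\<le>k. ?u (k - i) (Suc i)) + g$2$2 * (\<Sum>i\<le>k. ?u (Suc (k - i)) i)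
      - det g * (\<Sum>i\<le>k. ?u (k - i) i)) + ?u 0 (Suc (Suc k)) =
     g$1$1 * (?u (Suc k) 0 + (\<Sum>i\<le>k. ?u (k - i) (Suc i))) + g$2$2 * ((\<Sum>i\<le>k. ?u (Suc (k - i)) i) + ?u 0 (Suc k))
      - det g * (\<Sum>i\<le>k. ?u (k - i) i)"
    by (simp add: sym_diag_0_right sym_diag_0_left algebra_simps)
  also have "?u (Suc k) 0 + (\<Sum>i\<le>k. ?u (k - i) (Suc i)) = tr_Sym (Suc k) g"
    unfolding tr_Sym_eq sum.atMost_Suc_shift by simp
  also have "(\<Sum>i\<le>k. ?u (Suc (k - i)) i) + ?u 0 (Suc k) = tr_Sym (Suc k) g"
    unfolding tr_Sym_eq by (simp add: Suc_diff_le)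
  also have "(\<Sum>i\<le>k. ?u (k - i) i) = tr_Sym k g" by (simp add: tr_Sym_eq)
  finally show ?thesis by (simp add: algebra_simps)
qed

section \<open>The group SU(2) and the Clebsch-Gordan rule\<close>

lemma SU2_iff:
  "g \<in> SU2 \<longleftrightarrow> g$2$2 = cnj (g$1$1) \<and> g$1$2 = - cnj (g$2$1) \<and> cnj (g$1$1) * g$1$1 + cnj (g$2$1) * g$2$1 = 1"
proof
  assume "g \<in> SU2"
  then have m: "conj_transpose g ** g = mat 1" and dt: "det g = 1"
    unfolding SU2_def by blast+
  define a where "a = g$1$1"
  define b where "b = g$1$2"
  define c where "c = g$2$1"
  define d where "d = g$2$2"
  have 1: "cnj a * a + cnj c * c = 1" and 2: "cnj a * b + cnj c * d = 0"
    using m by (auto simp: vec_eq_iff forall_2 matrix_matrix_mult_def conj_transpose_def sum_2 mat_def a_def b_def c_def d_def)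
  have 3: "a * d - b * c = 1" using dt by (simp add: det_2 a_def b_def c_def d_def)
  \<comment> \<open>Multiply by the squared norm of the first column, which is 1, and regroup so
    that the determinant and the orthogonality of the columns appear.\<close>
  have "d = d * (cnj a * a + cnj c * c)" by (simp add: 1)
  also have "\<dots> = cnj a * (a * d - b * c) + c * (cnj a * b + cnj c * d)" by (simp add: algebra_simps)
  also have "\<dots> = cnj a" by (simp add: 2 3)
  finally have d: "d = cnj a" .
  have "b = b * (cnj a * a + cnj c * c)" by (simp add: 1)
  also have "\<dots> = - cnj c * (a * d - b * c) + a * (cnj a * b + cnj c * d)" by (simp add: algebra_simps)
  also have "\<dots> = - cnj c" by (simp add: 2 3)
  finally show "g$2$2 = cnj (g$1$1) \<and> g$1$2 = - cnj (g$2$1) \<and> cnj (g$1$1) * g$1$1 + cnj (g$2$1) * g$2$1 = 1"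
    using d 1 by (simp add: a_def b_def c_def d_def)
next
  assume "g$2$2 = cnj (g$1$1) \<and> g$1$2 = - cnj (g$2$1) \<and> cnj (g$1$1) * g$1$1 + cnj (g$2$1) * g$2$1 = 1"
  then show "g \<in> SU2"
    by (simp add: SU2_def vec_eq_iff forall_2 matrix_matrix_mult_def conj_transpose_def sum_2 mat_def det_2 algebra_simps)
qed

lemma SU2_det: "g \<in> SU2 \<Longrightarrow> det g = 1"
  by (simp add: SU2_def)

lemma matrix_mult_2:
  fixes g h :: "complex^2^2"
  shows "(h ** g)$i$j = h$i$1 * g$1$j + h$i$2 * g$2$j"
  by (simp add: matrix_matrix_mult_def sum_2)

lemma SU2_mult: "h \<in> SU2 \<Longrightarrow> g \<in> SU2 \<Longrightarrow> h ** g \<in> SU2"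
proof -
  assume h: "h \<in> SU2" and g: "g \<in> SU2"
  then have H: "cnj (h$1$1) * h$1$1 + cnj (h$2$1) * h$2$1 = 1" and G: "cnj (g$1$1) * g$1$1 + cnj (g$2$1) * g$2$1 = 1"
    by (auto simp: SU2_iff)
  from h g have e: "h$2$2 = cnj (h$1$1)" "h$1$2 = - cnj (h$2$1)" "g$2$2 = cnj (g$1$1)" "g$1$2 = - cnj (g$2$1)"
    by (auto simp: SU2_iff)
  have "cnj (h$1$1 * g$1$1 - cnj (h$2$1) * g$2$1) * (h$1$1 * g$1$1 - cnj (h$2$1) * g$2$1)
     + cnj (h$2$1 * g$1$1 + cnj (h$1$1) * g$2$1) * (h$2$1 * g$1$1 + cnj (h$1$1) * g$2$1)
     = (cnj (h$1$1) * h$1$1 + cnj (h$2$1) * h$2$1) * (cnj (g$1$1) * g$1$1 + cnj (g$2$1) * g$2$1)"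
    by (simp add: algebra_simps)
  also have "\<dots> = 1" by (simp add: H G)
  finally show ?thesis by (simp add: SU2_iff matrix_mult_2 e)
qed

lemma SU2_conj_transpose: "h \<in> SU2 \<Longrightarrow> conj_transpose h \<in> SU2"
  by (simp add: SU2_iff conj_transpose_def algebra_simps)

lemma SU2_inverse:
  assumes "h \<in> SU2" shows "conj_transpose h ** h = mat 1" "h ** conj_transpose h = mat 1"
  using assms matrix_left_right_inverse by (auto simp: SU2_def)

lemma SU2_norm_le:
  assumes "g \<in> SU2" shows "norm (g$i$j) \<le> 1"
proof -
  have "cnj (g$1$1) * g$1$1 + cnj (g$2$1) * g$2$1 = 1" using assms by (simp add: SU2_iff)
  then have "of_real ((norm (g$1$1))\<^sup>2 + (norm (g$2$1))\<^sup>2) = (1 :: complex)"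
    by (simp only: of_real_add complex_norm_square mult.commute[of _ "cnj _"])
  then have s: "(norm (g$1$1))\<^sup>2 + (norm (g$2$1))\<^sup>2 = 1" using of_real_eq_1_iff by blast
  then have "(norm (g$1$1))\<^sup>2 \<le> 1\<^sup>2" "(norm (g$2$1))\<^sup>2 \<le> 1\<^sup>2" 
    unfolding power_one using s zero_le_power2[of "norm (g$1$1)"] zero_le_power2[of "norm (g$2$1)"] by linarith+
  then have "norm (g$1$1) \<le> 1" "norm (g$2$1) \<le> 1" by (auto intro: power2_le_imp_le)
  moreover have "norm (g$2$2) = norm (g$1$1)" "norm (g$1$2) = norm (g$2$1)"
    using assms by (auto simp: SU2_iff)
  ultimately have "\<forall>i j. norm (g$i$j) \<le> 1" by (simp add: forall_2)
  then show ?thesis by blast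
qed

lemma tr_Sym_SU2_rec:
  "g \<in> SU2 \<Longrightarrow> tr_Sym (Suc (Suc k)) g = tr_Sym (Suc 0) g * tr_Sym (Suc k) g - tr_Sym k g"
  by (simp add: tr_Sym_rec SU2_det tr_Sym_1)

text \<open>The trace is \<open>2 * Re (g$1$1)\<close> and the determinant is 1, so the eigenvalues
  are \<open>w\<close> and \<open>cnj w\<close> on the unit circle. The sums \<open>h\<close> in
  these eigenvalues obey the same recursion as the characters and have \<open>k + 1\<close> terms of
  modulus 1.\<close>

lemma norm_tr_Sym_le:
  assumes "g \<in> SU2" shows "norm (tr_Sym k g) \<le> real (Suc k)"
proof -
  have "\<bar>Re (g$1$1)\<bar> \<le> 1" using SU2_norm_le[OF assms] abs_Re_le_cmod order_trans by blast
  then have R: "cos (arccos (Re (g$1$1))) = Re (g$1$1)" by (intro cos_arccos) auto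
  define w where "w = cis (arccos (Re (g$1$1)))"
  have w: "w * cnj w = 1" by (simp add: w_def cis_cnj flip: cis_mult) (simp add: cis_mult)
  have tr: "g$1$1 + g$2$2 = w + cnj w"
    using assms R by (simp add: SU2_iff w_def complex_eq_iff)
  define h where "h = (\<lambda>k. \<Sum>j\<le>k. w ^ (k - j) * cnj w ^ j)"
  have hS: "h (Suc k) = w * h k + cnj w ^ Suc k" for k
    unfolding h_def by (simp add: sum_distrib_left Suc_diff_le mult.assoc)
  have "tr_Sym k g = h k \<and> tr_Sym (Suc k) g = h (Suc k)"
  proof (induction k)
    case 0
    then show ?case by (simp add: tr_Sym_0 tr_Sym_1 tr h_def)
  next
    case (Suc k)
    have "tr_Sym (Suc (Suc k)) g = (w + cnj w) * h (Suc k) - h k"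
      using tr_Sym_SU2_rec[OF assms] Suc by (simp add: tr_Sym_1 tr)
    also have "\<dots> = w * h (Suc k) + cnj w * (w * h k + cnj w ^ Suc k) - h k"
      by (simp add: algebra_simps hS)
    also have "cnj w * (w * h k + cnj w ^ Suc k) = (w * cnj w) * h k + cnj w ^ Suc (Suc k)"
      by (simp add: algebra_simps)
    also have "w * h (Suc k) + ((w * cnj w) * h k + cnj w ^ Suc (Suc k)) - h k = h (Suc (Suc k))"
      by (simp add: w hS)
    finally show ?case using Suc by simp
  qed
  then have "tr_Sym k g = h k" by blast
  also have "norm (h k) \<le> (\<Sum>j\<le>k. norm (w ^ (k - j) * cnj w ^ j))" unfolding h_def by (rule norm_sum)
  also have "\<dots> = real (Suc k)" by (simp add: norm_mult norm_power w_def)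
  finally show ?thesis .
qed

lemma tr_Sym_mult_1:
  assumes "g \<in> SU2" "m \<ge> 1"
  shows "tr_Sym m g * tr_Sym (Suc 0) g = tr_Sym (m + 1) g + tr_Sym (m - 1) g"
proof -
  obtain k where "m = Suc k" using assms(2) by (cases m) auto
  then show ?thesis using tr_Sym_SU2_rec[OF assms(1), of k] by (simp add: mult.commute)
qed

lemma tr_Sym_clebsch_gordan:
  assumes g: "g \<in> SU2" and "b \<le> a"
  shows "tr_Sym a g * tr_Sym b g = (\<Sum>j\<le>b. tr_Sym (a + b - 2 * j) g)"
  using assms(2)
proof (induction b rule: induct_nat_012)
  case 0
  then show ?case by (simp add: tr_Sym_0)
next
  case 1
  then show ?case using tr_Sym_mult_1[OF g, of a] by simp
next
  case (ge2 b)
  have ih0: "tr_Sym a g * tr_Sym b g = (\<Sum>j\<le>b. tr_Sym (a + b - 2 * j) g)"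
    and ih1: "tr_Sym a g * tr_Sym (Suc b) g = (\<Sum>j\<le>Suc b. tr_Sym (a + Suc b - 2 * j) g)"
    by (rule ge2.IH; use ge2.prems in simp)+
  have "tr_Sym a g * tr_Sym (Suc (Suc b)) g = tr_Sym a g * tr_Sym (Suc b) g * tr_Sym (Suc 0) g - tr_Sym a g * tr_Sym b g"
    by (simp only: tr_Sym_SU2_rec[OF g, of b] right_diff_distrib mult_ac)
  also have "tr_Sym a g * tr_Sym (Suc b) g * tr_Sym (Suc 0) g = (\<Sum>j\<le>Suc b. tr_Sym (a + Suc b - 2 * j) g * tr_Sym (Suc 0) g)"
    by (simp only: ih1 sum_distrib_right)
  also have "\<dots> = (\<Sum>j\<le>Suc b. tr_Sym (a + Suc (Suc b) - 2 * j) g + tr_Sym (a + b - 2 * j) g)"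
  proof (intro sum.cong refl)
    fix j assume "j \<in> {..Suc b}"
    then have j: "a + Suc b - 2 * j \<ge> 1" "a + Suc b - 2 * j + 1 = a + Suc (Suc b) - 2 * j" "a + Suc b - 2 * j - 1 = a + b - 2 * j"
      using ge2.prems by auto
    show "tr_Sym (a + Suc b - 2 * j) g * tr_Sym (Suc 0) g = tr_Sym (a + Suc (Suc b) - 2 * j) g + tr_Sym (a + b - 2 * j) g"
      using tr_Sym_mult_1[OF g j(1)] unfolding j(2,3) .
  qed
  \<comment> \<open>The second sum has one term more than \<open>ih0\<close>. Since
    \<open>a + b - 2 (b + 1) = a + (b + 2) - 2 (b + 2)\<close>, it is the missing term
    \<open>j = b + 2\<close> of the first.\<close>
  also have "\<dots> - tr_Sym a g * tr_Sym b g = (\<Sum>j\<le>Suc b. tr_Sym (a + Suc (Suc b) - 2 * j) g) + tr_Sym (a + b - 2 * Suc b) g"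
    unfolding ih0 sum.distrib by simp
  also have "\<dots> = (\<Sum>j\<le>Suc (Suc b). tr_Sym (a + Suc (Suc b) - 2 * j) g)"
    by simp
  finally show ?case .
qed

section \<open>Integration over SU(2)\<close>
lemma measurable_matrix_mult: "(\<lambda>g. h ** g) \<in> borel_measurable (borel :: (complex^2^2) measure)"
proof (rule borel_measurable_continuous_onI)
  show "continuous_on UNIV (\<lambda>g::complex^2^2. h ** g)"
    unfolding matrix_matrix_mult_def by (intro continuous_intros)
qed


text \<open>Characters are combinations of these monomials, on which translation by explicit
  matrices acts transparently. This gives the integrals of characters without general Schur
  orthogonality.\<close>

definition entry_monomial :: "nat \<Rightarrow> nat \<Rightarrow> nat \<Rightarrow> nat \<Rightarrow> complex^2^2 \<Rightarrow> complex" where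
  "entry_monomial p q r t g = (g$1$1) ^ p * (g$1$2) ^ q * (g$2$1) ^ r * (g$2$2) ^ t"

lemma sym_diag_entry_monomial:
  "sym_diag (g$1$1) (g$1$2) (g$2$1) (g$2$2) p q =
    (\<Sum>i\<le>q. (of_nat (p choose i) * of_nat (q choose i)) * entry_monomial (p - i) i i (q - i) g)"
  unfolding sym_diag_def by (intro sum.cong refl) (simp add: entry_monomial_def power_mult_distrib mult_ac)

text \<open>The range consists of the triples with even sum that satisfy the triangle inequalities:
  the highest weights of three representations whose tensor product contains an invariant.\<close>

definition triangle :: "nat \<times> nat \<times> nat \<Rightarrow> nat \<times> nat \<times> nat" where
  "triangle = (\<lambda>(a, b, c). (a + b, b + c, c + a))"

lemma inj_triangle: "inj triangle"
  by (auto simp: inj_on_def triangle_def)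

locale haar_SU2 =
  fixes \<mu> :: "(complex^2^2) measure"
  assumes haar: "normalized_haar_SU2 \<mu>"
begin

sublocale prob_space \<mu>
  using haar by (simp add: normalized_haar_SU2_def)

lemma sets_eq: "sets \<mu> = sets (restrict_space borel SU2)"
  using haar by (simp add: normalized_haar_SU2_def)

lemma space_eq: "space \<mu> = SU2"
  using sets_eq_imp_space_eq[OF sets_eq] by (simp add: space_restrict_space)

lemma measurable_entry: "(\<lambda>g. g$i$j) \<in> borel_measurable \<mu>"
proof -
  have "(\<lambda>g :: complex^2^2. g$i$j) \<in> borel_measurable borel"
    by (intro borel_measurable_continuous_onI continuous_intros)
  then have "(\<lambda>g :: complex^2^2. g$i$j) \<in> borel_measurable (restrict_space borel SU2)"
    by (rule measurable_restrict_space1)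
  then show ?thesis by (simp add: measurable_cong_sets[OF sets_eq refl])
qed

lemma measurable_translate: "h \<in> SU2 \<Longrightarrow> (\<lambda>g. h ** g) \<in> measurable \<mu> \<mu>"
proof -
  assume h: "h \<in> SU2"
  have "(\<lambda>g. h ** g) \<in> measurable (restrict_space borel SU2) (restrict_space borel SU2)"
    using SU2_mult[OF h]
    by (intro measurable_restrict_space2 measurable_restrict_space1 measurable_matrix_mult) (auto simp: space_restrict_space)
  then show ?thesis by (simp add: measurable_cong_sets[OF sets_eq sets_eq])
qed

text \<open>Invariance is assumed for images of sets. A preimage under \<open>h\<close> is an image
  under the inverse of \<open>h\<close>, which on SU(2) is the conjugate transpose.\<close>

lemma distr_translate:
  assumes h: "h \<in> SU2" shows "distr \<mu> \<mu> (\<lambda>g. h ** g) = \<mu>"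
proof (rule measure_eqI)
  fix A assume "A \<in> sets (distr \<mu> \<mu> (\<lambda>g. h ** g))"
  then have A: "A \<in> sets \<mu>" by simp
  then have AS: "A \<subseteq> SU2" using sets.sets_into_space space_eq by blast
  let ?h' = "conj_transpose h"
  have h': "?h' \<in> SU2" by (rule SU2_conj_transpose[OF h])
  have inv: "h ** (?h' ** g) = g" "?h' ** (h ** g) = g" for g
    by (simp_all add: matrix_mul_assoc SU2_inverse[OF h])
  have "(\<lambda>g. h ** g) -` A \<inter> space \<mu> = (\<lambda>g. ?h' ** g) ` A"
  proof (intro equalityI subsetI)
    fix g assume "g \<in> (\<lambda>g. h ** g) -` A \<inter> space \<mu>"
    then show "g \<in> (\<lambda>g. ?h' ** g) ` A"
      by (intro image_eqI[of _ _ "h ** g"]) (auto simp: inv)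
  next
    fix g assume "g \<in> (\<lambda>g. ?h' ** g) ` A"
    then show "g \<in> (\<lambda>g. h ** g) -` A \<inter> space \<mu>"
      using AS SU2_mult[OF h'] by (auto simp: inv space_eq)
  qed
  then have "emeasure (distr \<mu> \<mu> (\<lambda>g. h ** g)) A = emeasure \<mu> ((\<lambda>g. ?h' ** g) ` A)"
    by (simp add: emeasure_distr[OF measurable_translate[OF h] A])
  also have "\<dots> = emeasure \<mu> A"
    using haar h' A by (simp add: normalized_haar_SU2_def)
  finally show "emeasure (distr \<mu> \<mu> (\<lambda>g. h ** g)) A = emeasure \<mu> A" .
qed simp

lemma integral_translate:
  fixes f :: "complex^2^2 \<Rightarrow> complex"
  assumes "h \<in> SU2" "f \<in> borel_measurable \<mu>"
  shows "(LINT g|\<mu>. f (h ** g)) = (LINT g|\<mu>. f g)"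
  using integral_distr[OF measurable_translate[OF assms(1)] assms(2)] by (simp add: distr_translate[OF assms(1)])

lemma integrable_bounded:
  fixes f :: "complex^2^2 \<Rightarrow> complex"
  assumes "f \<in> borel_measurable \<mu>" "\<And>g. g \<in> SU2 \<Longrightarrow> norm (f g) \<le> B"
  shows "integrable \<mu> f"
  by (rule integrable_const_bound[of _ B]) (use assms space_eq in auto)

lemma measurable_entry_monomial: "entry_monomial p q r t \<in> borel_measurable \<mu>"
  unfolding entry_monomial_def[abs_def] using measurable_entry by measurable

lemma integrable_entry_monomial: "integrable \<mu> (entry_monomial p q r t)"
proof (rule integrable_bounded[OF measurable_entry_monomial])
  fix g assume g: "g \<in> SU2"
  have "norm (g$i$j) ^ n \<le> 1" for i j n by (intro power_le_one SU2_norm_le[OF g]) auto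
  then show "norm (entry_monomial p q r t g) \<le> 1"
    unfolding entry_monomial_def norm_mult norm_power by (intro mult_le_one mult_nonneg_nonneg) auto
qed

text \<open>Translation by a diagonal matrix scales the two rows by inverse phases, so the monomial
  has weight \<open>(p + q) - (r + t)\<close>.\<close>

lemma integral_entry_monomial_0:
  assumes "p + q \<noteq> r + t" shows "(LINT g|\<mu>. entry_monomial p q r t g) = 0"
proof -
  \<comment> \<open>Chosen so that the phase becomes \<open>cis pi = -1\<close>; the integral then
    equals its own negative.\<close>
  define x where "x = pi / (real (p + q) - real (r + t))"
  define h :: "complex^2^2" where "h = vector [vector [cis x, 0], vector [0, cis (- x)]]"
  have e: "h$1$1 = cis x" "h$1$2 = 0" "h$2$1 = 0" "h$2$2 = cis (- x)"
    by (simp_all add: h_def)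
  have h: "h \<in> SU2" by (simp add: SU2_iff e cis_cnj cis_mult)
  have w: "cis x ^ (p + q) * cis (- x) ^ (r + t) = -1"
  proof -
    have "cis x ^ (p + q) * cis (- x) ^ (r + t) = cis ((real (p + q) - real (r + t)) * x)"
      unfolding Complex.DeMoivre cis_mult by (rule arg_cong[of _ _ cis]) (simp add: algebra_simps)
    also have "(real (p + q) - real (r + t)) * x = pi" using assms by (simp add: x_def flip: of_nat_add)
    finally show ?thesis by simp
  qed
  have "entry_monomial p q r t (h ** g) = (cis x ^ (p + q) * cis (- x) ^ (r + t)) * entry_monomial p q r t g" for g
    by (simp add: entry_monomial_def matrix_mult_2 e power_mult_distrib power_add mult_ac)
  then have "(LINT g|\<mu>. entry_monomial p q r t (h ** g)) = - (LINT g|\<mu>. entry_monomial p q r t g)"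
    unfolding w by simp
  with integral_translate[OF h measurable_entry_monomial] show ?thesis
    by (metis add.inverse_inverse eq_neg_iff_add_eq_0 mult_2 mult_eq_0_iff zero_neq_numeral)
qed

lemma integral_sum_entry_monomial:
  "(LINT g|\<mu>. (\<Sum>i\<in>I. c i * entry_monomial (p i) (q i) (r i) (t i) g)) = (\<Sum>i\<in>I. c i * (LINT g|\<mu>. entry_monomial (p i) (q i) (r i) (t i) g))"
  by (subst Bochner_Integration.integral_sum) (auto intro!: integrable_mult_right integrable_entry_monomial)

text \<open>Invariance under diagonal matrices leaves only the case \<open>p = q\<close>. There, translating \<open>(g\<^sub>1\<^sub>1 g\<^sub>1\<^sub>2)^q\<close>,
  whose integral is 0, by the rotation through 45 degrees gives a multiple of
  \<open>((g\<^sub>1\<^sub>1 + g\<^sub>2\<^sub>1) (g\<^sub>1\<^sub>2 + g\<^sub>2\<^sub>2))^q\<close>, and the part of weight 0 of that polynomial is the integrand.\<close>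

lemma integral_sym_diag:
  assumes "(p, q) \<noteq> (0, 0)"
  shows "(LINT g|\<mu>. sym_diag (g$1$1) (g$1$2) (g$2$1) (g$2$2) p q) = 0"
proof (cases "p = q")
  case False
  have "of_nat (p choose i) * of_nat (q choose i) * (LINT g|\<mu>. entry_monomial (p - i) i i (q - i) g) = 0" if "i \<le> q" for i
  proof (cases "i \<le> p")
    case True
    with that False have "(LINT g|\<mu>. entry_monomial (p - i) i i (q - i) g) = 0" by (intro integral_entry_monomial_0) auto
    then show ?thesis by simp
  qed (simp add: binomial_eq_0)
  then show ?thesis unfolding sym_diag_entry_monomial integral_sum_entry_monomial by (intro sum.neutral) blast
next
  case True
  with assms have q: "q > 0" by auto
  define z where "z = complex_of_real (1 / sqrt 2)"
  have z2: "z * z = 1 / 2" by (simp add: z_def flip: of_real_mult) 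
  define h :: "complex^2^2" where "h = vector [vector [z, z], vector [- z, z]]"
  have e: "h$1$1 = z" "h$1$2 = z" "h$2$1 = - z" "h$2$2 = z"
    by (simp_all add: h_def)
  have cz: "cnj z = z" by (simp add: z_def)
  have h: "h \<in> SU2" by (simp add: SU2_iff e cz z2)
  have mh: "entry_monomial q q 0 0 (h ** g) = (1 / 2) ^ q * ((g$1$1 + g$2$1) ^ q * (g$1$2 + g$2$2) ^ q)" for g
  proof -
    have "entry_monomial q q 0 0 (h ** g) = (z * z) ^ q * ((g$1$1 + g$2$1) ^ q * (g$1$2 + g$2$2) ^ q)"
      by (simp add: entry_monomial_def matrix_mult_2 e power_mult_distrib flip: distrib_left)
    then show ?thesis by (simp only: z2)
  qed
  have "(\<Sum>(i, j)\<in>{..q}\<times>{..q}. (of_nat (q choose i) * of_nat (q choose j)) * (LINT g|\<mu>. entry_monomial i j (q - i) (q - j) g))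
     = (LINT g|\<mu>. (g$1$1 + g$2$1) ^ q * (g$1$2 + g$2$2) ^ q)"
  proof -
    have "(g$1$1 + g$2$1) ^ q * (g$1$2 + g$2$2) ^ q = (\<Sum>x\<in>{..q}\<times>{..q}.
        (of_nat (q choose fst x) * of_nat (q choose snd x)) * entry_monomial (fst x) (snd x) (q - fst x) (q - snd x) g)" for g
      by (simp add: binomial_ring sum_product sum.cartesian_product case_prod_unfold entry_monomial_def mult_ac)
    then show ?thesis by (simp add: integral_sum_entry_monomial case_prod_unfold)
  qed
  also have "\<dots> = 0"
  proof -
    have "0 = (LINT g|\<mu>. entry_monomial q q 0 0 g)" using q by (subst integral_entry_monomial_0) auto
    also have "\<dots> = (LINT g|\<mu>. entry_monomial q q 0 0 (h ** g))" by (rule integral_translate[OF h measurable_entry_monomial, symmetric])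
    also have "\<dots> = (1 / 2) ^ q * (LINT g|\<mu>. (g$1$1 + g$2$1) ^ q * (g$1$2 + g$2$2) ^ q)" unfolding mh by simp
    finally show ?thesis by simp
  qed
  also have "(\<Sum>(i, j)\<in>{..q}\<times>{..q}. (of_nat (q choose i) * of_nat (q choose j)) * (LINT g|\<mu>. entry_monomial i j (q - i) (q - j) g))
     = (\<Sum>(i, j)\<in>(\<lambda>i. (q - i, i)) ` {..q}. (of_nat (q choose i) * of_nat (q choose j)) * (LINT g|\<mu>. entry_monomial i j (q - i) (q - j) g))"
  proof (rule sum.mono_neutral_right)
    show "\<forall>x\<in>{..q} \<times> {..q} - (\<lambda>i. (q - i, i)) ` {..q}.
       (case x of (i, j) \<Rightarrow> (of_nat (q choose i) * of_nat (q choose j)) * (LINT g|\<mu>. entry_monomial i j (q - i) (q - j) g)) = 0"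
    proof safe
      fix i j assume ij: "i \<le> q" "j \<le> q" and n: "(i, j) \<notin> (\<lambda>i. (q - i, i)) ` {..q}"
      \<comment> \<open>Weight 0 means that the degrees in the two rows agree, that is
        \<open>i + j = q\<close>; all other pairs integrate to 0.\<close>
      have "i + j \<noteq> (q - i) + (q - j)"
      proof
        assume "i + j = (q - i) + (q - j)"
        then have "i = q - j" using ij by linarith
        with ij n show False by auto
      qed
      then show "of_nat (q choose i) * of_nat (q choose j) * (LINT g|\<mu>. entry_monomial i j (q - i) (q - j) g) = 0"
        by (simp add: integral_entry_monomial_0)
    qed
  qed auto
  also have "\<dots> = (\<Sum>i\<le>q. (of_nat (q choose (q - i)) * of_nat (q choose i)) * (LINT g|\<mu>. entry_monomial (q - i) i (q - (q - i)) (q - i) g))"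
    by (subst sum.reindex) (auto simp: inj_on_def)
  also have "\<dots> = (\<Sum>i\<le>q. (of_nat (q choose i) * of_nat (q choose i)) * (LINT g|\<mu>. entry_monomial (q - i) i i (q - i) g))"
    by (intro sum.cong refl) (simp add: binomial_symmetric[symmetric])
  also have "\<dots> = (LINT g|\<mu>. sym_diag (g$1$1) (g$1$2) (g$2$1) (g$2$2) p q)"
    unfolding True sym_diag_entry_monomial integral_sum_entry_monomial ..
  finally show ?thesis .
qed

lemma measurable_tr_Sym: "tr_Sym k \<in> borel_measurable \<mu>"
proof -
  have "tr_Sym k = (\<lambda>g. \<Sum>j\<le>k. \<Sum>i\<le>j. of_nat (k - j choose i) * of_nat (j choose i) * entry_monomial (k - j - i) i i (j - i) g)"
    by (intro ext) (simp add: tr_Sym_eq sym_diag_entry_monomial)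
  then show ?thesis using measurable_entry_monomial by simp
qed

lemma integrable_tr_Sym: "integrable \<mu> (tr_Sym k)"
  by (rule integrable_bounded[OF measurable_tr_Sym norm_tr_Sym_le])

lemma integral_tr_Sym: "(LINT g|\<mu>. tr_Sym k g) = (if k = 0 then 1 else 0)"
proof (cases "k = 0")
  case True
  then show ?thesis by (simp add: tr_Sym_0 prob_space)
next
  case False
  have "(LINT g|\<mu>. tr_Sym k g) = (\<Sum>i\<le>k. LINT g|\<mu>. sym_diag (g$1$1) (g$1$2) (g$2$1) (g$2$2) (k - i) i)"
    unfolding tr_Sym_eq
    by (subst Bochner_Integration.integral_sum) (auto simp: sym_diag_entry_monomial intro!: integrable_mult_right integrable_entry_monomial)
  also have "\<dots> = 0" using False by (intro sum.neutral ballI integral_sym_diag) auto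
  finally show ?thesis using False by simp
qed

lemma integrable_tr_Sym2: "integrable \<mu> (\<lambda>g. tr_Sym a g * tr_Sym b g)"
proof (rule integrable_bounded[of _ "real (Suc a) * real (Suc b)"])
  show "(\<lambda>g. tr_Sym a g * tr_Sym b g) \<in> borel_measurable \<mu>" using measurable_tr_Sym by measurable
qed (auto simp: norm_mult simp del: of_nat_Suc intro!: mult_mono norm_tr_Sym_le)

text \<open>Only the trivial character has a nonzero integral, and it occurs in the Clebsch-Gordan
  sum exactly when \<open>a = b\<close>, then once, at \<open>j = b\<close>.\<close>

lemma integral_tr_Sym2: "(LINT g|\<mu>. tr_Sym a g * tr_Sym b g) = (if a = b then 1 else 0)"
proof -
  have le: "(LINT g|\<mu>. tr_Sym a g * tr_Sym b g) = (if a = b then 1 else 0)" if "b \<le> a" for a b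
  proof -
    have "(LINT g|\<mu>. tr_Sym a g * tr_Sym b g) = (LINT g|\<mu>. (\<Sum>j\<le>b. tr_Sym (a + b - 2 * j) g))"
      by (intro Bochner_Integration.integral_cong refl tr_Sym_clebsch_gordan that) (simp add: space_eq)
    also have "\<dots> = (\<Sum>j\<le>b. if a + b - 2 * j = 0 then 1 else 0)"
      by (subst Bochner_Integration.integral_sum) (auto intro: integrable_tr_Sym simp: integral_tr_Sym)
    also have "\<dots> = (\<Sum>j\<le>b. if j = b \<and> a = b then 1 else 0)"
      using that by (intro sum.cong refl) auto
    also have "\<dots> = (if a = b then 1 else 0)" by (cases "a = b") auto
    finally show ?thesis .
  qed
  show ?thesis using le[of a b] le[of b a] by (cases "a \<le> b") (auto simp: mult.commute)
qed

lemma integral_tr_Sym3: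
  "(LINT g|\<mu>. tr_Sym x g * tr_Sym y g * tr_Sym z g) = (if (x, y, z) \<in> range triangle then 1 else 0)"
proof -
  have le: "(LINT g|\<mu>. tr_Sym x g * tr_Sym y g * tr_Sym z g) = (if \<exists>j\<le>y. x + y - 2 * j = z then 1 else 0)" if "y \<le> x" for x y
  proof -
    have "(LINT g|\<mu>. tr_Sym x g * tr_Sym y g * tr_Sym z g) = (LINT g|\<mu>. (\<Sum>j\<le>y. tr_Sym (x + y - 2 * j) g * tr_Sym z g))"
      by (intro Bochner_Integration.integral_cong refl)
        (simp add: space_eq tr_Sym_clebsch_gordan that sum_distrib_right)
    also have "\<dots> = (\<Sum>j\<le>y. if x + y - 2 * j = z then 1 else 0)"
      by (subst Bochner_Integration.integral_sum) (auto intro: integrable_tr_Sym2 simp: integral_tr_Sym2)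
    also have "\<dots> = (if \<exists>j\<le>y. x + y - 2 * j = z then 1 else 0)"
    proof (cases "\<exists>j\<le>y. x + y - 2 * j = z")
      case True
      then obtain k where k: "k \<le> y" "x + y - 2 * k = z" by blast
      have "(\<Sum>j\<le>y. if x + y - 2 * j = z then 1 else 0 :: complex) = (\<Sum>j\<le>y. if j = k then 1 else 0)"
        using k that by (intro sum.cong refl) auto
      with True k(1) show ?thesis by simp
    qed (auto intro!: sum.neutral)
    finally show ?thesis .
  qed
  have triangle: "(x, y, z) \<in> range triangle \<longleftrightarrow> (\<exists>j\<le>y. x + y - 2 * j = z)" if "y \<le> x" for x y
  proof
    assume "(x, y, z) \<in> range triangle"
    then obtain a b c where "x = a + b" "y = b + c" "z = c + a" by (auto simp: triangle_def)
    then show "\<exists>j\<le>y. x + y - 2 * j = z" by (intro exI[of _ b]) auto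
  next
    assume "\<exists>j\<le>y. x + y - 2 * j = z"
    then obtain j where "j \<le> y" "x + y - 2 * j = z" by blast
    \<comment> \<open>The Clebsch-Gordan index \<open>j\<close> is the parameter \<open>b\<close>;
      then \<open>a = x - j\<close> and \<open>c = y - j\<close> are forced.\<close>
    with that show "(x, y, z) \<in> range triangle"
      by (intro image_eqI[of _ _ "(x - j, j, y - j)"]) (auto simp: triangle_def)
  qed
  have swap: "(y, x, z) \<in> range triangle \<longleftrightarrow> (x, y, z) \<in> range triangle"
  proof -
    have "(y, x, z) \<in> range triangle" if "(x, y, z) \<in> range triangle" for x y
    proof -
      from that obtain a b c where "x = a + b" "y = b + c" "z = c + a" by (auto simp: triangle_def)
      then show ?thesis by (intro image_eqI[of _ _ "(c, b, a)"]) (auto simp: triangle_def)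
    qed
    then show ?thesis by blast
  qed
  show ?thesis
  proof (cases "y \<le> x")
    case True
    then show ?thesis by (simp add: le triangle)
  next
    case False
    then have "(LINT g|\<mu>. tr_Sym y g * tr_Sym x g * tr_Sym z g) = (if (y, x, z) \<in> range triangle then 1 else 0)"
      by (simp add: le triangle)
    then show ?thesis unfolding swap by (simp add: mult_ac)
  qed
qed

end

section \<open>The integral of the cube of the L-function\<close>

lemma filterlim_cube_finite_subsets:
  "filterlim (\<lambda>N. {..<N} \<times> {..<N} \<times> {..<N}) (finite_subsets_at_top (UNIV :: (nat \<times> nat \<times> nat) set)) sequentially"
  unfolding filterlim_finite_subsets_at_top
proof (intro allI impI)
  fix X :: "(nat \<times> nat \<times> nat) set"
  assume "finite X \<and> X \<subseteq> UNIV"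
  then have fin: "finite X" by simp
  define M where "M = Max ((\<lambda>(x, y, z). x + y + z) ` X)"
  have M: "x + y + z \<le> M" if "(x, y, z) \<in> X" for x y z
    unfolding M_def by (rule Max_ge) (use fin imageI[OF that, of "\<lambda>(x, y, z). x + y + z"] in auto)
  show "\<forall>\<^sub>F N in sequentially. finite ({..<N} \<times> {..<N} \<times> {..<N}) \<and>
      X \<subseteq> {..<N} \<times> {..<N} \<times> {..<N} \<and> {..<N} \<times> {..<N} \<times> {..<N} \<subseteq> UNIV"
    using eventually_gt_at_top[of M]
  proof eventually_elim
    case (elim N)
    have "X \<subseteq> {..<N} \<times> {..<N} \<times> {..<N}"
    proof
      fix t assume "t \<in> X"
      moreover obtain x y z where "t = (x, y, z)" by (cases t)
      ultimately show "t \<in> {..<N} \<times> {..<N} \<times> {..<N}"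
        using M[of x y z] elim by auto
    qed
    then show ?case by simp
  qed
qed

context haar_SU2
begin

text \<open>The dimension bound for the character costs one power of \<open>n\<close>, which cancels
  the 1 in the exponent \<open>s + 1\<close>. Hence the convergence is uniform in \<open>g\<close>
  for \<open>Re s > 1\<close>.\<close>

lemma witten_term_bound:
  assumes "g \<in> SU2"
  shows "norm (cpow 1 s (Suc n) * tr_Sym n g) \<le> real (Suc n) powr - Re s"
proof -
  have "norm (cpow 1 s (Suc n) * tr_Sym n g) \<le> real (Suc n) powr (- Re s - of_int 1) * real (Suc n) powr 1"
    unfolding norm_mult using norm_tr_Sym_le[OF assms, of n] by (subst norm_cpow) (auto intro!: mult_mono)
  also have "\<dots> = real (Suc n) powr - Re s" by (subst powr_add[symmetric]) simp
  finally show ?thesis .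
qed

lemma witten_L_sums:
  assumes g: "g \<in> SU2" and s: "Re s > 1"
  shows "(\<lambda>n. cpow 1 s (Suc n) * tr_Sym n g) sums witten_L_SU2 s g"
proof -
  have "witten_L_SU2 s g = (\<Sum>\<^sub>\<infinity>n\<in>{1..}. cpow 1 s n * tr_Sym (n - 1) g)"
    unfolding witten_L_SU2_def
    by (intro infsum_cong) (simp add: cpow_def powr_minus_divide[symmetric] divide_inverse powr_minus[symmetric])
  also have "\<dots> = (\<Sum>\<^sub>\<infinity>n. cpow 1 s (Suc n) * tr_Sym n g)"
    by (rule infsum_reindex_bij_witness[of _ Suc "\<lambda>n. n - 1"]) auto
  finally have "witten_L_SU2 s g = \<dots>" .
  moreover have "(\<lambda>n. cpow 1 s (Suc n) * tr_Sym n g) summable_on UNIV"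
  proof (rule abs_summable_summable, rule summable_on_comparison_test)
    show "(\<lambda>n. real (Suc n) powr - Re s) summable_on UNIV" using s by (rule summable_powr_Suc)
  qed (use witten_term_bound[OF g] in auto)
  ultimately show ?thesis by (metis has_sum_imp_sums has_sum_infsum)
qed

lemma cube_integral:
  "(LINT g|\<mu>. (\<Sum>n<N. cpow 1 s (Suc n) * tr_Sym n g) ^ 3) =
    (\<Sum>(x, y, z)\<in>{..<N} \<times> {..<N} \<times> {..<N}. if (x, y, z) \<in> range triangle
       then cpow 1 s (Suc x) * cpow 1 s (Suc y) * cpow 1 s (Suc z) else 0)"
proof -
  let ?c = "\<lambda>n. cpow 1 s (Suc n)"
  have "(\<Sum>n<N. ?c n * tr_Sym n g) ^ 3 = (\<Sum>x\<in>{..<N} \<times> {..<N} \<times> {..<N}.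
      (?c (fst x) * ?c (fst (snd x)) * ?c (snd (snd x))) * (tr_Sym (fst x) g * tr_Sym (fst (snd x)) g * tr_Sym (snd (snd x)) g))" for g
  proof -
    have "(\<Sum>n<N. ?c n * tr_Sym n g) ^ 3 = (\<Sum>x<N. \<Sum>y<N. \<Sum>z<N.
        (?c x * ?c y * ?c z) * (tr_Sym x g * tr_Sym y g * tr_Sym z g))"
      by (simp add: power3_eq_cube sum_product sum_distrib_left sum_distrib_right mult_ac)
    then show ?thesis by (simp only: sum.cartesian_product case_prod_unfold)
  qed
  moreover have "integrable \<mu> (\<lambda>g. tr_Sym x g * tr_Sym y g * tr_Sym z g)" for x y z
  proof (rule integrable_bounded[of _ "real (Suc x) * real (Suc y) * real (Suc z)"])
    show "(\<lambda>g. tr_Sym x g * tr_Sym y g * tr_Sym z g) \<in> borel_measurable \<mu>" using measurable_tr_Sym by measurable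
  qed (auto simp: norm_mult simp del: of_nat_Suc intro!: mult_mono norm_tr_Sym_le)
  ultimately show ?thesis
    by (simp add: integral_tr_Sym3 case_prod_unfold if_distrib cong: if_cong)
qed

text \<open>The triple series is reindexed by the injective map \<open>triangle\<close> and extended
  by 0 to all triples. Cubes exhaust every finite index set, so the sums over cubes tend to the
  unordered sum.\<close>

lemma cube_sum_tendsto:
  assumes s: "Re s > 0"
  shows "(\<lambda>N. \<Sum>(x, y, z)\<in>{..<N} \<times> {..<N} \<times> {..<N}. if (x, y, z) \<in> range triangle
       then cpow 1 s (Suc x) * cpow 1 s (Suc y) * cpow 1 s (Suc z) else 0) \<longlonglongrightarrow> witten_series s"
proof -
  let ?f = "\<lambda>(x, y, z). cpow 1 s (Suc x) * cpow 1 s (Suc y) * cpow 1 s (Suc z)"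
  let ?g = "\<lambda>(x, y, z). if (x, y, z) \<in> range triangle then cpow 1 s (Suc x) * cpow 1 s (Suc y) * cpow 1 s (Suc z) else 0"
  have "((\<lambda>(a, b, c). cpow 1 s (Suc (a + b)) * cpow 1 s (Suc (b + c)) * cpow 1 s (Suc (c + a))) has_sum witten_series s) UNIV"
    unfolding witten_series_def triangle_sum_def
    by (rule has_sum_infsum, rule abs_summable_summable)
      (use witten_series_summable[OF s] in \<open>simp add: case_prod_unfold\<close>)
  then have "(?f \<circ> triangle has_sum witten_series s) UNIV"
    by (simp add: o_def triangle_def case_prod_unfold)
  then have "(?f has_sum witten_series s) (range triangle)"
    by (subst has_sum_reindex[OF inj_triangle])
  then have "(?g has_sum witten_series s) UNIV"
    by (subst has_sum_cong_neutral[where T = "range triangle" and g = ?f]) auto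
  then show ?thesis
    unfolding has_sum_def by (rule filterlim_compose[OF _ filterlim_cube_finite_subsets])
qed

text \<open>The cube of a partial sum is a finite combination of triple products of characters, so
  its integral is explicit. All these cubes are bounded by the constant \<open>B ^ 3\<close>, which
  is integrable for a probability measure; dominated convergence gives both claims.\<close>

lemma witten_cube:
  assumes s: "Re s > 1"
  shows "integrable \<mu> (\<lambda>g. witten_L_SU2 s g ^ 3)" "(LINT g|\<mu>. witten_L_SU2 s g ^ 3) = witten_series s"
proof -
  define P where "P = (\<lambda>N g. (\<Sum>n<N. cpow 1 s (Suc n) * tr_Sym n g) ^ 3)"
  define B where "B = (\<Sum>n. real (Suc n) powr - Re s)"
  have sm: "summable (\<lambda>n. real (Suc n) powr - Re s)"
    by (rule summable_on_imp_summable[OF summable_powr_Suc[OF s]])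
  have P_meas: "P N \<in> borel_measurable \<mu>" for N
    unfolding P_def using measurable_tr_Sym by measurable
  have lim: "(\<lambda>N. P N g) \<longlonglongrightarrow> witten_L_SU2 s g ^ 3" if "g \<in> space \<mu>" for g
    using witten_L_sums[OF _ s, of g] that unfolding P_def sums_def space_eq by (intro tendsto_power) auto
  have meas: "(\<lambda>g. witten_L_SU2 s g ^ 3) \<in> borel_measurable \<mu>"
    by (rule borel_measurable_LIMSEQ_metric[OF P_meas lim])
  have bound: "norm (P N g) \<le> B ^ 3" if "g \<in> space \<mu>" for N g
  proof -
    have "norm (\<Sum>n<N. cpow 1 s (Suc n) * tr_Sym n g) \<le> (\<Sum>n<N. real (Suc n) powr - Re s)"
      using that unfolding space_eq by (intro sum_norm_le witten_term_bound)
    also have "\<dots> \<le> B" unfolding B_def by (intro sum_le_suminf sm) auto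
    finally show ?thesis unfolding P_def norm_power by (intro power_mono) auto
  qed
  note dom = integral_dominated_convergence[of "\<lambda>g. witten_L_SU2 s g ^ 3" \<mu> P "\<lambda>_. B ^ 3"]
    integrable_dominated_convergence[of "\<lambda>g. witten_L_SU2 s g ^ 3" \<mu> P "\<lambda>_. B ^ 3"]
  show "integrable \<mu> (\<lambda>g. witten_L_SU2 s g ^ 3)"
    by (rule dom(2)) (use meas P_meas lim bound in auto)
  have "(\<lambda>N. LINT g|\<mu>. P N g) \<longlonglongrightarrow> (LINT g|\<mu>. witten_L_SU2 s g ^ 3)"
    by (rule dom(1)) (use meas P_meas lim bound in auto)
  moreover have "(\<lambda>N. LINT g|\<mu>. P N g) \<longlonglongrightarrow> witten_series s"
    unfolding P_def cube_integral using s by (intro cube_sum_tendsto) auto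
  ultimately show "(LINT g|\<mu>. witten_L_SU2 s g ^ 3) = witten_series s"
    by (rule LIMSEQ_unique)
qed

end


theorem theorem3p3:
  fixes \<mu> :: "(complex^2^2) measure"
  assumes haar: "normalized_haar_SU2 \<mu>"
  shows "\<exists>Z :: complex \<Rightarrow> complex.
    Z meromorphic_on UNIV \<and>
    Z holomorphic_on {s. Re s > 0} \<and>
    (\<forall>s. Re s > 1 \<longrightarrow>
       integrable \<mu> (\<lambda>g. witten_L_SU2 s g ^ 3) \<and>
       Z s = (LINT g|\<mu>. witten_L_SU2 s g ^ 3)) \<and>
    (\<forall>s. Re s > 0 \<longrightarrow>
       (\<lambda>(m1, m2, m3). norm (of_nat ((m1 + m2 + 1) * (m2 + m3 + 1) * (m3 + m1 + 1)) powr (- s - 1)))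
         summable_on (UNIV :: (nat \<times> nat \<times> nat) set) \<and>
       Z s = (\<Sum>\<^sub>\<infinity>(m1, m2, m3)\<in>(UNIV :: (nat \<times> nat \<times> nat) set).
               of_nat ((m1 + m2 + 1) * (m2 + m3 + 1) * (m3 + m1 + 1)) powr (- s - 1)))"
proof -
  interpret haar_SU2 \<mu> by (unfold_locales) (rule haar)
  obtain Z where Z: "Z meromorphic_on UNIV" "\<And>s. Re s > 0 \<Longrightarrow> Z s = witten_series s"
    using witten_series_continuation by blast
  have "Z holomorphic_on {s. Re s > 0}"
    by (rule holomorphic_transform[OF witten_series_holomorphic]) (simp add: Z(2))
  moreover have "integrable \<mu> (\<lambda>g. witten_L_SU2 s g ^ 3) \<and> Z s = (LINT g|\<mu>. witten_L_SU2 s g ^ 3)"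
    if "Re s > 1" for s
    using that witten_cube[OF that] by (simp add: Z(2))
  moreover have "(\<lambda>(m1, m2, m3). norm (of_nat ((m1 + m2 + 1) * (m2 + m3 + 1) * (m3 + m1 + 1)) powr (- s - 1) :: complex))
      summable_on (UNIV :: (nat \<times> nat \<times> nat) set) \<and>
     Z s = (\<Sum>\<^sub>\<infinity>(m1, m2, m3)\<in>(UNIV :: (nat \<times> nat \<times> nat) set).
       of_nat ((m1 + m2 + 1) * (m2 + m3 + 1) * (m3 + m1 + 1)) powr (- s - 1))" if "Re s > 0" for s
    using witten_series_summable[OF that] Z(2)[OF that] unfolding witten_series_term witten_series_def triangle_sum_def by blast
  ultimately show ?thesis using Z(1) by blast
qed

end
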